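(* Let $X=A(x,y)\frac{\partial}{\partial x}+B(x,y)\frac{\partial}{\partial y}$ be a singular holomorphic vector field at $(\mathbb{C}^2,0)$ and let $\Gamma$ be an analytic branch at $(\mathbb{C}^2,0)$ with multiplicity $n$, not invariant for $X$. Let $\omega=-B(x,y)\,dx+A(x,y)\,dy$ be the "dual" differential form of $X$. Then $$\upsilon_\Gamma(\omega)=(X,\Gamma)_{(0,0)}+n .$$
   Context: A branch is a reduced irreducible germ of analytic curve $\Gamma=(f=0)$ at $(0,0)$. $X$ singular means $A(0,0)=B(0,0)=0$. $\Gamma$ is invariant for $X$ if $X(f)\in(f)$. Contact with a form: if $(x(t),y(t))$ is an irreducible (i.e. primitive) parametrization of $\Gamma$ and $\omega=a\,dx+b\,dy$, then $\upsilon_\Gamma(\omega)=\mathrm{ord}_t\big(a(x(t),y(t))\dot x(t)+b(x(t),y(t))\dot y(t)\big)+1$. Deformation: let $\{\psi_s\}_{s\in\mathbb{C}}$ be the one-parameter group of $X$; the deformation of $\Gamma$ by $X$ is $\Gamma_\epsilon=\psi_{-\epsilon}(\Gamma)=(f\circ\psi_\epsilon=0)$. Contact exponent $(X,\Gamma)_{(0,0)}$: choose coordinates in which the tangent cone of $\Gamma$ is not the $OY$ axis $x=0$, and let $(t^n,\sum_{i\ge n}a_it^i)$ be an irreducible Puiseux parametrization of $\Gamma$. For $\epsilon$ small enough, $\Gamma_\epsilon$ admits an irreducible Puiseux parametrization $(t^n,\sum_{i\ge n}\tilde a_i(\epsilon)t^i)$ with $\tilde a_i$ holomorphic in $\epsilon$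 and $\tilde a_i(0)=a_i$ for all $i\ge n$. Then $(X,\Gamma)_{(0,0)}$ is the least $i$ such that $\tilde a_i(\epsilon)$ is not constant (it does not depend on the choice of such coordinates or of the Puiseux parametrization). *)

theory Defs
  imports "HOL-Complex_Analysis.Complex_Analysis" "HOL-Library.Extended_Nat"
begin

text \<open>
  Germs at the origin of \<open>\<complex>\<^sup>2\<close> are represented by total functions on \<^typ>\<open>complex \<times> complex\<close>
  that are only constrained near \<open>0 = (0, 0)\<close>; identities of germs are \<open>\<forall>\<^sub>F p in nhds 0\<close>.
\<close>

definition holo2_at :: "(complex \<times> complex \<Rightarrow> complex) \<Rightarrow> complex \<times> complex \<Rightarrow> bool" where
  "holo2_at F p \<longleftrightarrow> (\<exists>a b. (F has_derivative (\<lambda>v. a * fst v + b * snd v)) (at p))"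

definition holo3_at ::
  "(complex \<times> complex \<times> complex \<Rightarrow> complex) \<Rightarrow> complex \<times> complex \<times> complex \<Rightarrow> bool" where
  "holo3_at F q \<longleftrightarrow>
     (\<exists>a b c. (F has_derivative (\<lambda>v. a * fst v + b * fst (snd v) + c * snd (snd v))) (at q))"

definition holo_germ :: "(complex \<times> complex \<Rightarrow> complex) \<Rightarrow> bool" where
  "holo_germ F \<longleftrightarrow> (\<forall>\<^sub>F p in nhds 0. holo2_at F p)"

text \<open>A branch \<open>f = 0\<close>: \<open>f\<close> is an irreducible element of the ring of holomorphic germs.\<close>

definition branch :: "(complex \<times> complex \<Rightarrow> complex) \<Rightarrow> bool" where
  "branch f \<longleftrightarrow> holo_germ f \<and> f 0 = 0 \<and> \<not> (\<forall>\<^sub>F p in nhds 0. f p = 0) \<and>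
     (\<forall>g h. holo_germ g \<longrightarrow> holo_germ h \<longrightarrow> (\<forall>\<^sub>F p in nhds 0. f p = g p * h p) \<longrightarrow>
        g 0 \<noteq> 0 \<or> h 0 \<noteq> 0)"

text \<open>
  The value at \<open>v\<close> of the homogeneous part of degree \<open>k\<close> of the Taylor series of \<open>f\<close> at the
  origin is the coefficient of \<open>t\<^sup>k\<close> in \<open>f (t v)\<close>.
\<close>

definition hom_part ::
  "(complex \<times> complex \<Rightarrow> complex) \<Rightarrow> nat \<Rightarrow> complex \<times> complex \<Rightarrow> complex" where
  "hom_part f k v = fps_nth (fps_expansion (\<lambda>t. f (t * fst v, t * snd v)) 0) k"

definition curve_multiplicity :: "(complex \<times> complex \<Rightarrow> complex) \<Rightarrow> nat" where
  "curve_multiplicity f = (LEAST k. \<exists>v. hom_part f k v \<noteq> 0)"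

definition tangent_cone :: "(complex \<times> complex \<Rightarrow> complex) \<Rightarrow> (complex \<times> complex) set" where
  "tangent_cone f = {v. hom_part f (curve_multiplicity f) v = 0}"

text \<open>The derivation \<open>A \<partial>/\<partial>x + B \<partial>/\<partial>y\<close> applied to \<open>f\<close>.\<close>

definition apply_vf ::
  "(complex \<times> complex \<Rightarrow> complex) \<Rightarrow> (complex \<times> complex \<Rightarrow> complex) \<Rightarrow>
   (complex \<times> complex \<Rightarrow> complex) \<Rightarrow> complex \<times> complex \<Rightarrow> complex" where
  "apply_vf A B f p =
     A p * deriv (\<lambda>x. f (x, snd p)) (fst p) + B p * deriv (\<lambda>y. f (fst p, y)) (snd p)"

definition invariant_curve ::
  "(complex \<times> complex \<Rightarrow> complex) \<Rightarrow> (complex \<times> complex \<Rightarrow> complex) \<Rightarrow>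
   (complex \<times> complex \<Rightarrow> complex) \<Rightarrow> bool" where
  "invariant_curve A B f \<longleftrightarrow>
     (\<exists>g. holo_germ g \<and> (\<forall>\<^sub>F p in nhds 0. apply_vf A B f p = g p * f p))"

definition germ_ord :: "(complex \<Rightarrow> complex) \<Rightarrow> enat" where
  "germ_ord h =
     (if \<forall>\<^sub>F t in nhds 0. h t = 0 then \<infinity> else enat (subdegree (fps_expansion h 0)))"

text \<open>
  A parametrization is irreducible (primitive) if it does not factor through a
  reparametrization \<open>\<tau>\<close> of order at least 2. (Constant maps factor through \<open>\<tau> = 0\<close>.)
\<close>

definition irreducible_param ::
  "(complex \<times> complex \<Rightarrow> complex) \<Rightarrow> (complex \<Rightarrow> complex) \<Rightarrow> (complex \<Rightarrow> complex) \<Rightarrow> bool" where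
  "irreducible_param f x y \<longleftrightarrow>
     x analytic_on {0} \<and> y analytic_on {0} \<and> x 0 = 0 \<and> y 0 = 0 \<and>
     (\<forall>\<^sub>F t in nhds 0. f (x t, y t) = 0) \<and>
     \<not> (\<exists>u v \<tau>. u analytic_on {0} \<and> v analytic_on {0} \<and> \<tau> analytic_on {0} \<and>
          \<tau> 0 = 0 \<and> deriv \<tau> 0 = 0 \<and> (\<forall>\<^sub>F t in nhds 0. x t = u (\<tau> t) \<and> y t = v (\<tau> t)))"

text \<open>
  The 1-form \<open>a dx + b dy\<close> is given by the pair \<open>(a, b)\<close>; its contact is computed along a
  parametrization \<open>(x, y)\<close>.
\<close>

definition form_contact ::
  "(complex \<Rightarrow> complex) \<Rightarrow> (complex \<Rightarrow> complex) \<Rightarrow>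
   (complex \<times> complex \<Rightarrow> complex) \<times> (complex \<times> complex \<Rightarrow> complex) \<Rightarrow> enat" where
  "form_contact x y \<omega> =
     germ_ord (\<lambda>t. fst \<omega> (x t, y t) * deriv x t + snd \<omega> (x t, y t) * deriv y t) + 1"

definition dual_form ::
  "(complex \<times> complex \<Rightarrow> complex) \<Rightarrow> (complex \<times> complex \<Rightarrow> complex) \<Rightarrow>
   (complex \<times> complex \<Rightarrow> complex) \<times> (complex \<times> complex \<Rightarrow> complex)" where
  "dual_form A B = ((\<lambda>p. - B p), A)"

text \<open>
  The flow of a singular vector field: each \<open>\<psi> s\<close> is a germ at the origin. The neighbourhood
  on which \<open>\<psi> s\<close> is meaningful may shrink as \<open>s\<close> grows.
\<close>

definition one_parameter_group ::
  "(complex \<times> complex \<Rightarrow> complex) \<Rightarrow> (complex \<times> complex \<Rightarrow> complex) \<Rightarrow>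
   (complex \<Rightarrow> complex \<times> complex \<Rightarrow> complex \<times> complex) \<Rightarrow> bool" where
  "one_parameter_group A B \<psi> \<longleftrightarrow>
     (\<forall>\<^sub>F p in nhds 0. \<psi> 0 p = p) \<and>
     (\<forall>s\<^sub>0. \<forall>\<^sub>F (s, p) in nhds (s\<^sub>0, 0).
        holo3_at (\<lambda>(\<sigma>, q). fst (\<psi> \<sigma> q)) (s, p) \<and>
        holo3_at (\<lambda>(\<sigma>, q). snd (\<psi> \<sigma> q)) (s, p) \<and>
        ((\<lambda>\<sigma>. fst (\<psi> \<sigma> p)) has_field_derivative A (\<psi> s p)) (at s) \<and>
        ((\<lambda>\<sigma>. snd (\<psi> \<sigma> p)) has_field_derivative B (\<psi> s p)) (at s))"

definition local_biholo :: "(complex \<times> complex \<Rightarrow> complex \<times> complex) \<Rightarrow> bool" where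
  "local_biholo \<Theta> \<longleftrightarrow>
     holo_germ (fst \<circ> \<Theta>) \<and> holo_germ (snd \<circ> \<Theta>) \<and> \<Theta> 0 = 0 \<and>
     (\<exists>\<Phi>. holo_germ (fst \<circ> \<Phi>) \<and> holo_germ (snd \<circ> \<Phi>) \<and> \<Phi> 0 = 0 \<and>
        (\<forall>\<^sub>F p in nhds 0. \<Phi> (\<Theta> p) = p) \<and> (\<forall>\<^sub>F p in nhds 0. \<Theta> (\<Phi> p) = p))"

text \<open>
  An irreducible Puiseux parametrization \<open>(t\<^sup>n, \<Sum>\<^bsub>i\<ge>n\<^esub> S\<^sub>i t\<^sup>i)\<close> of \<open>f = 0\<close>.
\<close>

definition puiseux_param ::
  "(complex \<times> complex \<Rightarrow> complex) \<Rightarrow> nat \<Rightarrow> complex fps \<Rightarrow> bool" where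
  "puiseux_param f n S \<longleftrightarrow>
     fps_conv_radius S > 0 \<and> (\<forall>i<n. fps_nth S i = 0) \<and>
     irreducible_param f (\<lambda>t. t ^ n) (eval_fps S)"

text \<open>
  The contact exponent of \<open>A \<partial>/\<partial>x + B \<partial>/\<partial>y\<close> with the branch \<open>f = 0\<close>. Here \<open>\<Theta>\<close> expresses the
  original coordinates in the chosen ones, so the deformed curve
  \<open>\<psi>\<^bsub>-\<epsilon>\<^esub>(\<Gamma>) = (f \<circ> \<psi>\<^bsub>\<epsilon>\<^esub> = 0)\<close> has equation \<open>f \<circ> \<psi>\<^bsub>\<epsilon>\<^esub> \<circ> \<Theta> = 0\<close> in them; \<open>S \<epsilon>\<close> is the Puiseux
  series of that curve, and \<open>S 0\<close> that of the undeformed one. The value is \<open>\<infinity>\<close> if all the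
  coefficients are constant.
\<close>

definition has_contact_exponent ::
  "(complex \<times> complex \<Rightarrow> complex) \<Rightarrow> (complex \<times> complex \<Rightarrow> complex) \<Rightarrow>
   (complex \<times> complex \<Rightarrow> complex) \<Rightarrow> enat \<Rightarrow> bool" where
  "has_contact_exponent A B f k \<longleftrightarrow>
     (\<exists>\<psi> \<Theta> S \<delta>.
        one_parameter_group A B \<psi> \<and> local_biholo \<Theta> \<and>
        tangent_cone (f \<circ> \<Theta>) \<noteq> {v. fst v = 0} \<and> \<delta> > 0 \<and>
        (\<forall>\<epsilon>\<in>ball 0 \<delta>. puiseux_param (f \<circ> \<psi> \<epsilon> \<circ> \<Theta>) (curve_multiplicity f) (S \<epsilon>)) \<and>
        (\<forall>i. (\<lambda>\<epsilon>. fps_nth (S \<epsilon>) i) holomorphic_on ball 0 \<delta>) \<and>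
        k = Inf (enat ` {i. \<not> (\<lambda>\<epsilon>. fps_nth (S \<epsilon>) i) constant_on ball 0 \<delta>}))"

end

theory Submission
  imports Defs
begin

text \<open>
  Write the deformed curve at time \<open>\<epsilon>\<close> as \<open>c\<^sub>\<epsilon>(t) = \<psi>\<^sub>\<epsilon>(\<Theta>(t\<^sup>n, S\<^sub>\<epsilon>(t)))\<close>, so that
  \<open>f \<circ> c\<^sub>\<epsilon> = 0\<close>. Differentiating this in \<open>\<epsilon>\<close> and in \<open>t\<close>, the gradient of \<open>f\<close> along \<open>c\<^sub>\<epsilon>\<close> kills
  both \<open>X + \<partial>\<^sub>y(\<psi>\<^sub>\<epsilon> \<circ> \<Theta>) \<partial>\<^sub>\<epsilon>S\<^sub>\<epsilon>\<close> and the tangent vector of \<open>c\<^sub>\<epsilon>\<close>. Since \<open>f\<close> is reduced, its gradient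
  does not vanish identically on the curve, so these vectors are parallel, which says
  \<open>\<omega>(c\<^sub>\<epsilon>') = n t\<^bsup>n-1\<^esup> det D(\<psi>\<^sub>\<epsilon> \<circ> \<Theta>) \<partial>\<^sub>\<epsilon>S\<^sub>\<epsilon>\<close>. The map \<open>c\<^sub>\<epsilon>\<close> parametrizes the fixed curve \<open>f = 0\<close>, and all
  primitive parametrizations of an irreducible curve differ by a change of parameter, so the order
  of the left-hand side does not depend on \<open>\<epsilon>\<close>. Hence neither does the order of \<open>\<partial>\<^sub>\<epsilon>S\<^sub>\<epsilon>\<close>, and this
  order is the first index at which a coefficient of \<open>S\<^sub>\<epsilon>\<close> moves.

  Divisibility by the irreducible \<open>f\<close> is tested on the curve: a germ vanishing on \<open>(t\<^sup>n, s(t))\<close>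
  is, after \<open>x = t\<^sup>n\<close>, divisible by each of the distinct factors \<open>y - s(\<zeta>t)\<close> with \<open>\<zeta>\<^sup>n = 1\<close>, and
  their product and the quotient are invariant under \<open>t \<mapsto> \<zeta>t\<close>.
\<close>

section \<open>Holomorphic functions of two variables\<close>

text \<open>The contact exponent asks which coefficients are constant in \<epsilon>, not which have
  velocity zero at \<epsilon> = 0: a coefficient could start to move at second order. Hence the
  order of the velocity series is needed at every small time, with the same value. The numbers fit
  as follows: if \<omega> pulled back to the curve has order \<open>M\<close>, then t^(n-1) times
  the velocity series has order \<open>M\<close> too, so the first moving index is M + 1 - n, and
  the + 1 in the contact of a form supplies the rest. Non-invariance is what makes \<open>M\<close>
  finite. Holomorphy of the single coefficients does not license differentiating the whole series in
  \<epsilon>, so the velocity identity is obtained only modulo a power of t. The gradient of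
  \<open>f\<close> then has to be divided out: it is nonzero along the curve, but a component may
  vanish at the origin to some order e, so the precision must exceed e + M. Division of germs and
  descent through x = t^n are carried out analytically, with Cauchy's formula as the source of
  regularity.\<close>

definition pd1 :: "(complex \<times> complex \<Rightarrow> complex) \<Rightarrow> complex \<times> complex \<Rightarrow> complex" where
  "pd1 F p = deriv (\<lambda>x. F (x, snd p)) (fst p)"

definition pd2 :: "(complex \<times> complex \<Rightarrow> complex) \<Rightarrow> complex \<times> complex \<Rightarrow> complex" where
  "pd2 F p = deriv (\<lambda>y. F (fst p, y)) (snd p)"

text \<open>Continuity plus holomorphy in each variable can be verified slice by slice, which suits
  functions glued from several formulas. On open sets it amounts to joint complex differentiability
  (Osgood), see \<open>sep_holo_iff\<close>.\<close>

definition sep_holo :: "(complex \<times> complex \<Rightarrow> complex) \<Rightarrow> (complex \<times> complex) set \<Rightarrow> bool" where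
  "sep_holo F U \<longleftrightarrow> open U \<and> continuous_on U F \<and>
     (\<forall>p\<in>U. (\<lambda>x. F (x, snd p)) field_differentiable at (fst p)) \<and>
     (\<forall>p\<in>U. (\<lambda>y. F (fst p, y)) field_differentiable at (snd p))"

lemma sep_holoD:
  assumes "sep_holo F U"
  shows "open U" "continuous_on U F"
    "\<And>x y. (x, y) \<in> U \<Longrightarrow> (\<lambda>x. F (x, y)) field_differentiable at x"
    "\<And>x y. (x, y) \<in> U \<Longrightarrow> (\<lambda>y. F (x, y)) field_differentiable at y"
  using assms unfolding sep_holo_def by force+

lemma sep_holo_pd:
  assumes "sep_holo F U" "(x, y) \<in> U"
  shows "((\<lambda>x. F (x, y)) has_field_derivative pd1 F (x, y)) (at x)"
    "((\<lambda>y. F (x, y)) has_field_derivative pd2 F (x, y)) (at y)"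
  using sep_holoD(3,4)[OF assms] 
  by (auto simp: pd1_def pd2_def field_differentiable_derivI)

lemma sep_holo_holomorphic:
  assumes "sep_holo F U"
  shows "(\<And>x. x \<in> A \<Longrightarrow> (x, y) \<in> U) \<Longrightarrow> (\<lambda>x. F (x, y)) holomorphic_on A"
    "(\<And>y. y \<in> A \<Longrightarrow> (x, y) \<in> U) \<Longrightarrow> (\<lambda>y. F (x, y)) holomorphic_on A"
  using sep_holoD(3,4)[OF assms] unfolding holomorphic_on_def
  by (metis field_differentiable_at_within)+

lemma open_prod_cball:
  assumes "open U" "(x, y) \<in> (U :: (complex \<times> complex) set)"
  obtains r where "r > 0" "cball x r \<times> cball y r \<subseteq> U"
proof -
  obtain A B where AB: "open A" "open B" "x \<in> A" "y \<in> B" "A \<times> B \<subseteq> U"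
    using open_prod_elim[OF assms] by (metis mem_Sigma_iff)
  obtain r1 where r1: "r1 > 0" "cball x r1 \<subseteq> A" using AB(1,3) open_contains_cball_eq by meson
  obtain r2 where r2: "r2 > 0" "cball y r2 \<subseteq> B" using AB(2,4) open_contains_cball_eq by meson
  have "cball x (min r1 r2) \<times> cball y (min r1 r2) \<subseteq> cball x r1 \<times> cball y r2" by auto
  also have "\<dots> \<subseteq> U" using Sigma_mono[of "cball x r1" A "\<lambda>_. cball y r2" "\<lambda>_. B"] r1 r2 AB(5) by simp
  finally show ?thesis using that[of "min r1 r2"] r1 r2 by simp
qed

lemma sep_holo_swap: "sep_holo F U \<Longrightarrow> sep_holo (F \<circ> prod.swap) (prod.swap ` U)"
proof -
  assume F: "sep_holo F U"
  have sw: "prod.swap ` U = prod.swap -` U" by force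
  have c: "continuous_on UNIV (prod.swap :: complex \<times> complex \<Rightarrow> _)"
    unfolding prod.swap_def by (intro continuous_intros)
  have "open (prod.swap ` U)" unfolding sw
    using F c by (simp add: sep_holo_def open_vimage)
  moreover have "continuous_on (prod.swap ` U) (F \<circ> prod.swap)"
    by (rule continuous_on_compose) (use F c in \<open>auto simp: sep_holo_def image_image intro: continuous_on_subset\<close>)
  ultimately show ?thesis using F unfolding sep_holo_def by auto
qed

lemma pd1_swap: "pd1 F = pd2 (F \<circ> prod.swap) \<circ> prod.swap"
  by (auto simp: fun_eq_iff pd1_def pd2_def)

text \<open>Cauchy's formula in the second variable, unfolded to an integral over [0,1] on a circle
  that does not depend on the point, so that results on integrals with parameters apply.\<close>

lemma cauchy_pd2:
  assumes F: "sep_holo F U" and sub: "cball x0 r \<times> cball y0 r \<subseteq> U"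
    and x: "x \<in> cball x0 r" and y: "y \<in> ball y0 r"
  shows "pd2 F (x, y) = integral {0..1} (\<lambda>t. 1 / (2 * of_real pi * \<i>) *
     (F (x, circlepath y0 r t) / (circlepath y0 r t - y)^2 * (2 * pi * \<i> * r * exp (2 * of_real pi * \<i> * t))))"
proof -
  have mem: "(x, w) \<in> U" if "w \<in> cball y0 r" for w using that x sub by auto
  have c: "continuous_on (cball y0 r) (\<lambda>w. F (x, w))"
    by (rule continuous_on_compose2[OF sep_holoD(2)[OF F]]) (auto intro!: continuous_intros mem)
  have h: "(\<lambda>w. F (x, w)) holomorphic_on ball y0 r"
    by (rule sep_holo_holomorphic(2)[OF F]) (auto intro: mem)
  have "((\<lambda>w. F (x, w)) has_field_derivative (1 / (2 * of_real pi * \<i>) *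
     contour_integral (circlepath y0 r) (\<lambda>u. F (x, u) / (u - y)^2))) (at y)"
    by (rule Cauchy_derivative_integral_circlepath(2)[OF c h y])
  then have "pd2 F (x, y) = 1 / (2 * of_real pi * \<i>) *
     contour_integral (circlepath y0 r) (\<lambda>u. F (x, u) / (u - y)^2)"
    unfolding pd2_def by (simp add: DERIV_imp_deriv)
  then show ?thesis
    unfolding contour_integral_integral vector_derivative_circlepath integral_mult_right .
qed

lemma circlepath_in_sphere: "r > 0 \<Longrightarrow> circlepath y0 r t \<in> sphere y0 r"
  by (simp add: circlepath dist_norm norm_mult)

lemma continuous_circlepath[continuous_intros]:
  "continuous_on A f \<Longrightarrow> continuous_on A (\<lambda>t. circlepath y0 r (f t))"
  by (simp only: circlepath) (intro continuous_intros)

text \<open>In Cauchy's formula the integrand is jointly continuous in the point and the circle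
  parameter, and the integral inherits this.\<close>

lemma sep_holo_cont_pd2:
  assumes F: "sep_holo F U"
  shows "continuous_on U (pd2 F)"
proof -
  have "isCont (pd2 F) p" if "p \<in> U" for p
  proof -
    obtain x0 y0 where p: "p = (x0, y0)" by force
    obtain r where r: "r > 0" and sub: "cball x0 r \<times> cball y0 r \<subseteq> U"
      using open_prod_cball[OF sep_holoD(1)[OF F]] \<open>p \<in> U\<close> p by metis
    let ?V = "ball x0 r \<times> ball y0 r"
    let ?K = "\<lambda>q (t::real). 1 / (2 * of_real pi * \<i>) *
     (F (fst q, circlepath y0 r t) / (circlepath y0 r t - snd q)^2 * (2 * pi * \<i> * r * exp (2 * of_real pi * \<i> * t)))"
    have cF: "continuous_on (?V \<times> cbox 0 (1::real)) (\<lambda>z. F (fst (fst z), circlepath y0 r (snd z)))"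
      using circlepath_in_sphere[OF r] r sub
      by (intro continuous_on_compose2[OF sep_holoD(2)[OF F]] continuous_intros) (force simp: sphere_def)
    have "continuous_on (?V \<times> cbox 0 (1::real)) (\<lambda>(q, t). ?K q t)"
      unfolding split_beta using circlepath_in_sphere[OF r]
      by (intro continuous_intros cF) (force simp: sphere_def)+
    then have "continuous_on ?V (\<lambda>q. integral (cbox 0 1) (?K q))"
      by (rule integral_continuous_on_param)
    moreover have "integral (cbox 0 1) (?K q) = pd2 F q" if "q \<in> ?V" for q
      using that cauchy_pd2[OF F sub, of "fst q" "snd q"] by force
    ultimately have "continuous_on ?V (pd2 F)"
      by (metis (no_types, lifting) continuous_on_cong)
    then show ?thesis
      using r p by (auto simp: continuous_on_eq_continuous_at open_Times)
  qed
  then show ?thesis by (simp add: continuous_at_imp_continuous_on)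
qed

lemma sep_holo_cont_pd1:
  assumes F: "sep_holo F U"
  shows "continuous_on U (pd1 F)"
proof -
  have c: "continuous_on U (prod.swap :: complex \<times> complex \<Rightarrow> _)"
    unfolding prod.swap_def by (intro continuous_intros)
  show ?thesis unfolding pd1_swap
    by (rule continuous_on_compose[OF c]) (rule sep_holo_cont_pd2[OF sep_holo_swap[OF F]])
qed

text \<open>Total differentiability follows once one partial derivative exists and the other exists
  near by and is continuous; the continuity has come from Cauchy's formula.\<close>

lemma sep_holo_derivative:
  assumes F: "sep_holo F U" and p: "p \<in> U"
  shows "(F has_derivative (\<lambda>v. pd1 F p * fst v + pd2 F p * snd v)) (at p)"
proof -
  obtain x0 y0 where p': "p = (x0, y0)" by force
  obtain r where r: "r > 0" and sub: "cball x0 r \<times> cball y0 r \<subseteq> U"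
    using open_prod_cball[OF sep_holoD(1)[OF F]] p p' by metis
  let ?X = "ball x0 r" and ?Y = "ball y0 r"
  have inU: "(x, y) \<in> U" if "x \<in> ?X" "y \<in> ?Y" for x y using that sub by auto
  have "((\<lambda>(x, y). (\<lambda>x y. F (x, y)) x y) has_derivative
      (\<lambda>(tx, ty). pd1 F (x0, y0) * tx + blinfun_mult_right (pd2 F (x0, y0)) ty)) (at (x0, y0) within ?X \<times> ?Y)"
  proof (rule has_derivative_partialsI[where fy = "\<lambda>x y. blinfun_mult_right (pd2 F (x, y))"])
    show "((\<lambda>x. F (x, y0)) has_derivative (\<lambda>tx. pd1 F (x0, y0) * tx)) (at x0 within ?X)"
      using sep_holo_pd(1)[OF F inU] r unfolding has_field_derivative_def
      by (auto intro: has_derivative_at_withinI)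
    show "((\<lambda>y. F (x, y)) has_derivative blinfun_apply (blinfun_mult_right (pd2 F (x, y)))) (at y within ?Y)"
      if "x \<in> ?X" "y \<in> ?Y" for x y
      using sep_holo_pd(2)[OF F inU[OF that]] unfolding has_field_derivative_def
      by (auto intro: has_derivative_at_withinI)
    have "continuous_on (?X \<times> ?Y) (\<lambda>(x, y). blinfun_mult_right (pd2 F (x, y)))"
      unfolding split_beta prod.collapse
      by (intro bounded_linear.continuous_on[OF bounded_linear_blinfun_mult_right]
          continuous_on_subset[OF sep_holo_cont_pd2[OF F]]) (use inU in force)
    then show "continuous (at (x0, y0) within ?X \<times> ?Y) (\<lambda>(x, y). blinfun_mult_right (pd2 F (x, y)))"
      using r by (simp add: continuous_on_eq_continuous_within case_prod_unfold)
  qed (use r in auto)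
  then have "((\<lambda>(x, y). F (x, y)) has_derivative
      (\<lambda>(tx, ty). pd1 F (x0, y0) * tx + pd2 F (x0, y0) * ty)) (at (x0, y0))"
    using r by (subst (asm) at_within_open) (auto simp: open_Times)
  then show ?thesis by (simp add: p' case_prod_unfold)
qed

lemma sep_holo_imp_holo2: "sep_holo F U \<Longrightarrow> p \<in> U \<Longrightarrow> holo2_at F p"
  unfolding holo2_at_def using sep_holo_derivative by blast

lemma holo2_imp_section:
  assumes "(F has_derivative (\<lambda>v. a * fst v + b * snd v)) (at (x, y))"
  shows "((\<lambda>x. F (x, y)) has_field_derivative a) (at x)"
    "((\<lambda>y. F (x, y)) has_field_derivative b) (at y)"
proof -
  have "(F \<circ> (\<lambda>x. (x, y)) has_derivative (\<lambda>v. a * fst v + b * snd v) \<circ> (\<lambda>h. (h, 0))) (at x)"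
    by (rule diff_chain_at) (use assms in \<open>auto intro!: derivative_eq_intros\<close>)
  then show "((\<lambda>x. F (x, y)) has_field_derivative a) (at x)"
    by (simp add: has_field_derivative_def o_def cong: if_cong)
  have "(F \<circ> (\<lambda>y. (x, y)) has_derivative (\<lambda>v. a * fst v + b * snd v) \<circ> (\<lambda>h. (0, h))) (at y)"
    by (rule diff_chain_at) (use assms in \<open>auto intro!: derivative_eq_intros\<close>)
  then show "((\<lambda>y. F (x, y)) has_field_derivative b) (at y)"
    by (simp add: has_field_derivative_def o_def cong: if_cong)
qed

lemma holo2_imp_sep_holo:
  assumes "open U" "\<And>p. p \<in> U \<Longrightarrow> holo2_at F p"
  shows "sep_holo F U"
  unfolding sep_holo_def
proof (intro conjI ballI)
  show "continuous_on U F"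
    using assms has_derivative_continuous unfolding holo2_at_def
    by (metis continuous_at_imp_continuous_on)
  fix p assume p: "p \<in> U"
  obtain x y where xy: "p = (x, y)" by force
  obtain a b where ab: "(F has_derivative (\<lambda>v. a * fst v + b * snd v)) (at (x, y))"
    using assms(2)[OF p] unfolding holo2_at_def xy by (elim exE)
  show "(\<lambda>x. F (x, snd p)) field_differentiable at (fst p)"
    "(\<lambda>y. F (fst p, y)) field_differentiable at (snd p)"
    using holo2_imp_section[OF ab] unfolding xy field_differentiable_def by auto
qed (rule assms)

lemma sep_holo_iff: "sep_holo F U \<longleftrightarrow> open U \<and> (\<forall>p\<in>U. holo2_at F p)"
  by (metis holo2_imp_sep_holo sep_holo_imp_holo2 sep_holoD(1))

text \<open>In \<open>y\<close> this is the one-variable fact that derivatives of holomorphic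
  functions are holomorphic; in \<open>x\<close> it comes from differentiating under Cauchy's
  integral.\<close>

lemma sep_holo_pd2:
  assumes F: "sep_holo F U"
  shows "sep_holo (pd2 F) U"
  unfolding sep_holo_def
proof (intro conjI ballI)
  show "open U" "continuous_on U (pd2 F)"
    using F sep_holoD(1) sep_holo_cont_pd2 by auto
  fix p assume p: "p \<in> U"
  obtain x0 y0 where p': "p = (x0, y0)" by force
  obtain r where r: "r > 0" and sub: "cball x0 r \<times> cball y0 r \<subseteq> U"
    using open_prod_cball[OF sep_holoD(1)[OF F]] p p' by metis
  have inU: "(x, y) \<in> U" if "x \<in> ball x0 r" "y \<in> cball y0 r" for x y using that sub by auto
  have "(\<lambda>y. F (x0, y)) holomorphic_on ball y0 r"
    by (rule sep_holo_holomorphic(2)[OF F]) (use r in \<open>auto intro: inU\<close>)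
  then have "deriv (\<lambda>y. F (x0, y)) holomorphic_on ball y0 r"
    by (rule holomorphic_deriv) auto
  then show "(\<lambda>y. pd2 F (fst p, y)) field_differentiable at (snd p)"
    using r by (simp add: p' pd2_def holomorphic_on_def at_within_open[of _ "ball y0 r"])
  let ?K = "\<lambda>G x (t::real). 1 / (2 * of_real pi * \<i>) *
     (G (x, circlepath y0 r t) / (circlepath y0 r t - y0)^2 * (2 * pi * \<i> * r * exp (2 * of_real pi * \<i> * t)))"
  have cp: "circlepath y0 r t \<in> cball y0 r" "circlepath y0 r t \<noteq> y0" for t
    using circlepath_in_sphere[OF r, of y0 t] r by auto
  have cG: "continuous_on (ball x0 r \<times> cbox 0 1) (\<lambda>(x, t). ?K G x t)" if "continuous_on U G" for G
  proof -
    have "continuous_on (ball x0 r \<times> cbox 0 (1::real)) (\<lambda>z. G (fst z, circlepath y0 r (snd z)))"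
      using cp inU by (intro continuous_on_compose2[OF that] continuous_intros) force
    then show ?thesis unfolding split_beta using cp
      by (intro continuous_intros) (auto)
  qed
  \<comment> \<open>Leibniz' rule: the derivative of the integrand is the same kernel with
    \<open>pd1 F\<close> in place of \<open>F\<close>, and \<open>pd1 F\<close> is already known to
    be continuous.\<close>
  have "(\<lambda>x. integral (cbox 0 1) (?K F x)) field_differentiable (at x0 within ball x0 r)"
  proof (rule leibniz_rule_field_differentiable[where fx = "?K (pd1 F)"])
    show "((\<lambda>x. ?K F x t) has_field_derivative ?K (pd1 F) x t) (at x within ball x0 r)"
      if "x \<in> ball x0 r" "t \<in> cbox 0 1" for x and t :: real
      by (rule has_field_derivative_at_within)
        (intro DERIV_cmult DERIV_cmult_right DERIV_cdivide sep_holo_pd(1)[OF F] inU that cp)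
    show "?K F x integrable_on cbox 0 1" if "x \<in> ball x0 r" for x
    proof (rule integrable_continuous)
      have "continuous_on (cbox 0 1) (\<lambda>t. (\<lambda>(x, t). ?K F x t) (x, t))"
        by (rule continuous_on_compose2[OF cG[OF sep_holoD(2)[OF F]]])
          (use that in \<open>auto intro!: continuous_intros\<close>)
      then show "continuous_on (cbox 0 1) (?K F x)" by simp
    qed
    show "continuous_on (ball x0 r \<times> cbox 0 1) (\<lambda>(x, t). ?K (pd1 F) x t)"
      by (rule cG[OF sep_holo_cont_pd1[OF F]])
  qed (use r in auto)
  then have *: "(\<lambda>x. integral (cbox 0 1) (?K F x)) field_differentiable (at x0)"
    using r by (simp add: at_within_open[of _ "ball x0 r"])
  have "(\<lambda>x. pd2 F (x, y0)) field_differentiable (at x0)"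
  proof -
    obtain D where D: "((\<lambda>x. integral (cbox 0 1) (?K F x)) has_field_derivative D) (at x0)"
      using * field_differentiable_def by blast
    have "((\<lambda>x. pd2 F (x, y0)) has_field_derivative D) (at x0)"
      by (rule has_field_derivative_transform_within_open[OF D, of "ball x0 r"])
        (use r cauchy_pd2[OF F sub, of _ y0] in auto)
    then show ?thesis using field_differentiable_def by blast
  qed
  then show "(\<lambda>x. pd2 F (x, snd p)) field_differentiable at (fst p)" by (simp add: p')
qed

lemma sep_holo_pd1:
  assumes F: "sep_holo F U"
  shows "sep_holo (pd1 F) U"
proof -
  have "sep_holo (pd2 (F \<circ> prod.swap) \<circ> prod.swap) (prod.swap ` prod.swap ` U)"
    by (intro sep_holo_swap sep_holo_pd2 F)
  then show ?thesis by (simp add: pd1_swap image_image)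
qed

section \<open>Germs at the origin\<close>

lemma holo2_atE:
  assumes "holo2_at F p"
  obtains a b where "(F has_derivative (\<lambda>v. a * fst v + b * snd v)) (at p)"
  using assms unfolding holo2_at_def by (elim exE)

lemma holo2_atI: "(F has_derivative (\<lambda>v. a * fst v + b * snd v)) (at p) \<Longrightarrow> holo2_at F p"
  unfolding holo2_at_def by (intro exI)

lemma holo2_at_const: "holo2_at (\<lambda>_. c) p"
  unfolding holo2_at_def by (rule exI[of _ 0], rule exI[of _ 0]) simp

lemma holo2_at_fst: "holo2_at fst p"
  unfolding holo2_at_def by (rule exI[of _ 1], rule exI[of _ 0]) (auto intro!: derivative_eq_intros)

lemma holo2_at_snd: "holo2_at snd p"
  unfolding holo2_at_def by (rule exI[of _ 0], rule exI[of _ 1]) (auto intro!: derivative_eq_intros)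

lemma holo2_at_add:
  assumes "holo2_at F p" "holo2_at G p" shows "holo2_at (\<lambda>p. F p + G p) p"
proof -
  obtain a b where F: "(F has_derivative (\<lambda>v. a * fst v + b * snd v)) (at p)"
    using assms(1) by (rule holo2_atE)
  obtain c d where G: "(G has_derivative (\<lambda>v. c * fst v + d * snd v)) (at p)"
    using assms(2) by (rule holo2_atE)
  have "((\<lambda>p. F p + G p) has_derivative (\<lambda>v. (a + c) * fst v + (b + d) * snd v)) (at p)"
    by (rule has_derivative_eq_rhs[OF has_derivative_add[OF F G]]) (simp add: fun_eq_iff algebra_simps)
  then show ?thesis by (rule holo2_atI)
qed

lemma holo2_at_mult:
  assumes "holo2_at F p" "holo2_at G p" shows "holo2_at (\<lambda>p. F p * G p) p"
proof -
  obtain a b where F: "(F has_derivative (\<lambda>v. a * fst v + b * snd v)) (at p)"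
    using assms(1) by (rule holo2_atE)
  obtain c d where G: "(G has_derivative (\<lambda>v. c * fst v + d * snd v)) (at p)"
    using assms(2) by (rule holo2_atE)
  have "((\<lambda>p. F p * G p) has_derivative
      (\<lambda>v. (F p * c + a * G p) * fst v + (F p * d + b * G p) * snd v)) (at p)"
    by (rule has_derivative_eq_rhs[OF has_derivative_mult[OF F G]]) (simp add: fun_eq_iff algebra_simps)
  then show ?thesis by (rule holo2_atI)
qed

lemma holo2_at_compose:
  fixes F G H :: "complex \<times> complex \<Rightarrow> complex"
  assumes "(F has_derivative (\<lambda>v. a * fst v + b * snd v)) (at (G p, H p))"
    "(G has_derivative (\<lambda>v. c * fst v + d * snd v)) (at p)"
    "(H has_derivative (\<lambda>v. c' * fst v + d' * snd v)) (at p)"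
  shows "((\<lambda>p. F (G p, H p)) has_derivative
     (\<lambda>v. (a * c + b * c') * fst v + (a * d + b * d') * snd v)) (at p)"
proof -
  have "((\<lambda>p. (G p, H p)) has_derivative (\<lambda>v. (c * fst v + d * snd v, c' * fst v + d' * snd v))) (at p)"
    by (rule has_derivative_Pair[OF assms(2,3)])
  from has_derivative_compose[OF this assms(1)] show ?thesis
    by (rule has_derivative_eq_rhs) (simp add: fun_eq_iff algebra_simps)
qed

lemma holo2_at_compose1:
  assumes "(u has_field_derivative D) (at (G p))" "holo2_at G p"
  shows "holo2_at (\<lambda>p. u (G p)) p"
proof -
  obtain a b where "(G has_derivative (\<lambda>v. a * fst v + b * snd v)) (at p)"
    using assms(2) by (rule holo2_atE)
  from has_derivative_compose[OF this assms(1)[unfolded has_field_derivative_def]]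
  have "((\<lambda>p. u (G p)) has_derivative (\<lambda>v. (D * a) * fst v + (D * b) * snd v)) (at p)"
    by (rule has_derivative_eq_rhs) (simp add: fun_eq_iff algebra_simps)
  then show ?thesis by (rule holo2_atI)
qed

lemma holo_germ_iff: "holo_germ F \<longleftrightarrow> (\<exists>U. 0 \<in> U \<and> sep_holo F U)"
  unfolding holo_germ_def eventually_nhds sep_holo_iff by metis

lemma holo_germ_pd1: "holo_germ F \<Longrightarrow> holo_germ (pd1 F)"
  unfolding holo_germ_iff using sep_holo_pd1 by metis

lemma holo_germ_pd2: "holo_germ F \<Longrightarrow> holo_germ (pd2 F)"
  unfolding holo_germ_iff using sep_holo_pd2 by metis

lemma holo_germ_derivative:
  assumes "holo_germ F"
  shows "\<forall>\<^sub>F p in nhds 0. (F has_derivative (\<lambda>v. pd1 F p * fst v + pd2 F p * snd v)) (at p)"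
proof -
  obtain U where U: "0 \<in> U" "sep_holo F U" using assms holo_germ_iff by metis
  show ?thesis
    by (rule eventually_mono[OF eventually_nhds_in_open[OF sep_holoD(1)[OF U(2)] U(1)]])
      (rule sep_holo_derivative[OF U(2)])
qed

lemma holo_germ_isCont: "holo_germ F \<Longrightarrow> isCont F 0"
  by (rule has_derivative_continuous) (rule eventually_nhds_x_imp_x[OF holo_germ_derivative])

lemma holo_germ_tendsto: "holo_germ F \<Longrightarrow> (F \<longlongrightarrow> F 0) (nhds 0)"
  by (simp add: tendsto_nhds_iff holo_germ_isCont isContD)

lemma holo2_at_cong:
  assumes "\<forall>\<^sub>F q in nhds p. F q = G q" "holo2_at F p"
  shows "holo2_at G p"
proof -
  obtain a b where "(F has_derivative (\<lambda>v. a * fst v + b * snd v)) (at p)"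
    using assms(2) by (rule holo2_atE)
  moreover have "\<forall>\<^sub>F q in at p. F q = G q"
    using assms(1) by (auto simp: eventually_at_filter elim: eventually_mono)
  moreover have "F p = G p" using assms(1) by (auto dest: eventually_nhds_x_imp_x)
  ultimately have "(G has_derivative (\<lambda>v. a * fst v + b * snd v)) (at p)"
    by (rule has_derivative_transform_eventually) auto
  then show ?thesis by (rule holo2_atI)
qed

lemma holo_germ_const: "holo_germ (\<lambda>_. c)"
  and holo_germ_fst: "holo_germ fst"
  and holo_germ_snd: "holo_germ snd"
  by (simp_all add: holo_germ_def holo2_at_const holo2_at_fst holo2_at_snd)

lemma holo_germ_add: "holo_germ F \<Longrightarrow> holo_germ G \<Longrightarrow> holo_germ (\<lambda>p. F p + G p)"
  unfolding holo_germ_def by (erule (1) eventually_elim2) (rule holo2_at_add)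

lemma holo_germ_mult: "holo_germ F \<Longrightarrow> holo_germ G \<Longrightarrow> holo_germ (\<lambda>p. F p * G p)"
  unfolding holo_germ_def by (erule (1) eventually_elim2) (rule holo2_at_mult)

lemma holo_germ_diff: "holo_germ F \<Longrightarrow> holo_germ G \<Longrightarrow> holo_germ (\<lambda>p. F p - G p)"
  using holo_germ_add[OF _ holo_germ_mult[OF holo_germ_const[of "-1"]], of F G] by simp

lemma holo_germ_power: "holo_germ F \<Longrightarrow> holo_germ (\<lambda>p. F p ^ n)"
  by (induction n) (simp_all add: holo_germ_const holo_germ_mult)

lemma holo_germ_prod: "(\<And>i. i \<in> I \<Longrightarrow> holo_germ (F i)) \<Longrightarrow> holo_germ (\<lambda>p. \<Prod>i\<in>I. F i p)"
  by (induction I rule: infinite_finite_induct) (simp_all add: holo_germ_const holo_germ_mult)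

lemma holo_germ_sum: "(\<And>i. i \<in> I \<Longrightarrow> holo_germ (F i)) \<Longrightarrow> holo_germ (\<lambda>p. \<Sum>i\<in>I. F i p)"
  by (induction I rule: infinite_finite_induct) (simp_all add: holo_germ_const holo_germ_add)

text \<open>Germ identities travel along maps that are merely continuous at the base point; this
  admits choices such as \<open>nth_root\<close> that are discontinuous elsewhere.\<close>

lemma eventually_subst:
  fixes g :: "'a :: t2_space \<Rightarrow> 'b :: t1_space"
  assumes "\<forall>\<^sub>F p in nhds b. P p" "isCont g a" "g a = b"
  shows "\<forall>\<^sub>F t in nhds a. P (g t)"
proof -
  have "filterlim g (nhds b) (nhds a)"
    using assms(2,3) by (auto simp: tendsto_nhds_iff isCont_def)
  then show ?thesis using assms(1) by (rule eventually_compose_filterlim[rotated])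
qed

lemma holo_germ_compose:
  assumes "holo_germ F" "holo_germ G" "holo_germ H" "G 0 = 0" "H 0 = 0"
  shows "holo_germ (\<lambda>p. F (G p, H p))"
proof -
  have "\<forall>\<^sub>F p in nhds 0. holo2_at F (G p, H p)"
    by (rule eventually_subst[OF assms(1)[unfolded holo_germ_def]])
      (simp_all add: isCont_Pair holo_germ_isCont assms prod_eq_iff)
  then show ?thesis
    using assms(2,3)[unfolded holo_germ_def] unfolding holo_germ_def
  proof eventually_elim
    case (elim p)
    from elim(1) obtain a b where F: "(F has_derivative (\<lambda>v. a * fst v + b * snd v)) (at (G p, H p))"
      by (rule holo2_atE)
    from elim(2) obtain c d where G: "(G has_derivative (\<lambda>v. c * fst v + d * snd v)) (at p)"
      by (rule holo2_atE)
    from elim(3) obtain c' d' where H: "(H has_derivative (\<lambda>v. c' * fst v + d' * snd v)) (at p)"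
      by (rule holo2_atE)
    show ?case by (rule holo2_atI[OF holo2_at_compose[OF F G H]])
  qed
qed

lemma analytic_at_eventually:
  fixes u :: "complex \<Rightarrow> complex"
  shows "u analytic_on {z} \<longleftrightarrow> (\<forall>\<^sub>F t in nhds z. (u has_field_derivative deriv u t) (at t))"
proof
  assume "u analytic_on {z}"
  then obtain S where S: "open S" "z \<in> S" "u holomorphic_on S" using analytic_at by metis
  show "\<forall>\<^sub>F t in nhds z. (u has_field_derivative deriv u t) (at t)"
    by (rule eventually_mono[OF eventually_nhds_in_open[OF S(1,2)]]) (rule holomorphic_derivI[OF S(3,1)])
next
  assume "\<forall>\<^sub>F t in nhds z. (u has_field_derivative deriv u t) (at t)"
  then obtain S where S: "open S" "z \<in> S" "\<And>t. t \<in> S \<Longrightarrow> (u has_field_derivative deriv u t) (at t)"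
    unfolding eventually_nhds by metis
  then have "u holomorphic_on S" using holomorphic_on_open by metis
  then show "u analytic_on {z}" using S analytic_at by metis
qed

lemma holo_germ_compose1:
  assumes "u analytic_on {0}" "holo_germ G" "G 0 = 0"
  shows "holo_germ (\<lambda>p. u (G p))"
proof -
  have "\<forall>\<^sub>F p in nhds 0. (u has_field_derivative deriv u (G p)) (at (G p))"
    by (rule eventually_subst[OF assms(1)[unfolded analytic_at_eventually]])
      (use assms in \<open>auto intro!: holo_germ_isCont\<close>)
  then show ?thesis
    using assms(2)[unfolded holo_germ_def] unfolding holo_germ_def
    by eventually_elim (rule holo2_at_compose1)
qed

lemma holo_germ_inverse:
  assumes "holo_germ F" "F 0 \<noteq> 0"
  shows "holo_germ (\<lambda>p. inverse (F p))"
proof -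
  have "holo_germ (\<lambda>p. (\<lambda>z. inverse (z + F 0)) (F p - F 0))"
    by (rule holo_germ_compose1)
      (use assms in \<open>auto intro!: analytic_intros holo_germ_diff holo_germ_const\<close>)
  then show ?thesis by simp
qed

lemma eventually_curve:
  assumes "\<forall>\<^sub>F p in nhds 0. P p" "x analytic_on {0}" "y analytic_on {0}" "x 0 = 0" "y 0 = 0"
  shows "\<forall>\<^sub>F t in nhds 0. P (x t, y t)"
  by (rule eventually_subst[OF assms(1)])
    (simp_all add: isCont_Pair analytic_at_imp_isCont assms prod_eq_iff)

lemma has_field_derivative_curve:
  fixes F :: "complex \<times> complex \<Rightarrow> complex"
  assumes "(F has_derivative (\<lambda>v. a * fst v + b * snd v)) (at (x t, y t))"
    "(x has_field_derivative c) (at t)" "(y has_field_derivative d) (at t)"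
  shows "((\<lambda>t. F (x t, y t)) has_field_derivative (a * c + b * d)) (at t)"
proof -
  have "((\<lambda>t. (x t, y t)) has_derivative (\<lambda>h. (c * h, d * h))) (at t)"
    by (rule has_derivative_Pair[OF assms(2,3)[unfolded has_field_derivative_def]])
  from has_derivative_compose[OF this assms(1)] show ?thesis
    unfolding has_field_derivative_def by (rule has_derivative_eq_rhs) (simp add: fun_eq_iff algebra_simps)
qed

lemma holo_germ_curve_deriv:
  assumes "holo_germ F" "x analytic_on {0}" "y analytic_on {0}" "x 0 = 0" "y 0 = 0"
  shows "\<forall>\<^sub>F t in nhds 0. ((\<lambda>t. F (x t, y t)) has_field_derivative
     (pd1 F (x t, y t) * deriv x t + pd2 F (x t, y t) * deriv y t)) (at t)"
  using eventually_curve[OF holo_germ_derivative assms(2-5), OF assms(1)]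
    assms(2,3)[unfolded analytic_at_eventually]
  by eventually_elim (rule has_field_derivative_curve)

lemma holo_germ_curve:
  assumes "holo_germ F" "x analytic_on {0}" "y analytic_on {0}" "x 0 = 0" "y 0 = 0"
  shows "(\<lambda>t. F (x t, y t)) analytic_on {0}"
  unfolding analytic_at_eventually
  by (rule eventually_mono[OF holo_germ_curve_deriv[OF assms]]) (metis DERIV_imp_deriv)

section \<open>Division by a coordinate and descent through x = t^d\<close>

text \<open>The quotient is extended over \<open>y = 0\<close> by the derivative
  \<open>pd2 F\<close>. Holomorphy in each variable is quick; joint continuity at points of the axis
  is the real content and rests on a mean value estimate.\<close>

lemma hadamard_division:
  assumes F: "holo_germ F" and F0: "\<forall>\<^sub>F t in nhds 0. F (t, 0) = 0"
  shows "\<exists>G. holo_germ G \<and> (\<forall>\<^sub>F p in nhds 0. F p = snd p * G p)"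
proof -
  obtain U where U: "(0, 0) \<in> U" "sep_holo F U" using F holo_germ_iff by (metis zero_prod_def)
  obtain r1 where r1: "r1 > 0" "cball 0 r1 \<times> cball 0 r1 \<subseteq> U"
    using open_prod_cball[OF sep_holoD(1)[OF U(2)] U(1)] .
  obtain r2 where r2: "r2 > 0" "\<And>t. t \<in> ball 0 r2 \<Longrightarrow> F (t, 0) = 0"
    using F0 unfolding eventually_nhds_metric by (metis dist_commute mem_ball)
  define r where "r = min r1 r2"
  have r: "r > 0" using r1 r2 r_def by simp
  define V :: "(complex \<times> complex) set" where "V = ball 0 r \<times> ball 0 r"
  have oV: "open V" by (simp add: V_def open_Times)
  have VU: "V \<subseteq> U" using r1 r_def unfolding V_def by (force simp: subset_iff)
  have inV: "(x, y) \<in> V \<longleftrightarrow> norm x < r \<and> norm y < r" for x y by (simp add: V_def)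
  have Fx0: "F (x, 0) = 0" if "norm x < r" for x using that r2(2) r_def by simp
  have hF: "sep_holo F V" using U(2) VU oV unfolding sep_holo_iff by auto
  define G where "G = (\<lambda>p. if snd p = 0 then pd2 F p else F p / snd p)"
  \<comment> \<open>On a vertical slice the singularity at \<open>y = 0\<close> is removable, the
    missing value being the derivative there.\<close>
  have Gy: "(\<lambda>y. G (x, y)) holomorphic_on ball 0 r" if x: "norm x < r" for x
  proof (rule pole_theorem_open_0[where a = 0 and g = "\<lambda>y. F (x, y)"])
    show "(\<lambda>y. F (x, y)) holomorphic_on ball 0 r"
      by (rule sep_holo_holomorphic(2)[OF hF]) (simp add: inV x)
  qed (auto simp: G_def pd2_def Fx0 x)
  have G1: "(\<lambda>x. G (x, y)) holomorphic_on ball 0 r" if y: "norm y < r" for y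
  proof (cases "y = 0")
    case True
    then show ?thesis
      using sep_holo_holomorphic(1)[OF sep_holo_pd2[OF hF], of "ball 0 r" 0] r by (simp add: G_def inV)
  next
    case False
    have "(\<lambda>x. F (x, y)) holomorphic_on ball 0 r"
      by (rule sep_holo_holomorphic(1)[OF hF]) (simp add: inV y)
    with False show ?thesis by (auto simp: G_def intro!: holomorphic_intros)
  qed
  have cont: "isCont G p" if p: "p \<in> V" for p
  proof (cases "snd p = 0")
    case False
    have "continuous_on (V \<inter> snd -` (-{0})) (\<lambda>p. F p / snd p)"
      by (intro continuous_intros continuous_on_subset[OF sep_holoD(2)[OF hF]]) auto
    then have "continuous_on (V \<inter> snd -` (-{0})) G"
      by (rule continuous_on_eq) (auto simp: G_def)
    moreover have "open (V \<inter> snd -` (-{0}))" using oV by (intro open_Int open_vimage_snd) auto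
    ultimately show ?thesis using p False by (simp add: continuous_on_eq_continuous_at)
  next
    case True
    obtain x0 where p': "p = (x0, 0)" using True by (cases p) auto
    define c where "c = pd2 F p"
    have cc: "isCont (pd2 F) p"
      using sep_holo_cont_pd2[OF hF] p oV by (simp add: continuous_on_eq_continuous_at)
    show ?thesis unfolding isCont_def Lim_at
    proof (intro allI impI)
      fix e :: real assume e: "e > 0"
      obtain d1 where d1: "d1 > 0" "\<And>q. dist q p < d1 \<Longrightarrow> dist (pd2 F q) c < e / 2"
        using cc e unfolding continuous_at_eps_delta c_def by (metis half_gt_zero)
      obtain d2 where d2: "d2 > 0" "ball p d2 \<subseteq> V" using oV p open_contains_ball_eq by metis
      have "dist (G q) c < e" if q: "dist q p < min d1 d2" for q
      proof -
        obtain x y where q': "q = (x, y)" by force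
        have seg: "dist (x, w) p < min d1 d2" if "norm w \<le> norm y" for w
        proof -
          have "dist (x, w) p \<le> dist q p"
            using that by (auto simp: p' q' dist_Pair_Pair)
          with q show ?thesis by simp
        qed
        have segV: "(x, w) \<in> V" if "norm w \<le> norm y" for w
          using seg[OF that] d2(2) by (auto simp: dist_commute subset_iff)
        have bnd: "norm (pd2 F (x, w) - c) \<le> e / 2" if "norm w \<le> norm y" for w
          using d1(2)[of "(x, w)"] seg[OF that] by (simp add: dist_norm)
        show ?thesis
        proof (cases "y = 0")
          case True
          then show ?thesis using bnd[of 0] e by (simp add: G_def q' dist_norm)
        next
          case False
          \<comment> \<open>Mean value inequality for \<open>F (x, w) - c * w\<close> on the disc of
            radius \<open>norm y\<close>. Since \<open>F\<close> vanishes at \<open>w = 0\<close>,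
            dividing by \<open>y\<close> bounds \<open>G q - c\<close>.\<close>
          have "norm ((F (x, y) - c * y) - (F (x, 0) - c * 0)) \<le> e / 2 * norm (y - 0)"
          proof (rule field_differentiable_bound[where S = "cball 0 (norm y)" and f' = "\<lambda>w. pd2 F (x, w) - c"])
            show "((\<lambda>w. F (x, w) - c * w) has_field_derivative pd2 F (x, w) - c) (at w within cball 0 (norm y))"
              if "w \<in> cball 0 (norm y)" for w
              using that segV[of w]
              by (intro has_field_derivative_at_within[OF DERIV_diff] sep_holo_pd(2)[OF hF])
                (auto intro!: derivative_eq_intros)
          qed (use bnd in simp_all)
          moreover have "F (x, 0) = 0" using segV[of 0] by (auto simp: inV Fx0)
          ultimately have "norm (F (x, y) - c * y) \<le> e / 2 * norm y" by simp
          moreover have "F (x, y) - c * y = (G q - c) * y"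
            using False by (simp add: G_def q' left_diff_distrib)
          then have "norm (F (x, y) - c * y) = norm (G q - c) * norm y"
            by (simp only: norm_mult)
          ultimately have "norm (G q - c) \<le> e / 2" using False by simp
          then show ?thesis using e by (simp add: dist_norm)
        qed
      qed
      moreover have "G p = c" using True by (simp add: G_def c_def)
      ultimately show "\<exists>d>0. \<forall>x. 0 < dist x p \<and> dist x p < d \<longrightarrow> dist (G x) (G p) < e"
        using d1(1) d2(1) by (intro exI[of _ "min d1 d2"]) auto
    qed
  qed
  have "sep_holo G V"
    unfolding sep_holo_def
  proof (intro conjI ballI oV)
    show "continuous_on V G" using cont by (simp add: continuous_at_imp_continuous_on)
    fix p assume "p \<in> V"
    then have p: "norm (fst p) < r" "norm (snd p) < r" by (auto simp: V_def)
    show "(\<lambda>x. G (x, snd p)) field_differentiable at (fst p)"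
      by (rule holomorphic_on_imp_differentiable_at[OF G1]) (use p in auto)
    show "(\<lambda>y. G (fst p, y)) field_differentiable at (snd p)"
      by (rule holomorphic_on_imp_differentiable_at[OF Gy]) (use p in auto)
  qed
  moreover have "0 \<in> V" using r by (simp add: zero_prod_def inV)
  ultimately have "holo_germ G" unfolding holo_germ_iff by metis
  moreover have "\<forall>\<^sub>F p in nhds 0. F p = snd p * G p"
  proof (rule eventually_mono[OF eventually_nhds_in_open[OF oV \<open>0 \<in> V\<close>]])
    fix p assume "p \<in> V"
    then show "F p = snd p * G p"
      using Fx0[of "fst p"] by (cases p) (auto simp: G_def inV)
  qed
  ultimately show ?thesis by metis
qed

text \<open>The root given by the principal logarithm, with its jump across the negative axis. Only
  two properties matter: continuity at the origin, and agreement at any given nonzero point with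
  some local holomorphic branch.\<close>

definition nth_root :: "nat \<Rightarrow> complex \<Rightarrow> complex" where
  "nth_root d x = (if x = 0 then 0 else exp (Ln x / of_nat d))"

lemma nth_root_power: "d > 0 \<Longrightarrow> nth_root d x ^ d = x"
  by (auto simp: nth_root_def simp flip: exp_of_nat_mult)

lemma nth_root_0 [simp]: "nth_root d 0 = 0"
  by (simp add: nth_root_def)

lemma norm_nth_root_less:
  assumes "d > 0" "norm x < e ^ d" "e > 0"
  shows "norm (nth_root d x) < e"
proof -
  have "norm (nth_root d x) ^ d < e ^ d"
    using assms nth_root_power[OF assms(1), of x] by (simp flip: norm_power)
  then show ?thesis using assms by (meson less_imp_le power_less_imp_less_base)
qed

lemma isCont_nth_root:
  assumes "d > 0" shows "isCont (nth_root d) 0"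
  unfolding continuous_at_eps_delta
proof (intro allI impI)
  fix e :: real assume e: "e > 0"
  show "\<exists>\<delta>>0. \<forall>x. dist x 0 < \<delta> \<longrightarrow> dist (nth_root d x) (nth_root d 0) < e"
    by (rule exI[of _ "e ^ d"]) (use e assms norm_nth_root_less in auto)
qed

text \<open>The logarithm is applied to \<open>x / x0\<close>, which is close to 1, so its cut stays
  out of reach.\<close>

lemma nth_root_local_branch:
  assumes "d > 0" "x0 \<noteq> 0"
  obtains l where "l x0 = nth_root d x0" "l analytic_on {x0}" "\<And>x. x \<noteq> 0 \<Longrightarrow> l x ^ d = x"
proof -
  define l where "l = (\<lambda>x. exp (Ln (x / x0) / of_nat d) * nth_root d x0)"
  have "l x0 = nth_root d x0" using assms by (simp add: l_def)
  moreover have "l analytic_on {x0}"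
    unfolding l_def using assms by (auto intro!: analytic_intros)
  moreover have "l x ^ d = x" if "x \<noteq> 0" for x
    using assms that by (simp add: l_def power_mult_distrib nth_root_power flip: exp_of_nat_mult)
  ultimately show ?thesis using that by metis
qed

lemma isCont_nth_root_fst:
  fixes p :: "complex \<times> complex"
  assumes "d > 0" "fst p = 0"
  shows "isCont (\<lambda>p. (nth_root d (fst p), snd p)) p"
proof (rule isCont_Pair)
  have "isCont fst p" by (intro continuous_intros)
  then show "isCont (\<lambda>p. nth_root d (fst p)) p"
    by (rule isCont_o2) (use assms isCont_nth_root in simp)
  show "isCont snd p" by (intro continuous_intros)
qed

text \<open>Every point near the origin is (z^d, y) with z near 0, so an identity checked after the
  substitution x = z^d holds before it.\<close>

lemma eventually_power_fst:
  assumes "d > 0" "\<forall>\<^sub>F p in nhds 0. P (fst p ^ d, snd p)"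
  shows "\<forall>\<^sub>F p in nhds (0 :: complex \<times> complex). P p"
  using eventually_subst[OF assms(2) isCont_nth_root_fst[OF assms(1)], of 0]
  by (simp add: nth_root_power[OF assms(1)] prod_eq_iff)

lemma finite_unity_roots: "d > 0 \<Longrightarrow> finite {z :: complex. z ^ d = 1}"
  using bij_betw_finite[OF Complex.bij_betw_roots_unity[of d]] by simp

text \<open>Any choice of a d-th root of \<open>x\<close> defines \<open>q\<close>. Invariance makes
  the choice immaterial, so local branches of the root show holomorphy off \<open>x = 0\<close>, and
  continuity removes the singularity at \<open>x = 0\<close>.\<close>

lemma holo_germ_descend:
  assumes Q: "holo_germ Q" and d: "d > 0"
    and inv: "\<And>\<zeta>. \<zeta> ^ d = 1 \<Longrightarrow> \<forall>\<^sub>F p in nhds 0. Q (\<zeta> * fst p, snd p) = Q p"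
  shows "\<exists>q. holo_germ q \<and> (\<forall>\<^sub>F p in nhds 0. Q p = q (fst p ^ d, snd p))"
proof -
  have "\<forall>\<^sub>F p in nhds 0. \<forall>\<zeta>\<in>{z. z ^ d = 1}. Q (\<zeta> * fst p, snd p) = Q p"
    using inv by (intro eventually_ball_finite finite_unity_roots d) auto
  with Q have "\<forall>\<^sub>F p in nhds 0. holo2_at Q p \<and> (\<forall>\<zeta>\<in>{z. z ^ d = 1}. Q (\<zeta> * fst p, snd p) = Q p)"
    unfolding holo_germ_def by (rule eventually_conj)
  then obtain U where U': "open U" "0 \<in> U"
      "\<forall>p\<in>U. holo2_at Q p \<and> (\<forall>\<zeta>\<in>{z. z ^ d = 1}. Q (\<zeta> * fst p, snd p) = Q p)"
    unfolding eventually_nhds by (elim exE conjE)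
  have U: "open U" "0 \<in> U" "\<And>p. p \<in> U \<Longrightarrow> holo2_at Q p"
     "\<And>p \<zeta>. p \<in> U \<Longrightarrow> \<zeta> ^ d = 1 \<Longrightarrow> Q (\<zeta> * fst p, snd p) = Q p"
    using U' by simp_all
  obtain r where r: "r > 0" "cball 0 r \<times> cball 0 r \<subseteq> U"
    using open_prod_cball[OF U(1)] U(2) by (metis zero_prod_def)
  have inU: "(x, y) \<in> U" if "norm x < r" "norm y < r" for x y
    using r that by (auto simp: subset_iff)
  define q where "q = (\<lambda>p. Q (nth_root d (fst p), snd p))"
  \<comment> \<open>Two d-th roots of the same nonzero number differ by a root of unity, which
    \<open>Q\<close> ignores.\<close>
  have key: "Q (l, y) = q (x, y)" if "l ^ d = x" "norm l < r" "norm y < r" for l x y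
  proof (cases "x = 0")
    case True
    then show ?thesis using that d by (simp add: q_def)
  next
    case False
    have eq: "l ^ d = nth_root d x ^ d" using that d by (simp add: nth_root_power)
    have nz: "l \<noteq> 0" using that False d by auto
    then have "(nth_root d x / l) ^ d = 1" using eq[symmetric] by (simp add: power_divide)
    from U(4)[OF inU[OF that(2,3)] this] show ?thesis using nz by (simp add: q_def)
  qed
  define V :: "(complex \<times> complex) set" where "V = ball 0 (r ^ d) \<times> ball 0 r"
  have oV: "open V" by (simp add: V_def open_Times)
  have rt: "norm (nth_root d x) < r" if "norm x < r ^ d" for x
    using norm_nth_root_less[OF d that r(1)] .
  have h1: "holo2_at q p" if p: "p \<in> V" "fst p \<noteq> 0" for p
  proof -
    obtain x0 y0 where p': "p = (x0, y0)" by force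
    have x0: "x0 \<noteq> 0" "norm x0 < r ^ d" and y0: "norm y0 < r" using p p' by (auto simp: V_def)
    obtain l where l': "l x0 = nth_root d x0" "l analytic_on {x0}" "\<And>x. x \<noteq> 0 \<Longrightarrow> l x ^ d = x"
      using nth_root_local_branch[OF d x0(1)] by metis
    define D where "D = deriv l x0"
    have l: "l x0 = nth_root d x0" "(l has_field_derivative D) (at x0)" "\<And>x. x \<noteq> 0 \<Longrightarrow> l x ^ d = x"
      using l' analytic_on_imp_differentiable_at[OF l'(2)]
      by (simp_all add: D_def field_differentiable_derivI)
    have "holo2_at Q (l (fst p), snd p)" by (rule U(3)[OF inU]) (use l x0 y0 rt p' in auto)
    then obtain a b where ab: "(Q has_derivative (\<lambda>v. a * fst v + b * snd v)) (at (l (fst p), snd p))"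
      by (rule holo2_atE)
    have "((\<lambda>p. l (fst p)) has_derivative (\<lambda>v. D * fst v + 0 * snd v)) (at p)"
      using has_derivative_compose[of fst fst p UNIV l "(*) D"] l(2)
      by (simp add: p' has_field_derivative_def has_derivative_fst)
    moreover have "(snd has_derivative (\<lambda>v :: complex \<times> complex. 0 * fst v + 1 * snd v)) (at p)"
      by (auto intro!: derivative_eq_intros)
    ultimately have h: "holo2_at (\<lambda>p. Q (l (fst p), snd p)) p"
      by (rule holo2_atI[OF holo2_at_compose[of Q a b "\<lambda>p. l (fst p)" p snd, OF ab]])
    have "isCont (\<lambda>p. l (fst p)) p"
      using DERIV_isCont[OF l(2)] by (intro isCont_o2[OF isCont_fst]) (auto simp: p')
    then have "isCont (\<lambda>p. norm (l (fst p))) p" by (rule continuous_norm)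
    then have "\<forall>\<^sub>F q in nhds p. norm (l (fst q)) < r"
      using l(1) x0 rt unfolding continuous_at
      by (intro order_tendstoD(2)) (auto simp: tendsto_nhds_iff p')
    moreover have "\<forall>\<^sub>F q in nhds p. q \<in> V \<inter> fst -` (-{0})"
      using oV p by (intro eventually_nhds_in_open open_Int open_vimage_fst) auto
    \<comment> \<open>Near \<open>p\<close> the holomorphic branch \<open>l\<close> yields the same
      values as the possibly discontinuous \<open>nth_root\<close>.\<close>
    ultimately have "\<forall>\<^sub>F z in nhds p. Q (l (fst z), snd z) = q z"
    proof eventually_elim
      case (elim z)
      then show ?case using key[of "l (fst z)" "fst z" "snd z"] l(3) by (auto simp: V_def)
    qed
    then show ?thesis using h by (rule holo2_at_cong)
  qed
  have cq: "isCont q p" if p: "p \<in> V" for p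
  proof (cases "fst p = 0")
    case False
    then show ?thesis using h1[OF p] holo2_atE has_derivative_continuous by metis
  next
    case True
    then have "holo2_at Q (nth_root d (fst p), snd p)"
      using p r by (intro U(3)[OF inU]) (auto simp: V_def)
    then have "isCont Q (nth_root d (fst p), snd p)"
      using holo2_atE has_derivative_continuous by metis
    moreover have "isCont (\<lambda>p. (nth_root d (fst p), snd p)) p"
      by (rule isCont_nth_root_fst[OF d True])
    ultimately show ?thesis unfolding q_def by (rule isCont_o2[rotated])
  qed
  \<comment> \<open>A horizontal slice meets \<open>x = 0\<close> in one point, where continuity is
    known, so the singularity is removable.\<close>
  have h2: "(\<lambda>x. q (x, y)) holomorphic_on ball 0 (r ^ d)" if y: "norm y < r" for y
  proof (rule no_isolated_singularity[where K = "{0}"])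
    show "continuous_on (ball 0 (r ^ d)) (\<lambda>x. q (x, y))"
      by (rule continuous_on_compose2[of V q])
        (use cq y in \<open>auto intro!: continuous_at_imp_continuous_on continuous_intros simp: V_def\<close>)
    have "open (V - fst -` {0})" using oV by (intro open_Diff closed_vimage_fst) auto
    then have "sep_holo q (V - fst -` {0})" unfolding sep_holo_iff using h1 by auto
    then show "(\<lambda>x. q (x, y)) holomorphic_on ball 0 (r ^ d) - {0}"
      by (rule sep_holo_holomorphic) (use y in \<open>auto simp: V_def\<close>)
  qed auto
  have h3: "(\<lambda>y. q (x, y)) holomorphic_on ball 0 r" if x: "norm x < r ^ d" for x
  proof -
    have "sep_holo Q U" using U by (simp add: sep_holo_iff)
    then have "(\<lambda>y. Q (nth_root d x, y)) holomorphic_on ball 0 r"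
      by (rule sep_holo_holomorphic) (use rt[OF x] inU in auto)
    then show ?thesis by (simp add: q_def)
  qed
  have "sep_holo q V" unfolding sep_holo_def
  proof (intro conjI ballI oV)
    show "continuous_on V q" using cq by (simp add: continuous_at_imp_continuous_on)
    fix p assume "p \<in> V"
    then have p: "norm (fst p) < r ^ d" "norm (snd p) < r" by (auto simp: V_def)
    show "(\<lambda>x. q (x, snd p)) field_differentiable at (fst p)"
      by (rule holomorphic_on_imp_differentiable_at[OF h2]) (use p in auto)
    show "(\<lambda>y. q (fst p, y)) field_differentiable at (snd p)"
      by (rule holomorphic_on_imp_differentiable_at[OF h3]) (use p in auto)
  qed
  moreover have "0 \<in> V" using r by (simp add: zero_prod_def V_def)
  ultimately have "holo_germ q" unfolding holo_germ_iff by metis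
  moreover have "\<forall>\<^sub>F p in nhds 0. Q p = q (fst p ^ d, snd p)"
  proof -
    have "\<forall>\<^sub>F p in nhds (0 :: complex \<times> complex). p \<in> ball 0 r \<times> ball 0 r"
      using r by (intro eventually_nhds_in_open open_Times) (auto simp: zero_prod_def)
    then show ?thesis
      by eventually_elim (use key in \<open>force simp: mem_Times_iff\<close>)
  qed
  ultimately show ?thesis by metis
qed

section \<open>Orders and zeros of germs in one variable\<close>

text \<open>Power times unit is the working form of the order: later comparisons of orders are
  comparisons of such factorizations, with \<open>germ_ord_factor\<close> as the way back.\<close>

lemma analytic_factor:
  fixes h :: "complex \<Rightarrow> complex"
  assumes "h analytic_on {0}" "\<not> (\<forall>\<^sub>F t in nhds 0. h t = 0)"
  obtains m g where "g analytic_on {0}" "g 0 \<noteq> 0" "\<forall>\<^sub>F t in nhds 0. h t = t ^ m * g t" "germ_ord h = enat m"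
proof -
  define H where "H = fps_expansion h 0"
  have H: "h has_fps_expansion H"
    unfolding H_def using assms(1) by (rule analytic_at_imp_has_fps_expansion_0)
  have nz: "H \<noteq> 0"
    using assms(2) H unfolding has_fps_expansion_def by (auto elim: eventually_mono)
  define m where "m = subdegree H"
  define g where "g = eval_fps (fps_shift m H)"
  have r: "fps_conv_radius (fps_shift m H) > 0" using H by (simp add: has_fps_expansion_def)
  show ?thesis
  proof
    show "g analytic_on {0}" unfolding g_def
      using r by (intro analytic_on_eval_fps) (auto simp: zero_ereal_def)
    show "g 0 \<noteq> 0" using nz by (simp add: g_def eval_fps_at_0 m_def)
    have "eventually (\<lambda>t. t \<in> eball 0 (fps_conv_radius (fps_shift m H))) (nhds (0::complex))"
      using r by (intro eventually_nhds_in_open) (auto simp: zero_ereal_def)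
    moreover have "eventually (\<lambda>t. eval_fps H t = h t) (nhds 0)" using H by (simp add: has_fps_expansion_def)
    ultimately show "\<forall>\<^sub>F t in nhds 0. h t = t ^ m * g t"
    proof eventually_elim
      case (elim t)
      have "eval_fps (fps_shift m H * fps_X ^ m) t = eval_fps (fps_shift m H) t * eval_fps (fps_X ^ m) t"
        by (rule eval_fps_mult) (use elim in auto)
      moreover have "fps_shift m H * fps_X ^ m = H" by (simp add: m_def subdegree_decompose[symmetric])
      ultimately show ?case using elim by (simp add: g_def mult.commute)
    qed
    show "germ_ord h = enat m" unfolding germ_ord_def using assms(2) by (simp add: m_def H_def)
  qed
qed

lemma analytic_eventually_nonzero:
  fixes h :: "complex \<Rightarrow> complex"
  assumes "h analytic_on {0}" "\<not> (\<forall>\<^sub>F t in nhds 0. h t = 0)"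
  shows "\<forall>\<^sub>F t in at 0. h t \<noteq> 0"
proof -
  obtain m g where g: "g analytic_on {0}" "g 0 \<noteq> 0" "\<forall>\<^sub>F t in nhds 0. h t = t ^ m * g t"
    using analytic_factor[OF assms] by metis
  have "\<forall>\<^sub>F t in nhds 0. g t \<noteq> 0"
    using g(2) analytic_at_imp_isCont[OF g(1)] by (intro tendsto_imp_eventually_ne) (auto simp: tendsto_nhds_iff isContD)
  with g(3) have "\<forall>\<^sub>F t in nhds 0. t \<noteq> 0 \<longrightarrow> h t \<noteq> 0" by eventually_elim auto
  then show ?thesis by (simp add: eventually_at_filter)
qed

lemma analytic_zero_at:
  fixes h :: "complex \<Rightarrow> complex"
  assumes "h analytic_on {0}" "\<forall>\<^sub>F t in at 0. h t = 0"
  shows "\<forall>\<^sub>F t in nhds 0. h t = 0"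
proof (rule ccontr)
  assume "\<not> ?thesis"
  from analytic_eventually_nonzero[OF assms(1) this] assms(2)
  have "\<forall>\<^sub>F t in at (0 :: complex). False" by eventually_elim auto
  then show False by simp
qed

text \<open>Germs in one variable form an integral domain, because a nonzero germ has no zeros in a
  punctured neighbourhood.\<close>

lemma analytic_prod_zero:
  fixes h :: "'i \<Rightarrow> complex \<Rightarrow> complex"
  assumes "finite I" "\<And>i. i \<in> I \<Longrightarrow> h i analytic_on {0}" "\<forall>\<^sub>F t in nhds 0. (\<Prod>i\<in>I. h i t) = 0"
  shows "\<exists>i\<in>I. \<forall>\<^sub>F t in nhds 0. h i t = 0"
proof (rule ccontr)
  assume "\<not> ?thesis"
  then have "\<forall>\<^sub>F t in at 0. \<forall>i\<in>I. h i t \<noteq> 0"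
    using assms(1,2) by (intro eventually_ball_finite) (auto intro: analytic_eventually_nonzero)
  moreover have "\<forall>\<^sub>F t in at 0. (\<Prod>i\<in>I. h i t) = 0"
    using assms(3) by (auto simp: eventually_at_filter elim: eventually_mono)
  ultimately have "\<forall>\<^sub>F t in at (0 :: complex). False"
    by eventually_elim (use assms(1) in auto)
  then show False by simp
qed

text \<open>A nonzero \<open>h\<close> has no zero near 0 except possibly 0 itself, so
  \<open>h (\<sigma> t) = 0\<close> would force \<open>\<sigma> t = 0\<close>.\<close>

lemma analytic_compose_zero:
  fixes h \<sigma> :: "complex \<Rightarrow> complex"
  assumes "h analytic_on {0}" "\<sigma> analytic_on {0}" "\<sigma> 0 = 0" "\<not> (\<forall>\<^sub>F t in nhds 0. \<sigma> t = 0)"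
    "\<forall>\<^sub>F t in nhds 0. h (\<sigma> t) = 0"
  shows "\<forall>\<^sub>F t in nhds 0. h t = 0"
proof (rule ccontr)
  assume "\<not> ?thesis"
  then have "\<forall>\<^sub>F t in nhds 0. t \<noteq> 0 \<longrightarrow> h t \<noteq> 0"
    using analytic_eventually_nonzero[OF assms(1)] by (simp add: eventually_at_filter)
  then have "\<forall>\<^sub>F t in nhds 0. \<sigma> t \<noteq> 0 \<longrightarrow> h (\<sigma> t) \<noteq> 0"
    by (rule eventually_subst) (use assms analytic_at_imp_isCont in auto)
  with assms(5) have "\<forall>\<^sub>F t in nhds 0. \<sigma> t = 0" by eventually_elim auto
  with assms(4) show False by simp
qed

section \<open>The equation of a parametrized curve\<close>

text \<open>Here \<open>d\<close> is the multiplicative order of \<open>\<zeta>\<close>: the first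
  \<open>d\<close> powers are pairwise distinct d-th roots of unity, hence all of them.\<close>

lemma unity_root_generates:
  fixes \<zeta> :: complex
  assumes "n > 0" "\<zeta> ^ n = 1" "\<zeta> \<noteq> 1"
  obtains d where "d \<ge> 2" "d dvd n" "\<And>\<omega>. \<omega> ^ d = 1 \<Longrightarrow> \<exists>k. \<omega> = \<zeta> ^ k"
proof -
  define d where "d = (LEAST d. d > 0 \<and> \<zeta> ^ d = 1)"
  have d: "d > 0" "\<zeta> ^ d = 1"
    using LeastI[of "\<lambda>d. d > 0 \<and> \<zeta> ^ d = 1" n] assms unfolding d_def by auto
  have min: "d \<le> k" if "k > 0" "\<zeta> ^ k = 1" for k
    unfolding d_def using that by (intro Least_le) auto
  have "d \<noteq> 1" using d(2) assms(3) by auto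
  then have d2: "d \<ge> 2" using d(1) by linarith
  have "\<zeta> ^ n = (\<zeta> ^ d) ^ (n div d) * \<zeta> ^ (n mod d)"
    by (simp flip: power_mult power_add)
  then have "\<zeta> ^ (n mod d) = 1" using d(2) assms(2) by simp
  then have "n mod d = 0" using min[of "n mod d"] d(1) mod_less_divisor[of d n] by fastforce
  then have dvd: "d dvd n" by auto
  have nz: "\<zeta> \<noteq> 0" using d by (auto simp: power_0_left)
  have le: "\<not> i < j" if "\<zeta> ^ i = \<zeta> ^ j" "j < d" for i j
  proof
    assume "i < j"
    then have "\<zeta> ^ j = \<zeta> ^ i * \<zeta> ^ (j - i)" by (simp flip: power_add)
    then have "\<zeta> ^ (j - i) = 1" using that nz by simp
    then show False using min[of "j - i"] \<open>i < j\<close> that by simp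
  qed
  have inj: "inj_on (\<lambda>k. \<zeta> ^ k) {..<d}"
    by (intro inj_onI) (metis le lessThan_iff linorder_neqE_nat)
  have "(\<lambda>k. \<zeta> ^ k) ` {..<d} = {z. z ^ d = 1}"
  proof (rule card_subset_eq)
    show "finite {z :: complex. z ^ d = 1}" using d(1) by (rule finite_unity_roots)
    show "(\<lambda>k. \<zeta> ^ k) ` {..<d} \<subseteq> {z. z ^ d = 1}"
    proof clarsimp
      fix k
      have "(\<zeta> ^ k) ^ d = (\<zeta> ^ d) ^ k" by (metis mult.commute power_mult)
      then show "(\<zeta> ^ k) ^ d = 1" using d by simp
    qed
    show "card ((\<lambda>k. \<zeta> ^ k) ` {..<d}) = card {z :: complex. z ^ d = 1}"
      using d by (simp add: card_image[OF inj] card_roots_unity_eq)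
  qed
  then show ?thesis using that[OF d2 dvd] by blast
qed

lemma eventually_scale:
  fixes P :: "complex \<Rightarrow> bool"
  shows "\<forall>\<^sub>F t in nhds 0. P t \<Longrightarrow> \<forall>\<^sub>F t in nhds 0. P (c * t)"
  by (erule eventually_subst) (auto intro: continuous_intros)

lemma analytic_scale:
  fixes s :: "complex \<Rightarrow> complex"
  assumes "s analytic_on {0}"
  shows "(\<lambda>t. s (c * t)) analytic_on {0}"
  using analytic_on_compose_gen[of "\<lambda>t. c * t" "{0}" s "{0}"] assms
  by (auto simp: o_def intro!: analytic_intros)

lemma irreducible_paramD:
  assumes "irreducible_param h x y"
  shows "x analytic_on {0}" "y analytic_on {0}" "x 0 = 0" "y 0 = 0"
    "\<forall>\<^sub>F t in nhds 0. h (x t, y t) = 0"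
    "\<And>u v \<tau>. u analytic_on {0} \<Longrightarrow> v analytic_on {0} \<Longrightarrow> \<tau> analytic_on {0} \<Longrightarrow> \<tau> 0 = 0 \<Longrightarrow>
       \<forall>\<^sub>F t in nhds 0. x t = u (\<tau> t) \<and> y t = v (\<tau> t) \<Longrightarrow> deriv \<tau> 0 \<noteq> 0"
proof -
  show "x analytic_on {0}" "y analytic_on {0}" "x 0 = 0" "y 0 = 0" "\<forall>\<^sub>F t in nhds 0. h (x t, y t) = 0"
    using assms unfolding irreducible_param_def by simp_all
  show "deriv \<tau> 0 \<noteq> 0"
    if *: "u analytic_on {0}" "v analytic_on {0}" "\<tau> analytic_on {0}" "\<tau> 0 = 0"
      "\<forall>\<^sub>F t in nhds 0. x t = u (\<tau> t) \<and> y t = v (\<tau> t)" for u v \<tau>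
  proof
    assume "deriv \<tau> 0 = 0"
    with * have "\<exists>u v \<tau>. u analytic_on {0} \<and> v analytic_on {0} \<and> \<tau> analytic_on {0} \<and>
          \<tau> 0 = 0 \<and> deriv \<tau> 0 = 0 \<and> (\<forall>\<^sub>F t in nhds 0. x t = u (\<tau> t) \<and> y t = v (\<tau> t))"
      by (intro exI conjI)
    with assms show False unfolding irreducible_param_def by (elim conjE) (erule notE)
  qed
qed

lemma irreducible_param_pos:
  assumes "irreducible_param h (\<lambda>t. t ^ n) s"
  shows "n > 0"
  using irreducible_paramD(3)[OF assms] by (cases n) auto

text \<open>A series with a nontrivial rotational symmetry is a series in t^d, where
  \<open>d\<close> is the order of the rotation. Since \<open>d\<close> divides \<open>n\<close>, so
  is t^n, and the parametrization would factor through t^d.\<close>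

lemma irreducible_param_symmetry:
  assumes irr: "irreducible_param h (\<lambda>t. t ^ n) s"
    and \<zeta>: "\<zeta> ^ n = 1" "\<forall>\<^sub>F t in nhds 0. s (\<zeta> * t) = s t"
  shows "\<zeta> = 1"
proof (rule ccontr)
  note n = irreducible_param_pos[OF irr]
  note s = irreducible_paramD(2,4)[OF irr]
  assume "\<zeta> \<noteq> 1"
  then obtain d where d: "d \<ge> 2" "d dvd n" "\<And>\<omega>. \<omega> ^ d = 1 \<Longrightarrow> \<exists>k. \<omega> = \<zeta> ^ k"
    using unity_root_generates[OF n \<zeta>(1)] by metis
  have pw: "\<forall>\<^sub>F t in nhds 0. s (\<zeta> ^ k * t) = s t" for k
  proof (induction k)
    case (Suc k)
    from eventually_scale[OF Suc, of \<zeta>] \<zeta>(2) show ?case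
      by eventually_elim (simp add: mult_ac)
  qed simp
  \<comment> \<open>The one-variable germ is regarded as a germ in the plane, so that
    \<open>holo_germ_descend\<close> writes it as a function of t^d.\<close>
  have "holo_germ (\<lambda>p. s (fst p))"
    by (rule holo_germ_compose1[OF s(1) holo_germ_fst]) simp
  moreover have "\<forall>\<^sub>F p in nhds (0 :: complex \<times> complex). s (fst (\<omega> * fst p, snd p)) = s (fst p)"
    if \<omega>: "\<omega> ^ d = 1" for \<omega>
  proof -
    obtain k where "\<omega> = \<zeta> ^ k" using d(3)[OF \<omega>] by metis
    then have "\<forall>\<^sub>F t in nhds 0. s (\<omega> * t) = s t" using pw by simp
    then have "\<forall>\<^sub>F p in nhds (0 :: complex \<times> complex). s (\<omega> * fst p) = s (fst p)"
      by (rule eventually_subst) (auto intro: continuous_intros)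
    then show ?thesis by simp
  qed
  ultimately obtain q where q: "holo_germ q" "\<forall>\<^sub>F p in nhds (0 :: complex \<times> complex). s (fst p) = q (fst p ^ d, snd p)"
    using holo_germ_descend[of "\<lambda>p. s (fst p)" d] d(1) by force
  have ev: "\<forall>\<^sub>F t in nhds 0. s t = q (t ^ d, 0)"
    using eventually_subst[OF q(2), where g = "\<lambda>t. (t, 0)" and a = 0]
    by (auto intro!: isCont_Pair simp: zero_prod_def)
  have "deriv (\<lambda>t :: complex. t ^ d) 0 \<noteq> 0"
  proof (rule irreducible_paramD(6)[OF irr, where u = "\<lambda>z. z ^ (n div d)" and v = "\<lambda>z. q (z, 0)"])
    show "(\<lambda>z. q (z, 0)) analytic_on {0}"
      by (rule holo_germ_curve[OF q(1)]) (auto intro!: analytic_intros)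
    show "\<forall>\<^sub>F t in nhds 0. t ^ n = (t ^ d) ^ (n div d) \<and> s t = q (t ^ d, 0)"
      using ev d(2) by (auto simp flip: power_mult)
  qed (use d in \<open>auto intro!: analytic_intros\<close>)
  moreover have "((\<lambda>t. t ^ d) has_field_derivative 0) (at (0 :: complex))"
    using d(1) by (auto intro!: derivative_eq_intros)
  ultimately show False using DERIV_imp_deriv by metis
qed

text \<open>On each vertical line the linear factor vanishes in at most one point, and there
  \<open>R\<close> vanishes by continuity.\<close>

lemma holo_germ_linear_cancel:
  assumes s: "s analytic_on {0}" and R: "holo_germ R"
    and 0: "\<forall>\<^sub>F p in nhds 0. (snd p - s (fst p)) * R p = 0"
  shows "\<forall>\<^sub>F p in nhds 0. R p = 0"
proof -
  have "\<forall>\<^sub>F p in nhds 0. (\<forall>\<^sub>F q in nhds p. (snd q - s (fst q)) * R q = 0) \<and> holo2_at R p"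
    using 0 R by (simp add: eventually_conj_iff eventually_eventually holo_germ_def)
  then show ?thesis
  proof eventually_elim
    case (elim p)
    obtain x y where p: "p = (x, y)" by force
    from elim have "isCont R p" by (auto elim!: holo2_atE dest: has_derivative_continuous)
    moreover have cy: "isCont (\<lambda>y. (x, y)) y" by (intro isCont_Pair continuous_intros)
    ultimately have c: "isCont (\<lambda>y. R (x, y)) y" using isCont_o2[OF cy, of R] p by simp
    have "\<forall>\<^sub>F w in nhds y. (w - s x) * R (x, w) = 0"
      using eventually_subst[OF elim[THEN conjunct1] cy] p by simp
    then have ev: "\<forall>\<^sub>F w in at y. (w - s x) * R (x, w) = 0"
      by (auto simp: eventually_at_filter elim: eventually_mono)
    have "\<forall>\<^sub>F w in at y. w \<noteq> s x"
    proof (cases "y = s x")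
      case False
      then have "\<forall>\<^sub>F w in nhds y. w \<in> -{s x}" by (intro eventually_nhds_in_open) auto
      then show ?thesis by (auto simp: eventually_at_filter elim: eventually_mono)
    qed (auto simp: eventually_at_filter)
    with ev have "\<forall>\<^sub>F w in at y. R (x, w) = 0" by eventually_elim simp
    then have "((\<lambda>w. R (x, w)) \<longlongrightarrow> 0) (at y)" by (rule tendsto_eventually)
    moreover have "((\<lambda>w. R (x, w)) \<longlongrightarrow> R (x, y)) (at y)" using c by (simp add: isCont_def)
    ultimately have "R (x, y) = 0" using tendsto_unique trivial_limit_at by metis
    then show ?case by (simp add: p)
  qed
qed

lemma holo_germ_shear:
  assumes "s analytic_on {0}" "s 0 = 0" "holo_germ Q"
  shows "holo_germ (\<lambda>p. Q (fst p, snd p + s (fst p)))" "holo_germ (\<lambda>p. Q (fst p, snd p - s (fst p)))"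
    "isCont (\<lambda>p. (fst p, snd p - s (fst p))) (0 :: complex \<times> complex)"
proof -
  have h: "holo_germ (\<lambda>p. s (fst p))" by (rule holo_germ_compose1[OF assms(1) holo_germ_fst]) simp
  show "holo_germ (\<lambda>p. Q (fst p, snd p + s (fst p)))"
    by (rule holo_germ_compose) (simp_all add: assms holo_germ_fst holo_germ_snd holo_germ_add h)
  show "holo_germ (\<lambda>p. Q (fst p, snd p - s (fst p)))"
    by (rule holo_germ_compose) (simp_all add: assms holo_germ_fst holo_germ_snd holo_germ_diff h)
  show "isCont (\<lambda>p. (fst p, snd p - s (fst p))) (0 :: complex \<times> complex)"
    by (intro isCont_Pair holo_germ_isCont holo_germ_diff h holo_germ_fst holo_germ_snd)
qed

text \<open>A shear moves the graph of \<open>s\<close> to the axis \<open>y = 0\<close>, where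
  \<open>hadamard_division\<close> applies.\<close>

lemma holo_germ_linear_factor:
  assumes s: "s analytic_on {0}" "s 0 = 0" and Q: "holo_germ Q"
    and 0: "\<forall>\<^sub>F t in nhds 0. Q (t, s t) = 0"
  shows "\<exists>G. holo_germ G \<and> (\<forall>\<^sub>F p in nhds 0. Q p = (snd p - s (fst p)) * G p)"
proof -
  obtain G where G: "holo_germ G" "\<forall>\<^sub>F p in nhds 0. Q (fst p, snd p + s (fst p)) = snd p * G p"
    using hadamard_division[OF holo_germ_shear(1)[OF s Q]] 0 by auto
  have "\<forall>\<^sub>F p in nhds 0. Q p = (snd p - s (fst p)) * G (fst p, snd p - s (fst p))"
    using eventually_subst[OF G(2) holo_germ_shear(3)[OF s G(1)]] s by (simp add: prod_eq_iff)
  then show ?thesis using holo_germ_shear(2)[OF s G(1)] by (intro exI conjI)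
qed

text \<open>
  The Weierstrass polynomial of the curve \<open>(t\<^sup>n, s(t))\<close>, pulled back by \<open>x = t\<^sup>n\<close>.
\<close>

definition curve_poly :: "nat \<Rightarrow> (complex \<Rightarrow> complex) \<Rightarrow> complex \<times> complex \<Rightarrow> complex" where
  "curve_poly n s p = (\<Prod>\<zeta>\<in>{z. z ^ n = 1}. (snd p - s (\<zeta> * fst p)))"

lemma holo_germ_curve_factor:
  assumes "s analytic_on {0}"
  shows "holo_germ (\<lambda>p. snd p - s (\<zeta> * fst p))"
  by (intro holo_germ_diff holo_germ_snd holo_germ_compose1[OF analytic_scale[OF assms] holo_germ_fst]) simp

lemma holo_germ_curve_poly: "s analytic_on {0} \<Longrightarrow> holo_germ (curve_poly n s)"
  unfolding curve_poly_def[abs_def] by (intro holo_germ_prod holo_germ_curve_factor)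

text \<open>Rotating \<open>x\<close> only permutes the factors, by multiplication in the group of
  n-th roots of unity.\<close>

lemma curve_poly_rotate:
  assumes "n > 0" "\<zeta> ^ n = 1"
  shows "curve_poly n s (\<zeta> * fst p, snd p) = curve_poly n s p"
  unfolding curve_poly_def
proof (rule prod.reindex_bij_witness[where i = "\<lambda>\<omega>. \<omega> / \<zeta>" and j = "\<lambda>\<omega>. \<omega> * \<zeta>"])
  fix a :: complex
  show "a * \<zeta> \<in> {z. z ^ n = 1}" if "a \<in> {z. z ^ n = 1}" using that assms by (simp add: power_mult_distrib)
  show "a / \<zeta> \<in> {z. z ^ n = 1}" if "a \<in> {z. z ^ n = 1}" using that assms by (simp add: power_divide)
qed (use assms in \<open>auto simp: mult.assoc power_0_left\<close>)

lemma holo_germ_prod_cancel: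
  assumes "finite I" "s analytic_on {0}" "holo_germ R"
    "\<forall>\<^sub>F p in nhds 0. (\<Prod>\<zeta>\<in>I. (snd p - s (\<zeta> * fst p))) * R p = 0"
  shows "\<forall>\<^sub>F p in nhds 0. R p = 0"
  using assms(1,4)
proof (induction I)
  case (insert \<zeta> I)
  have "\<forall>\<^sub>F p in nhds 0. (\<Prod>\<zeta>\<in>I. (snd p - s (\<zeta> * fst p))) * R p = 0"
    by (rule holo_germ_linear_cancel[OF analytic_scale[OF assms(2), of \<zeta>]])
      (use insert assms in \<open>auto intro!: holo_germ_mult holo_germ_prod holo_germ_curve_factor simp: mult.assoc\<close>)
  then show ?case by (rule insert.IH)
qed simp

text \<open>If two conjugate series coincided, substituting \<open>t / \<omega>\<close> would
  exhibit \<open>\<zeta> / \<omega>\<close> as a symmetry of \<open>s\<close>.\<close>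

lemma irreducible_param_conjugates_differ:
  assumes irr: "irreducible_param h (\<lambda>t. t ^ n) s"
    and "\<zeta> ^ n = 1" "\<omega> ^ n = 1" "\<zeta> \<noteq> \<omega>"
  shows "\<forall>\<^sub>F t in at 0. s (\<zeta> * t) - s (\<omega> * t) \<noteq> 0"
proof (rule analytic_eventually_nonzero)
  note s = irreducible_paramD(2,4)[OF irr]
  note n = irreducible_param_pos[OF irr]
  show "(\<lambda>t. s (\<zeta> * t) - s (\<omega> * t)) analytic_on {0}" by (intro analytic_intros analytic_scale s)
  have nz: "\<omega> \<noteq> 0" using assms n by (auto simp: power_0_left)
  show "\<not> (\<forall>\<^sub>F t in nhds 0. s (\<zeta> * t) - s (\<omega> * t) = 0)"
  proof
    assume "\<forall>\<^sub>F t in nhds 0. s (\<zeta> * t) - s (\<omega> * t) = 0"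
    from eventually_scale[OF this, of "1 / \<omega>"]
    have "\<forall>\<^sub>F t in nhds 0. s ((\<zeta> / \<omega>) * t) = s t" using nz by simp
    moreover have "(\<zeta> / \<omega>) ^ n = 1" using assms by (simp add: power_divide)
    ultimately have "\<zeta> / \<omega> = 1" using irreducible_param_symmetry[OF irr, of "\<zeta> / \<omega>"] by blast
    then show False using assms(4) nz by simp
  qed
qed

text \<open>Factors are split off one at a time. On the conjugate curve of the next root the earlier
  factors are nonzero away from the origin, so the current quotient must vanish there and can be
  divided once more.\<close>

lemma pullback_division:
  assumes irr: "irreducible_param h (\<lambda>t. t ^ n) s"
    and g: "holo_germ g" "\<forall>\<^sub>F t in nhds 0. g (t ^ n, s t) = 0"
    and I: "finite I" "I \<subseteq> {z. z ^ n = 1}"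
  shows "\<exists>Q. holo_germ Q \<and> (\<forall>\<^sub>F p in nhds 0. g (fst p ^ n, snd p) = (\<Prod>\<zeta>\<in>I. (snd p - s (\<zeta> * fst p))) * Q p)"
  using I
proof (induction I)
  case empty
  have "holo_germ (\<lambda>p. g (fst p ^ n, snd p))"
    by (rule holo_germ_compose)
      (use irreducible_param_pos[OF irr] in \<open>auto intro!: g holo_germ_power holo_germ_fst holo_germ_snd\<close>)
  then show ?case by (intro exI[of _ "\<lambda>p. g (fst p ^ n, snd p)"]) simp
next
  case (insert \<zeta> I)
  note s = irreducible_paramD(2,4)[OF irr]
  define T where "T = (\<lambda>p. \<Prod>\<zeta>\<in>I. (snd p - s (\<zeta> * fst p)))"
  obtain Q where Q: "holo_germ Q" "\<forall>\<^sub>F p in nhds 0. g (fst p ^ n, snd p) = T p * Q p"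
    using insert unfolding T_def by auto
  have sz: "(\<lambda>t. s (\<zeta> * t)) analytic_on {0}" by (rule analytic_scale[OF s(1)])
  \<comment> \<open>The substitution x = t^n cannot tell \<open>\<zeta> * t\<close> from
    \<open>t\<close>, so the pullback of \<open>g\<close> vanishes on every conjugate curve.\<close>
  have "\<forall>\<^sub>F t in nhds 0. g ((\<zeta> * t) ^ n, s (\<zeta> * t)) = 0"
    by (rule eventually_scale[OF g(2)])
  moreover have "\<forall>\<^sub>F t in nhds 0. g (t ^ n, s (\<zeta> * t)) = T (t, s (\<zeta> * t)) * Q (t, s (\<zeta> * t))"
    using eventually_curve[OF Q(2) _ sz, of "\<lambda>t. t"] s by simp
  ultimately have "\<forall>\<^sub>F t in nhds 0. T (t, s (\<zeta> * t)) * Q (t, s (\<zeta> * t)) = 0"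
    by eventually_elim (use insert.prems in \<open>simp add: power_mult_distrib\<close>)
  then have "\<forall>\<^sub>F t in at 0. T (t, s (\<zeta> * t)) * Q (t, s (\<zeta> * t)) = 0"
    by (auto simp: eventually_at_filter elim: eventually_mono)
  moreover have "\<forall>\<^sub>F t in at 0. \<forall>\<omega>\<in>I. s (\<zeta> * t) - s (\<omega> * t) \<noteq> 0"
    using insert by (intro eventually_ball_finite ballI irreducible_param_conjugates_differ[OF irr]) auto
  ultimately have "\<forall>\<^sub>F t in at 0. Q (t, s (\<zeta> * t)) = 0"
    by eventually_elim (use insert in \<open>simp add: T_def\<close>)
  then have "\<forall>\<^sub>F t in nhds 0. Q (t, s (\<zeta> * t)) = 0"
    by (rule analytic_zero_at[rotated]) (intro holo_germ_curve[OF Q(1) _ sz] analytic_intros, simp_all add: s)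
  then obtain G where G: "holo_germ G" "\<forall>\<^sub>F p in nhds 0. Q p = (snd p - s (\<zeta> * fst p)) * G p"
    using holo_germ_linear_factor[OF sz _ Q(1)] s by auto
  from Q(2) G(2) have "\<forall>\<^sub>F p in nhds 0. g (fst p ^ n, snd p) = (\<Prod>\<zeta>\<in>insert \<zeta> I. (snd p - s (\<zeta> * fst p))) * G p"
    by eventually_elim (use insert in \<open>simp add: T_def mult_ac\<close>)
  then show ?case using G(1) by (intro exI conjI)
qed

lemma curve_poly_0: "n > 0 \<Longrightarrow> s 0 = 0 \<Longrightarrow> curve_poly n s 0 = 0"
  using card_roots_unity_eq[of n] by (simp add: curve_poly_def)

text \<open>\<open>W\<close> is the Weierstrass polynomial itself, as a germ in the plane below the
  covering x = t^n; it generates the ideal of germs vanishing on the curve.\<close>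

lemma curve_equation:
  assumes irr: "irreducible_param h (\<lambda>t. t ^ n) s"
  obtains W where "holo_germ W" "W 0 = 0" "\<forall>\<^sub>F p in nhds 0. curve_poly n s p = W (fst p ^ n, snd p)"
    "\<forall>g. holo_germ g \<longrightarrow> (\<forall>\<^sub>F t in nhds 0. g (t ^ n, s t) = 0) \<longrightarrow>
       (\<exists>q. holo_germ q \<and> (\<forall>\<^sub>F p in nhds 0. g p = W p * q p))"
proof -
  note s = irreducible_paramD(2,4)[OF irr]
  note n = irreducible_param_pos[OF irr]
  have rotW: "\<forall>\<^sub>F p in nhds 0. curve_poly n s (\<zeta> * fst p, snd p) = curve_poly n s p"
    if "\<zeta> ^ n = 1" for \<zeta>
    using curve_poly_rotate[OF n that] by (intro always_eventually allI)
  have "\<exists>W. holo_germ W \<and> (\<forall>\<^sub>F p in nhds 0. curve_poly n s p = W (fst p ^ n, snd p))"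
    by (rule holo_germ_descend[OF holo_germ_curve_poly[OF s(1)] n]) (rule rotW)
  then obtain W where W: "holo_germ W" "\<forall>\<^sub>F p in nhds 0. curve_poly n s p = W (fst p ^ n, snd p)"
    by (elim exE conjE)
  have W0: "W 0 = 0"
    using eventually_nhds_x_imp_x[OF W(2)] curve_poly_0[OF n] s n by (simp add: zero_prod_def power_0_left)
  have div: "\<exists>q. holo_germ q \<and> (\<forall>\<^sub>F p in nhds 0. g p = W p * q p)"
    if g: "holo_germ g" "\<forall>\<^sub>F t in nhds 0. g (t ^ n, s t) = 0" for g
  proof -
    obtain Q where Q: "holo_germ Q" "\<forall>\<^sub>F p in nhds 0. g (fst p ^ n, snd p) = curve_poly n s p * Q p"
      using pullback_division[OF irr g finite_unity_roots[OF n] order_refl, folded curve_poly_def]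
      by (elim exE conjE)
    have rot: "\<forall>\<^sub>F p in nhds 0. Q (\<zeta> * fst p, snd p) = Q p" if \<zeta>: "\<zeta> ^ n = 1" for \<zeta>
    proof -
      have hr: "holo_germ (\<lambda>p. Q (\<zeta> * fst p, snd p))"
        by (rule holo_germ_compose) (auto intro!: Q holo_germ_mult holo_germ_const holo_germ_fst holo_germ_snd)
      have "\<forall>\<^sub>F p in nhds 0. g ((\<zeta> * fst p) ^ n, snd p) = curve_poly n s (\<zeta> * fst p, snd p) * Q (\<zeta> * fst p, snd p)"
        using eventually_subst[OF Q(2), where g = "\<lambda>p. (\<zeta> * fst p, snd p)" and a = 0]
        by (auto intro!: isCont_Pair continuous_intros simp: zero_prod_def)
      \<comment> \<open>The rotation changes neither the pullback of \<open>g\<close> nor the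
        polynomial, so the two expressions for \<open>g\<close> differ only in the quotient, and the
        polynomial is cancelled.\<close>
      with Q(2) have "\<forall>\<^sub>F p in nhds 0. curve_poly n s p * (Q (\<zeta> * fst p, snd p) - Q p) = 0"
        by eventually_elim (auto simp: curve_poly_rotate[OF n \<zeta>] power_mult_distrib \<zeta>)
      then have "\<forall>\<^sub>F p in nhds 0. Q (\<zeta> * fst p, snd p) - Q p = 0"
        by (rule holo_germ_prod_cancel[OF finite_unity_roots[OF n] s(1) holo_germ_diff[OF hr Q(1)],
              folded curve_poly_def])
      then show ?thesis by simp
    qed
    have "\<exists>q. holo_germ q \<and> (\<forall>\<^sub>F p in nhds 0. Q p = q (fst p ^ n, snd p))"
      by (rule holo_germ_descend[OF Q(1) n]) (rule rot)
    then obtain q where q: "holo_germ q" "\<forall>\<^sub>F p in nhds 0. Q p = q (fst p ^ n, snd p)"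
      by (elim exE conjE)
    from Q(2) q(2) W(2) have "\<forall>\<^sub>F p in nhds 0. g (fst p ^ n, snd p) = W (fst p ^ n, snd p) * q (fst p ^ n, snd p)"
      by eventually_elim simp
    then have "\<forall>\<^sub>F p in nhds 0. g p = W p * q p"
      using eventually_power_fst[OF n, of "\<lambda>p. g p = W p * q p"] by simp
    then show ?thesis using q(1) by (intro exI conjI)
  qed
  show ?thesis by (rule that[OF W(1) W0 W(2)]) (intro allI impI, rule div)
qed

lemma analytic_compose0:
  fixes f g :: "complex \<Rightarrow> complex"
  assumes "f analytic_on {0}" "g analytic_on {0}" "g 0 = 0"
  shows "(\<lambda>t. f (g t)) analytic_on {0}"
  using analytic_on_compose_gen[OF assms(2,1)] assms(3) by (simp add: o_def)

lemma analytic_has_deriv: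
  fixes f :: "complex \<Rightarrow> complex"
  assumes "f analytic_on {z}"
  shows "(f has_field_derivative deriv f z) (at z)"
  using assms unfolding analytic_at_eventually by (rule eventually_nhds_x_imp_x)

lemma eventually_compose0:
  fixes \<tau> :: "complex \<Rightarrow> complex"
  assumes "\<forall>\<^sub>F t in nhds 0. P t" "\<tau> analytic_on {0}" "\<tau> 0 = 0"
  shows "\<forall>\<^sub>F t in nhds 0. P (\<tau> t)"
  by (rule eventually_subst[OF assms(1)]) (use assms analytic_at_imp_isCont in auto)

section \<open>Parametrizations of a branch\<close>

lemma germ_ord_factor:
  fixes h g :: "complex \<Rightarrow> complex"
  assumes "g analytic_on {0}" "g 0 \<noteq> 0" "\<forall>\<^sub>F t in nhds 0. h t = t ^ m * g t"
  shows "germ_ord h = enat m"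
proof -
  define G where "G = fps_expansion g 0"
  have G: "g has_fps_expansion G"
    unfolding G_def using assms(1) by (rule analytic_at_imp_has_fps_expansion_0)
  have "(\<lambda>t. t ^ m * g t) has_fps_expansion fps_X ^ m * G"
    by (intro fps_expansion_intros G)
  then have h: "h has_fps_expansion fps_X ^ m * G"
    using assms(3) unfolding has_fps_expansion_def by (auto elim: eventually_elim2)
  have "fps_nth G 0 \<noteq> 0" using has_fps_expansion_imp_0_eq_fps_nth_0[OF G] assms(2) by simp
  then have G0: "G \<noteq> 0" "subdegree G = 0" by auto
  have "h analytic_on {0}" using h by (rule has_fps_expansion_imp_analytic_0)
  then have "fps_expansion h 0 = fps_X ^ m * G"
    using fps_expansion_unique_complex[OF analytic_at_imp_has_fps_expansion_0 h] by simp
  then have sd: "subdegree (fps_expansion h 0) = m" using G0 by simp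
  have "\<not> (\<forall>\<^sub>F t in nhds 0. h t = 0)"
  proof
    assume "\<forall>\<^sub>F t in nhds 0. h t = 0"
    then have "h has_fps_expansion 0"
      unfolding has_fps_expansion_def by (auto elim: eventually_mono)
    from fps_expansion_unique_complex[OF h this] have "fps_X ^ m * G = 0" .
    then show False using G0 by simp
  qed
  then show ?thesis using sd by (simp add: germ_ord_def)
qed

text \<open>In the factorization of \<open>\<tau>\<close>, exponent 0 contradicts the value at 0 and
  an exponent from 2 on contradicts the derivative.\<close>

lemma analytic_simple_zero:
  fixes \<tau> :: "complex \<Rightarrow> complex"
  assumes "\<tau> analytic_on {0}" "\<tau> 0 = 0" "deriv \<tau> 0 \<noteq> 0"
  obtains g where "g analytic_on {0}" "g 0 \<noteq> 0" "\<forall>\<^sub>F t in nhds 0. \<tau> t = t * g t"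
proof -
  have D: "(\<tau> has_field_derivative deriv \<tau> 0) (at 0)"
    using assms(1) by (rule analytic_has_deriv)
  have "\<not> (\<forall>\<^sub>F t in nhds 0. \<tau> t = 0)"
  proof
    assume "\<forall>\<^sub>F t in nhds 0. \<tau> t = 0"
    then have "(\<tau> has_field_derivative 0) (at 0)"
      using DERIV_cong_ev[of 0 0 \<tau> "\<lambda>_. 0" 0 0] by simp
    then show False using D assms(3) by (auto dest: DERIV_unique)
  qed
  then obtain m g where g: "g analytic_on {0}" "g 0 \<noteq> 0" "\<forall>\<^sub>F t in nhds 0. \<tau> t = t ^ m * g t"
    by (rule analytic_factor[OF assms(1)])
  have "\<tau> 0 = 0 ^ m * g 0" using g(3) by (rule eventually_nhds_x_imp_x)
  then have "m \<noteq> 0" using assms(2) g(2) by auto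
  moreover have "\<not> m \<ge> 2"
  proof
    assume m: "m \<ge> 2"
    have "(g has_field_derivative deriv g 0) (at 0)"
      using g(1) by (rule analytic_has_deriv)
    then have "((\<lambda>t. t ^ m * g t) has_field_derivative 0) (at 0)"
      using m by (auto intro!: derivative_eq_intros simp: power_0_left)
    then have "(\<tau> has_field_derivative 0) (at 0)"
      using DERIV_cong_ev[OF refl g(3) refl] by simp
    then show False using D assms(3) by (auto dest: DERIV_unique)
  qed
  ultimately have "m = 1" by linarith
  then show ?thesis using that g by simp
qed

text \<open>If \<open>L\<close> is \<open>t ^ m\<close> times a unit \<open>g\<close>, then
  \<open>L (\<tau> t)\<close> is \<open>t ^ m\<close> times the unit
  \<open>k t ^ m * g (\<tau> t)\<close>, and \<open>d\<close> is one more unit. In the application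
  \<open>d\<close> is the derivative of \<open>\<tau>\<close>.\<close>

lemma germ_ord_reparam:
  assumes L: "L analytic_on {0}" and \<tau>: "\<tau> analytic_on {0}" "\<tau> 0 = 0" "deriv \<tau> 0 \<noteq> 0"
    and d: "d analytic_on {0}" "d 0 \<noteq> 0"
    and h: "\<forall>\<^sub>F t in nhds 0. h t = d t * L (\<tau> t)"
  shows "germ_ord h = germ_ord L"
proof (cases "\<forall>\<^sub>F t in nhds 0. L t = 0")
  case True
  have "\<forall>\<^sub>F t in nhds 0. L (\<tau> t) = 0" by (rule eventually_compose0[OF True \<tau>(1,2)])
  with h have "\<forall>\<^sub>F t in nhds 0. h t = 0" by eventually_elim simp
  with True show ?thesis by (simp add: germ_ord_def)
next
  case False
  obtain m g where g: "g analytic_on {0}" "g 0 \<noteq> 0" "\<forall>\<^sub>F t in nhds 0. L t = t ^ m * g t" "germ_ord L = enat m"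
    by (rule analytic_factor[OF L False])
  obtain k where k: "k analytic_on {0}" "k 0 \<noteq> 0" "\<forall>\<^sub>F t in nhds 0. \<tau> t = t * k t"
    by (rule analytic_simple_zero[OF \<tau>])
  have "germ_ord h = enat m"
  proof (rule germ_ord_factor)
    show "(\<lambda>t. d t * (k t ^ m * g (\<tau> t))) analytic_on {0}"
      by (intro analytic_on_mult analytic_on_power d(1) k(1) analytic_compose0[OF g(1) \<tau>(1,2)])
    show "\<forall>\<^sub>F t in nhds 0. h t = t ^ m * (d t * (k t ^ m * g (\<tau> t)))"
      using h k(3) eventually_compose0[OF g(3) \<tau>(1,2)]
      by eventually_elim (simp add: power_mult_distrib)
  qed (use d k g \<tau> in auto)
  then show ?thesis using g(4) by simp
qed

text \<open>\<open>h\<close> vanishes on the curve and is thus a multiple of the non-unit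
  \<open>W\<close>; irreducibility makes the cofactor a unit. So the abstract equation
  \<open>h\<close> may be traded for the explicit product over conjugate series.\<close>

lemma branch_curve:
  assumes br: "branch h" and irr: "irreducible_param h (\<lambda>t. t ^ n) s"
  obtains W q where "holo_germ W" "\<forall>\<^sub>F p in nhds 0. curve_poly n s p = W (fst p ^ n, snd p)"
    "\<forall>g. holo_germ g \<longrightarrow> (\<forall>\<^sub>F t in nhds 0. g (t ^ n, s t) = 0) \<longrightarrow>
       (\<exists>q. holo_germ q \<and> (\<forall>\<^sub>F p in nhds 0. g p = W p * q p))"
    "holo_germ q" "q 0 \<noteq> 0" "\<forall>\<^sub>F p in nhds 0. h p = W p * q p"
proof -
  obtain W where W: "holo_germ W" "W 0 = 0" "\<forall>\<^sub>F p in nhds 0. curve_poly n s p = W (fst p ^ n, snd p)"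
    and div: "\<forall>g. holo_germ g \<longrightarrow> (\<forall>\<^sub>F t in nhds 0. g (t ^ n, s t) = 0) \<longrightarrow>
       (\<exists>q. holo_germ q \<and> (\<forall>\<^sub>F p in nhds 0. g p = W p * q p))"
    by (rule curve_equation[OF irr])
  have h: "holo_germ h" using br by (simp add: branch_def)
  obtain q where q: "holo_germ q" "\<forall>\<^sub>F p in nhds 0. h p = W p * q p"
    using div[rule_format, OF h irreducible_paramD(5)[OF irr]] by (elim exE conjE)
  have "\<forall>g k. holo_germ g \<longrightarrow> holo_germ k \<longrightarrow> (\<forall>\<^sub>F p in nhds 0. h p = g p * k p) \<longrightarrow> g 0 \<noteq> 0 \<or> k 0 \<noteq> 0"
    using br by (simp add: branch_def)
  then have "q 0 \<noteq> 0" using W(1,2) q by simp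
  show ?thesis by (rule that[OF W(1,3) div q(1) \<open>q 0 \<noteq> 0\<close> q(2)])
qed

lemma holo_germ_nonzero:
  assumes "holo_germ q" "q 0 \<noteq> 0"
  shows "\<forall>\<^sub>F p in nhds 0. q p \<noteq> 0"
  using tendsto_imp_eventually_ne[OF holo_germ_tendsto[OF assms(1)] assms(2)] .

lemma branch_divides:
  assumes br: "branch h" and irr: "irreducible_param h (\<lambda>t. t ^ n) s"
    and g: "holo_germ g" "\<forall>\<^sub>F t in nhds 0. g (t ^ n, s t) = 0"
  shows "\<exists>r. holo_germ r \<and> (\<forall>\<^sub>F p in nhds 0. g p = r p * h p)"
proof -
  obtain W q where W: "\<forall>g. holo_germ g \<longrightarrow> (\<forall>\<^sub>F t in nhds 0. g (t ^ n, s t) = 0) \<longrightarrow>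
       (\<exists>q. holo_germ q \<and> (\<forall>\<^sub>F p in nhds 0. g p = W p * q p))"
    and q: "holo_germ q" "q 0 \<noteq> 0" "\<forall>\<^sub>F p in nhds 0. h p = W p * q p"
    by (rule branch_curve[OF br irr])
  obtain r where r: "holo_germ r" "\<forall>\<^sub>F p in nhds 0. g p = W p * r p" using W[rule_format, OF g] by (elim exE conjE)
  have "\<forall>\<^sub>F p in nhds 0. g p = (r p * inverse (q p)) * h p"
    using r(2) q(3) holo_germ_nonzero[OF q(1,2)] by eventually_elim simp
  moreover have "holo_germ (\<lambda>p. r p * inverse (q p))" by (intro holo_germ_mult holo_germ_inverse r q)
  ultimately show ?thesis by (intro exI[of _ "\<lambda>p. r p * inverse (q p)"] conjI)
qed

text \<open>Reducedness in concrete form: \<open>y - s(x)\<close> is a simple factor of the pullback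
  of \<open>h\<close>, so on the curve the y-derivative is the product of the other factors, namely
  differences of conjugate series and a unit.\<close>

lemma branch_pd2_nonzero:
  assumes br: "branch h" and irr: "irreducible_param h (\<lambda>t. t ^ n) s"
  shows "\<not> (\<forall>\<^sub>F t in nhds 0. pd2 h (t ^ n, s t) = 0)"
proof
  assume 0: "\<forall>\<^sub>F t in nhds 0. pd2 h (t ^ n, s t) = 0"
  note s = irreducible_paramD(2,4)[OF irr]
  note n = irreducible_param_pos[OF irr]
  obtain W q where W: "\<forall>\<^sub>F p in nhds 0. curve_poly n s p = W (fst p ^ n, snd p)"
    and q: "holo_germ q" "q 0 \<noteq> 0" "\<forall>\<^sub>F p in nhds 0. h p = W p * q p"
    by (rule branch_curve[OF br irr])
  define R where "R = {z :: complex. z ^ n = 1}"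
  have R: "finite R" "1 \<in> R" using finite_unity_roots[OF n] by (auto simp: R_def)
  define T where "T = (\<lambda>p. \<Prod>\<zeta>\<in>R - {1}. (snd p - s (\<zeta> * fst p)))"
  have hT: "holo_germ T" unfolding T_def by (intro holo_germ_prod holo_germ_curve_factor s)
  have cp: "curve_poly n s p = (snd p - s (fst p)) * T p" for p
    unfolding curve_poly_def T_def R_def[symmetric] using prod.remove[OF R, of "\<lambda>\<zeta>. snd p - s (\<zeta> * fst p)"] by simp
  have pown: "isCont (\<lambda>p :: complex \<times> complex. (fst p ^ n, snd p)) 0"
    by (intro isCont_Pair continuous_intros)
  define E where "E = (\<lambda>p. T p * q (fst p ^ n, snd p))"
  have hq: "holo_germ (\<lambda>p. q (fst p ^ n, snd p))"
    by (rule holo_germ_compose) (use n in \<open>auto intro!: q holo_germ_power holo_germ_fst holo_germ_snd\<close>)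
  have hE: "holo_germ E" unfolding E_def by (intro holo_germ_mult hT hq)
  have "\<forall>\<^sub>F p in nhds 0. h (fst p ^ n, snd p) = W (fst p ^ n, snd p) * q (fst p ^ n, snd p)"
    using eventually_subst[OF q(3) pown] n by (simp add: prod_eq_iff)
  with W have eq: "\<forall>\<^sub>F p in nhds 0. h (fst p ^ n, snd p) = (snd p - s (fst p)) * E p"
    by eventually_elim (simp add: cp E_def)
  have hh: "holo_germ h" using br by (simp add: branch_def)
  note holo_germ_derivative[OF hE]
  moreover have "\<forall>\<^sub>F p in nhds 0. (h has_derivative (\<lambda>v. pd1 h (fst p ^ n, snd p) * fst v + pd2 h (fst p ^ n, snd p) * snd v))
      (at (fst p ^ n, snd p))"
    using eventually_subst[OF holo_germ_derivative[OF hh] pown] n by (simp add: prod_eq_iff)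
  moreover have "\<forall>\<^sub>F p in nhds 0. \<forall>\<^sub>F p in nhds p. h (fst p ^ n, snd p) = (snd p - s (fst p)) * E p"
    using eq by (simp add: eventually_eventually)
  ultimately have "\<forall>\<^sub>F p in nhds 0. snd p = s (fst p) \<longrightarrow> pd2 h (fst p ^ n, snd p) = E p"
  proof eventually_elim
    case (elim p)
    obtain x y where p: "p = (x, y)" by force
    have cy: "isCont (\<lambda>y. (x, y)) y" by (intro isCont_Pair continuous_intros)
    have ev: "\<forall>\<^sub>F w in nhds y. h (x ^ n, w) = (w - s x) * E (x, w)"
      using eventually_subst[OF elim(3) cy] p by simp
    have "((\<lambda>y. E (x, y)) has_field_derivative pd2 E p) (at y)"
      using elim(1) unfolding p by (rule holo2_imp_section(2))
    then have "((\<lambda>w. (w - s x) * E (x, w)) has_field_derivative (1 * E (x, y) + pd2 E p * (y - s x))) (at y)"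
      by (intro DERIV_mult) (auto intro!: derivative_eq_intros)
    then have "((\<lambda>w. h (x ^ n, w)) has_field_derivative (1 * E (x, y) + pd2 E p * (y - s x))) (at y)"
      using DERIV_cong_ev[OF refl ev refl] by simp
    moreover have "((\<lambda>w. h (x ^ n, w)) has_field_derivative pd2 h (x ^ n, y)) (at y)"
      using elim(2) unfolding p fst_conv snd_conv by (rule holo2_imp_section(2))
    ultimately have "pd2 h (x ^ n, y) = 1 * E (x, y) + pd2 E p * (y - s x)" by (metis DERIV_unique)
    then show ?case by (auto simp: p)
  qed
  from eventually_curve[OF this _ s(1) _ s(2), of "\<lambda>t. t"]
  have "\<forall>\<^sub>F t in nhds 0. pd2 h (t ^ n, s t) = E (t, s t)" by (simp add: analytic_on_ident)
  with 0 have "\<forall>\<^sub>F t in nhds 0. E (t, s t) = 0" by eventually_elim simp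
  then have "\<forall>\<^sub>F t in at 0. E (t, s t) = 0" by (auto simp: eventually_at_filter elim: eventually_mono)
  moreover have "\<forall>\<^sub>F t in nhds 0. q (t ^ n, s t) \<noteq> 0"
    by (rule eventually_curve[OF holo_germ_nonzero[OF q(1,2)] irreducible_paramD(1-4)[OF irr]])
  then have "\<forall>\<^sub>F t in at 0. q (t ^ n, s t) \<noteq> 0" by (auto simp: eventually_at_filter elim: eventually_mono)
  moreover have "\<forall>\<^sub>F t in at 0. \<forall>\<zeta>\<in>R - {1}. s (1 * t) - s (\<zeta> * t) \<noteq> 0"
    using R by (intro eventually_ball_finite ballI irreducible_param_conjugates_differ[OF irr]) (auto simp: R_def)
  ultimately have "\<forall>\<^sub>F t in at (0 :: complex). False"
    by eventually_elim (use R in \<open>auto simp: E_def T_def\<close>)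
  then show False by simp
qed

text \<open>After replacing t by t^n the first coordinate becomes an n-th power, that of
  \<open>\<sigma>\<close>, and the equation forces
  \<open>y (t ^ n) = s (\<zeta> * \<sigma> t)\<close> for one root of unity \<open>\<zeta>\<close>.
  Undoing the substitution requires \<open>n\<close> to divide the order \<open>m\<close> of
  \<open>x\<close>: rotating \<open>t\<close> by \<open>\<omega>\<close> multiplies
  \<open>\<sigma>\<close> by \<open>\<omega> ^ m\<close> and leaves \<open>y (t ^ n)\<close> alone,
  so \<open>s\<close> has the symmetry \<open>\<omega> ^ m\<close>, which primitivity makes
  trivial.\<close>

lemma irreducible_param_reparam:
  assumes br: "branch h" and irr: "irreducible_param h (\<lambda>t. t ^ n) s" and irr': "irreducible_param h x y"
  obtains \<tau> where "\<tau> analytic_on {0}" "\<tau> 0 = 0" "deriv \<tau> 0 \<noteq> 0"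
    "\<forall>\<^sub>F t in nhds 0. x t = \<tau> t ^ n \<and> y t = s (\<tau> t)"
proof -
  note s = irreducible_paramD(2,4)[OF irr]
  note n = irreducible_param_pos[OF irr]
  note xy = irreducible_paramD(1-4)[OF irr']
  obtain W q where W: "holo_germ W" "\<forall>\<^sub>F p in nhds 0. curve_poly n s p = W (fst p ^ n, snd p)"
    and q: "holo_germ q" "q 0 \<noteq> 0" "\<forall>\<^sub>F p in nhds 0. h p = W p * q p"
    by (rule branch_curve[OF br irr])
  have W0: "\<forall>\<^sub>F t in nhds 0. W (x t, y t) = 0"
    using irreducible_paramD(5)[OF irr'] eventually_curve[OF q(3) xy]
      eventually_curve[OF holo_germ_nonzero[OF q(1,2)] xy]
    by eventually_elim simp
  \<comment> \<open>Over \<open>x = 0\<close> all factors of the Weierstrass polynomial reduce to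
    \<open>y\<close>, so a parametrization inside that line would be constant, and constant maps are
    not primitive.\<close>
  have x0: "\<not> (\<forall>\<^sub>F t in nhds 0. x t = 0)"
  proof
    assume x0: "\<forall>\<^sub>F t in nhds 0. x t = 0"
    have "\<forall>\<^sub>F t in nhds 0. curve_poly n s (0, y t) = W (0 ^ n, y t)"
      using eventually_curve[OF W(2), of "\<lambda>_. 0" y] xy by simp
    with W0 x0 have "\<forall>\<^sub>F t in nhds 0. y t = 0"
      by eventually_elim (use n in \<open>simp add: curve_poly_def s power_0_left card_roots_unity_eq\<close>)
    with x0 have "\<forall>\<^sub>F t in nhds 0. x t = (\<lambda>_. 0) (0 :: complex) \<and> y t = (\<lambda>_. 0) (0 :: complex)"
      by eventually_elim simp
    then have "deriv (\<lambda>_ :: complex. 0 :: complex) 0 \<noteq> 0"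
      by (intro irreducible_paramD(6)[OF irr', of "\<lambda>_. 0" "\<lambda>_. 0"]) auto
    then show False by simp
  qed
  obtain m g where g: "g analytic_on {0}" "g 0 \<noteq> 0" "\<forall>\<^sub>F t in nhds 0. x t = t ^ m * g t"
    by (rule analytic_factor[OF xy(1) x0])
  \<comment> \<open>The unit part of \<open>x\<close> is nonzero at 0 and therefore has a
    holomorphic n-th root there; the power \<open>t ^ m\<close> acquires one through t^n.\<close>
  obtain l where l: "l analytic_on {g 0}" "\<forall>z. z \<noteq> 0 \<longrightarrow> l z ^ n = z"
    using nth_root_local_branch[OF n g(2)] by metis
  define v where "v = (\<lambda>t. l (g t))"
  have v: "v analytic_on {0}"
    using analytic_on_compose_gen[OF g(1) l(1)] by (simp add: v_def o_def)
  have "\<forall>\<^sub>F t in nhds 0. g t \<noteq> 0"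
    using g(2) analytic_at_imp_isCont[OF g(1)]
    by (intro tendsto_imp_eventually_ne) (auto simp: tendsto_nhds_iff isContD)
  then have vn: "\<forall>\<^sub>F t in nhds 0. v t ^ n = g t"
    by eventually_elim (use l in \<open>simp add: v_def\<close>)
  have g0: "x 0 = 0 ^ m * g 0" using g(3) by (rule eventually_nhds_x_imp_x)
  then have m: "m > 0" using xy(3) g(2) by (cases m) auto
  define \<sigma> where "\<sigma> = (\<lambda>t. t ^ m * v (t ^ n))"
  have pw: "(\<lambda>t :: complex. t ^ n) analytic_on {0}" "(0 :: complex) ^ n = 0" using n by (auto intro!: analytic_intros)
  have \<sigma>: "\<sigma> analytic_on {0}" "\<sigma> 0 = 0"
    unfolding \<sigma>_def using m by (auto intro!: analytic_on_mult analytic_on_power analytic_on_ident analytic_compose0[OF v pw])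
  have \<sigma>n: "\<forall>\<^sub>F t in nhds 0. \<sigma> t ^ n = x (t ^ n)"
    using eventually_compose0[OF g(3) pw] eventually_compose0[OF vn pw]
    by eventually_elim (simp add: \<sigma>_def power_mult_distrib mult.commute flip: power_mult)
  have yn: "(\<lambda>t. y (t ^ n)) analytic_on {0}" "y (0 ^ n) = 0"
    using analytic_compose0[OF xy(2) pw] n xy(4) by (simp_all add: power_0_left)
  have "\<forall>\<^sub>F t in nhds 0. curve_poly n s (\<sigma> t, y (t ^ n)) = W (\<sigma> t ^ n, y (t ^ n))"
    using eventually_curve[OF W(2) \<sigma>(1) yn(1) \<sigma>(2) yn(2)] by simp
  with \<sigma>n eventually_compose0[OF W0 pw]
  have "\<forall>\<^sub>F t in nhds 0. (\<Prod>\<zeta>\<in>{z. z ^ n = 1}. (y (t ^ n) - s (\<zeta> * \<sigma> t))) = 0"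
    by eventually_elim (simp add: curve_poly_def)
  moreover have "(\<lambda>t. y (t ^ n) - s (\<zeta> * \<sigma> t)) analytic_on {0}" for \<zeta>
    by (intro analytic_on_diff yn(1) analytic_compose0[OF analytic_scale[OF s(1)] \<sigma>])
  ultimately have "\<exists>\<zeta>\<in>{z. z ^ n = 1}. \<forall>\<^sub>F t in nhds 0. y (t ^ n) - s (\<zeta> * \<sigma> t) = 0"
    by (intro analytic_prod_zero finite_unity_roots n)
  then obtain \<zeta> where \<zeta>: "\<zeta> ^ n = 1" "\<forall>\<^sub>F t in nhds 0. y (t ^ n) - s (\<zeta> * \<sigma> t) = 0" by blast
  have \<zeta>0: "\<zeta> \<noteq> 0" using \<zeta>(1) n by (auto simp: power_0_left)
  have \<sigma>0: "\<not> (\<forall>\<^sub>F t in nhds 0. \<zeta> * \<sigma> t = 0)"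
  proof
    assume "\<forall>\<^sub>F t in nhds 0. \<zeta> * \<sigma> t = 0"
    with \<sigma>n have ev: "\<forall>\<^sub>F t in nhds 0. x (t ^ n) = 0"
      by eventually_elim (use \<zeta>0 n in \<open>auto simp: power_0_left\<close>)
    have "\<not> (\<forall>\<^sub>F t in nhds 0. t ^ n = (0 :: complex))"
    proof
      assume "\<forall>\<^sub>F t in nhds 0. t ^ n = (0 :: complex)"
      then have "\<forall>\<^sub>F t in at 0. t = (0 :: complex)"
        by (auto simp: eventually_at_filter elim: eventually_mono)
      then have "\<forall>\<^sub>F t in at (0 :: complex). False"
        unfolding eventually_at_filter by eventually_elim simp
      then show False by simp
    qed
    from analytic_compose_zero[OF xy(1) pw this ev] x0 show False by simp
  qed
  have m1: "\<omega> ^ m = 1" if \<omega>: "\<omega> ^ n = 1" for \<omega> :: complex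
  proof (rule irreducible_param_symmetry[OF irr])
    show "(\<omega> ^ m) ^ n = 1" using \<omega> by (metis mult.commute power_mult power_one)
    have "\<sigma> (\<omega> * t) = \<omega> ^ m * \<sigma> t" for t
      using \<omega> by (simp add: \<sigma>_def power_mult_distrib)
    then have "\<forall>\<^sub>F t in nhds 0. y (t ^ n) - s (\<zeta> * (\<omega> ^ m * \<sigma> t)) = 0"
      using eventually_scale[OF \<zeta>(2), of \<omega>] \<omega> by (simp add: power_mult_distrib)
    with \<zeta>(2) have "\<forall>\<^sub>F t in nhds 0. s (\<omega> ^ m * (\<zeta> * \<sigma> t)) - s (\<zeta> * \<sigma> t) = 0"
      by eventually_elim (simp add: mult_ac)
    moreover have "(\<lambda>t. s (\<omega> ^ m * t) - s t) analytic_on {0}"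
      by (rule analytic_on_diff[OF analytic_scale[OF s(1)] s(1)])
    moreover have "(\<lambda>t. \<zeta> * \<sigma> t) analytic_on {0}"
      by (rule analytic_on_mult[OF analytic_on_const \<sigma>(1)])
    ultimately have "\<forall>\<^sub>F t in nhds 0. s (\<omega> ^ m * t) - s t = 0"
      using analytic_compose_zero[of "\<lambda>t. s (\<omega> ^ m * t) - s t" "\<lambda>t. \<zeta> * \<sigma> t"] \<sigma>0 \<sigma>(2) by simp
    then show "\<forall>\<^sub>F t in nhds 0. s (\<omega> ^ m * t) = s t" by simp
  qed
  \<comment> \<open>A generator of the n-th roots of unity: its m-th power is 1 exactly if
    \<open>n\<close> divides \<open>m\<close>.\<close>
  have "exp (2 * of_real pi * \<i> * of_nat 1 / of_nat n) ^ n = (1 :: complex)"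
    using n by (simp flip: exp_of_nat_mult)
  from m1[OF this] have "exp (2 * of_real pi * \<i> * of_nat m / of_nat n) = (1 :: complex)"
    by (simp add: mult_ac flip: exp_of_nat_mult)
  then have "n dvd m" using complex_root_unity_eq_1[of n m] n by simp
  then obtain k where k: "m = n * k" by (elim dvdE)
  define \<tau> where "\<tau> = (\<lambda>t. \<zeta> * (t ^ k * v t))"
  have \<tau>: "\<tau> analytic_on {0}" "\<tau> 0 = 0"
    unfolding \<tau>_def using m k by (auto intro!: analytic_on_mult analytic_on_power analytic_on_ident v simp: power_0_left)
  have \<tau>n: "\<tau> (t ^ n) = \<zeta> * \<sigma> t" for t by (simp add: \<tau>_def \<sigma>_def k power_mult)
  have "\<forall>\<^sub>F t in nhds 0. x (t ^ n) = \<tau> (t ^ n) ^ n \<and> y (t ^ n) = s (\<tau> (t ^ n))"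
    using \<sigma>n \<zeta>(2) by eventually_elim (simp add: \<tau>n power_mult_distrib \<zeta>(1))
  from eventually_subst[OF this isCont_nth_root[OF n]]
  have ev: "\<forall>\<^sub>F t in nhds 0. x t = \<tau> t ^ n \<and> y t = s (\<tau> t)"
    by (simp add: nth_root_power[OF n])
  \<comment> \<open>Primitivity of \<open>(x, y)\<close> itself, which has just been factored
    through \<open>\<tau>\<close>.\<close>
  have "deriv \<tau> 0 \<noteq> 0"
    by (rule irreducible_paramD(6)[OF irr', of "\<lambda>z. z ^ n" s]) (use s \<tau> ev in \<open>auto intro!: analytic_intros\<close>)
  then show ?thesis using that[OF \<tau> _ ev] by simp
qed

section \<open>Changes of coordinates\<close>

definition holo_map :: "(complex \<times> complex \<Rightarrow> complex \<times> complex) \<Rightarrow> bool" where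
  "holo_map \<Psi> \<longleftrightarrow> holo_germ (\<lambda>p. fst (\<Psi> p)) \<and> holo_germ (\<lambda>p. snd (\<Psi> p)) \<and> \<Psi> 0 = 0"

lemma holo_map_compose:
  assumes "holo_germ F" "holo_map \<Psi>"
  shows "holo_germ (\<lambda>p. F (\<Psi> p))"
  using holo_germ_compose[of F "\<lambda>p. fst (\<Psi> p)" "\<lambda>p. snd (\<Psi> p)"] assms by (simp add: holo_map_def)

lemma holo_map_isCont: "holo_map \<Psi> \<Longrightarrow> isCont \<Psi> 0"
  using isCont_Pair[of 0 "\<lambda>p. fst (\<Psi> p)" "\<lambda>p. snd (\<Psi> p)"]
  by (simp add: holo_map_def holo_germ_isCont)

lemma holo_map_eventually:
  assumes "\<forall>\<^sub>F p in nhds 0. P p" "holo_map \<Psi>"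
  shows "\<forall>\<^sub>F p in nhds 0. P (\<Psi> p)"
  by (rule eventually_subst[OF assms(1) holo_map_isCont[OF assms(2)]]) (use assms in \<open>simp add: holo_map_def\<close>)

lemma holo_map_comp: "holo_map \<Psi> \<Longrightarrow> holo_map \<Phi> \<Longrightarrow> holo_map (\<lambda>p. \<Psi> (\<Phi> p))"
  using holo_map_compose[of "\<lambda>p. fst (\<Psi> p)" \<Phi>] holo_map_compose[of "\<lambda>p. snd (\<Psi> p)" \<Phi>]
  by (auto simp: holo_map_def)

lemma holo_map_curve:
  assumes "holo_map \<Psi>" "x analytic_on {0}" "y analytic_on {0}" "x 0 = 0" "y 0 = 0"
  shows "(\<lambda>t. fst (\<Psi> (x t, y t))) analytic_on {0}" "(\<lambda>t. snd (\<Psi> (x t, y t))) analytic_on {0}"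
    "fst (\<Psi> (x 0, y 0)) = 0" "snd (\<Psi> (x 0, y 0)) = 0"
proof -
  have "(x 0, y 0) = 0" using assms by (simp add: zero_prod_def)
  then show "fst (\<Psi> (x 0, y 0)) = 0" "snd (\<Psi> (x 0, y 0)) = 0" using assms(1) by (simp_all add: holo_map_def)
qed (use assms holo_germ_curve in \<open>auto simp: holo_map_def\<close>)

text \<open>A factorization of the image parametrization through some \<open>\<tau>\<close> is
  carried back by \<open>\<Phi>\<close> to one of \<open>(x, y)\<close> through the same
  \<open>\<tau>\<close>.\<close>

lemma irreducible_param_push:
  assumes \<Psi>: "holo_map \<Psi>" and \<Phi>: "holo_map \<Phi>" and inv: "\<forall>\<^sub>F p in nhds 0. \<Phi> (\<Psi> p) = p"
    and irr: "irreducible_param h x y"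
    and f: "\<forall>\<^sub>F t in nhds 0. f (\<Psi> (x t, y t)) = 0"
  shows "irreducible_param f (\<lambda>t. fst (\<Psi> (x t, y t))) (\<lambda>t. snd (\<Psi> (x t, y t)))"
proof -
  note xy = irreducible_paramD(1-4)[OF irr]
  have False if *: "u analytic_on {0}" "v analytic_on {0}" "\<tau> analytic_on {0}" "\<tau> 0 = 0" "deriv \<tau> 0 = 0"
    "\<forall>\<^sub>F t in nhds 0. fst (\<Psi> (x t, y t)) = u (\<tau> t) \<and> snd (\<Psi> (x t, y t)) = v (\<tau> t)" for u v \<tau>
  proof -
    from eventually_nhds_x_imp_x[OF *(6)] have uv0: "u 0 = 0" "v 0 = 0"
      using holo_map_curve(3,4)[OF \<Psi> xy] *(4) by simp_all
    have "\<forall>\<^sub>F t in nhds 0. x t = fst (\<Phi> (u (\<tau> t), v (\<tau> t))) \<and> y t = snd (\<Phi> (u (\<tau> t), v (\<tau> t)))"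
      using *(6) eventually_curve[OF inv xy]
    proof eventually_elim
      case (elim t)
      then have "\<Psi> (x t, y t) = (u (\<tau> t), v (\<tau> t))" by (simp add: prod_eq_iff)
      then show ?case using elim(2) by simp
    qed
    then have "deriv \<tau> 0 \<noteq> 0"
      by (intro irreducible_paramD(6)[OF irr holo_map_curve(1,2)[OF \<Phi> *(1,2) uv0] *(3,4)])
    with *(5) show False by simp
  qed
  then have "\<not> (\<exists>u v \<tau>. u analytic_on {0} \<and> v analytic_on {0} \<and> \<tau> analytic_on {0} \<and>
          \<tau> 0 = 0 \<and> deriv \<tau> 0 = 0 \<and> (\<forall>\<^sub>F t in nhds 0. fst (\<Psi> (x t, y t)) = u (\<tau> t) \<and> snd (\<Psi> (x t, y t)) = v (\<tau> t)))"
    by (intro notI, elim exE conjE)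
  then show ?thesis
    unfolding irreducible_param_def using holo_map_curve[OF \<Psi> xy] f by simp
qed

text \<open>Composition with \<open>\<Phi>\<close> turns a factorization of the pulled back equation
  into one of \<open>f\<close>, with the same values of the factors at the origin.\<close>

lemma branch_pull:
  assumes br: "branch f" and \<Theta>: "holo_map \<Theta>" and \<Phi>: "holo_map \<Phi>"
    and inv: "\<forall>\<^sub>F p in nhds 0. \<Phi> (\<Theta> p) = p" "\<forall>\<^sub>F p in nhds 0. \<Theta> (\<Phi> p) = p"
  shows "branch (\<lambda>p. f (\<Theta> p))"
  unfolding branch_def
proof (intro conjI allI impI)
  have f: "holo_germ f" "f 0 = 0" "\<not> (\<forall>\<^sub>F p in nhds 0. f p = 0)"
    and irr: "\<forall>g h. holo_germ g \<longrightarrow> holo_germ h \<longrightarrow> (\<forall>\<^sub>F p in nhds 0. f p = g p * h p) \<longrightarrow> g 0 \<noteq> 0 \<or> h 0 \<noteq> 0"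
    using br by (simp_all add: branch_def)
  show "holo_germ (\<lambda>p. f (\<Theta> p))" by (rule holo_map_compose[OF f(1) \<Theta>])
  show "f (\<Theta> 0) = 0" using \<Theta> f(2) by (simp add: holo_map_def)
  show "\<not> (\<forall>\<^sub>F p in nhds 0. f (\<Theta> p) = 0)"
  proof
    assume "\<forall>\<^sub>F p in nhds 0. f (\<Theta> p) = 0"
    from holo_map_eventually[OF this \<Phi>] inv(2) have "\<forall>\<^sub>F p in nhds 0. f p = 0" by eventually_elim simp
    with f(3) show False by simp
  qed
  fix g h assume gh: "holo_germ g" "holo_germ h" "\<forall>\<^sub>F p in nhds 0. f (\<Theta> p) = g p * h p"
  from holo_map_eventually[OF gh(3) \<Phi>] inv(2) have "\<forall>\<^sub>F p in nhds 0. f p = g (\<Phi> p) * h (\<Phi> p)"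
    by eventually_elim simp
  then have "g (\<Phi> 0) \<noteq> 0 \<or> h (\<Phi> 0) \<noteq> 0"
    using irr[rule_format, OF holo_map_compose[OF gh(1) \<Phi>] holo_map_compose[OF gh(2) \<Phi>]] by simp
  then show "g 0 \<noteq> 0 \<or> h 0 \<noteq> 0" using \<Phi> by (simp add: holo_map_def)
qed

lemma eventually_deriv_eq:
  fixes f g :: "complex \<Rightarrow> complex"
  assumes "\<forall>\<^sub>F t in nhds z. f t = g t"
  shows "\<forall>\<^sub>F t in nhds z. deriv f t = deriv g t"
proof -
  have "\<forall>\<^sub>F t in nhds z. \<forall>\<^sub>F u in nhds t. f u = g u" using assms by (simp add: eventually_eventually)
  then show ?thesis by eventually_elim (rule deriv_cong_ev, auto)
qed

lemma eventually_deriv_compose: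
  fixes f \<tau> :: "complex \<Rightarrow> complex"
  assumes "f analytic_on {0}" "\<tau> analytic_on {0}" "\<tau> 0 = 0"
  shows "\<forall>\<^sub>F t in nhds 0. deriv (\<lambda>t. f (\<tau> t)) t = deriv f (\<tau> t) * deriv \<tau> t"
  using eventually_compose0[OF assms(1)[unfolded analytic_at_eventually] assms(2,3)]
    assms(2)[unfolded analytic_at_eventually]
  by eventually_elim (rule DERIV_imp_deriv, rule DERIV_chain2)

section \<open>Forms and gradients along a branch\<close>

text \<open>The coefficient of dt in the pullback of P dx + Q dy. It serves both the dual form, with
  \<open>P = - B\<close> and \<open>Q = A\<close>, and df, where it is the derivative of
  \<open>f\<close> along the curve.\<close>

definition pairing ::
  "(complex \<Rightarrow> complex) \<Rightarrow> (complex \<Rightarrow> complex) \<Rightarrow> (complex \<times> complex \<Rightarrow> complex) \<Rightarrow>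
   (complex \<times> complex \<Rightarrow> complex) \<Rightarrow> complex \<Rightarrow> complex" where
  "pairing x y P Q t = P (x t, y t) * deriv x t + Q (x t, y t) * deriv y t"

lemma analytic_pairing:
  assumes "holo_germ P" "holo_germ Q" "x analytic_on {0}" "y analytic_on {0}" "x 0 = 0" "y 0 = 0"
  shows "pairing x y P Q analytic_on {0}"
  unfolding pairing_def[abs_def]
  by (intro analytic_on_add analytic_on_mult holo_germ_curve[OF assms(1) assms(3-6)] holo_germ_curve[OF assms(2-6)]
      analytic_deriv assms)

text \<open>Reparametrizing a pulled back form produces the factor \<open>deriv \<tau>\<close>,
  which is a unit.\<close>

lemma germ_ord_pairing_reparam:
  assumes PQ: "holo_germ P" "holo_germ Q"
    and c: "cx analytic_on {0}" "cy analytic_on {0}" "cx 0 = 0" "cy 0 = 0"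
    and \<tau>: "\<tau> analytic_on {0}" "\<tau> 0 = 0" "deriv \<tau> 0 \<noteq> 0"
    and x: "\<forall>\<^sub>F t in nhds 0. x t = cx (\<tau> t)" and y: "\<forall>\<^sub>F t in nhds 0. y t = cy (\<tau> t)"
  shows "germ_ord (pairing x y P Q) = germ_ord (pairing cx cy P Q)"
proof (rule germ_ord_reparam[OF analytic_pairing[OF PQ c] \<tau> analytic_deriv[OF \<tau>(1)] \<tau>(3)])
  show "\<forall>\<^sub>F t in nhds 0. pairing x y P Q t = deriv \<tau> t * pairing cx cy P Q (\<tau> t)"
    using x y eventually_deriv_eq[OF x] eventually_deriv_eq[OF y]
      eventually_deriv_compose[OF c(1) \<tau>(1,2)] eventually_deriv_compose[OF c(2) \<tau>(1,2)]
    by eventually_elim (simp add: pairing_def algebra_simps)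
qed

text \<open>Otherwise both coordinates would be constant, and constant maps factor through
  \<open>\<tau> = 0\<close>.\<close>

lemma irreducible_param_deriv_nonzero:
  assumes "irreducible_param h x y"
  shows "\<not> (\<forall>\<^sub>F t in nhds 0. deriv x t = 0 \<and> deriv y t = 0)"
proof
  note xy = irreducible_paramD(1-4)[OF assms]
  assume 0: "\<forall>\<^sub>F t in nhds 0. deriv x t = 0 \<and> deriv y t = 0"
  have const: "\<forall>\<^sub>F t in nhds 0. u t = 0"
    if u: "u analytic_on {0}" "u 0 = 0" "\<forall>\<^sub>F t in nhds 0. deriv u t = 0" for u :: "complex \<Rightarrow> complex"
  proof -
    have "\<forall>\<^sub>F t in nhds 0. (u has_field_derivative 0) (at t)"
      using u(1)[unfolded analytic_at_eventually] u(3) by eventually_elim simp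
    then obtain r where r: "r > 0" "\<And>t. dist t 0 < r \<Longrightarrow> (u has_field_derivative 0) (at t)"
      unfolding eventually_nhds_metric by auto
    have "u t = u 0" if t: "dist t 0 < r" for t
    proof -
      have "norm (u t - u 0) \<le> 0 * norm (t - 0)"
      proof (rule field_differentiable_bound[where S = "ball 0 r" and f' = "\<lambda>_. 0"])
        show "(u has_field_derivative 0) (at z within ball 0 r)" if "z \<in> ball 0 r" for z
          by (rule has_field_derivative_at_within[OF r(2)]) (use that in \<open>simp add: dist_commute\<close>)
      qed (use t r in \<open>auto simp: dist_commute\<close>)
      then show ?thesis by simp
    qed
    then show ?thesis unfolding eventually_nhds_metric using r(1) u(2) by auto
  qed
  have "\<forall>\<^sub>F t in nhds 0. x t = (\<lambda>_. 0) (0 :: complex) \<and> y t = (\<lambda>_. 0) (0 :: complex)"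
    using const[OF xy(1,3)] const[OF xy(2,4)] 0 by (simp add: eventually_conj_iff)
  then have "deriv (\<lambda>_ :: complex. 0 :: complex) 0 \<noteq> 0"
    by (intro irreducible_paramD(6)[OF assms, of "\<lambda>_. 0" "\<lambda>_. 0"]) auto
  then show False by simp
qed

lemma analytic_mult_zero:
  fixes g h :: "complex \<Rightarrow> complex"
  assumes "g analytic_on {0}" "h analytic_on {0}" "\<forall>\<^sub>F t in nhds 0. g t * h t = 0"
    "\<not> (\<forall>\<^sub>F t in nhds 0. g t = 0)"
  shows "\<forall>\<^sub>F t in nhds 0. h t = 0"
proof (rule analytic_zero_at[OF assms(2)])
  have "\<forall>\<^sub>F t in at 0. g t * h t = 0" using assms(3) by (auto simp: eventually_at_filter elim: eventually_mono)
  with analytic_eventually_nonzero[OF assms(1,4)] show "\<forall>\<^sub>F t in at 0. h t = 0" by eventually_elim simp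
qed

lemma tangent_relation:
  assumes "holo_germ f" "x analytic_on {0}" "y analytic_on {0}" "x 0 = 0" "y 0 = 0"
    "\<forall>\<^sub>F t in nhds 0. f (x t, y t) = 0"
  shows "\<forall>\<^sub>F t in nhds 0. pairing x y (pd1 f) (pd2 f) t = 0"
  using holo_germ_curve_deriv[OF assms(1-5)] eventually_deriv_eq[OF assms(6)]
  by eventually_elim (auto simp: pairing_def dest: DERIV_imp_deriv)

text \<open>\<open>\<Theta>\<close> leads from coordinates in which the branch has the form (t^n,
  s(t)) to the original ones; \<open>cx\<close> and \<open>cy\<close> give this reference
  parametrization in the original coordinates.\<close>

locale parametrized_branch =
  fixes f :: "complex \<times> complex \<Rightarrow> complex" and \<Theta> \<Phi> :: "complex \<times> complex \<Rightarrow> complex \<times> complex"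
    and n :: nat and s :: "complex \<Rightarrow> complex"
  assumes branch: "branch f"
    and \<Theta>: "holo_map \<Theta>" and \<Phi>: "holo_map \<Phi>"
    and \<Phi>\<Theta>: "\<forall>\<^sub>F p in nhds 0. \<Phi> (\<Theta> p) = p" and \<Theta>\<Phi>: "\<forall>\<^sub>F p in nhds 0. \<Theta> (\<Phi> p) = p"
    and irr: "irreducible_param (\<lambda>p. f (\<Theta> p)) (\<lambda>t. t ^ n) s"
begin

lemma holo_f: "holo_germ f"
  using branch by (simp add: branch_def)

lemma branch_pullback: "branch (\<lambda>p. f (\<Theta> p))"
  by (rule branch_pull[OF branch \<Theta> \<Phi> \<Phi>\<Theta> \<Theta>\<Phi>])

definition cx :: "complex \<Rightarrow> complex" where "cx t = fst (\<Theta> (t ^ n, s t))"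
definition cy :: "complex \<Rightarrow> complex" where "cy t = snd (\<Theta> (t ^ n, s t))"

lemma irreducible_c: "irreducible_param f cx cy"
  unfolding cx_def[abs_def] cy_def[abs_def]
  by (rule irreducible_param_push[OF \<Theta> \<Phi> \<Phi>\<Theta> irr irreducible_paramD(5)[OF irr]])

lemmas c_props = irreducible_paramD(1-5)[OF irreducible_c]

lemma reparam:
  assumes "irreducible_param f x y"
  obtains \<tau> where "\<tau> analytic_on {0}" "\<tau> 0 = 0" "deriv \<tau> 0 \<noteq> 0"
    "\<forall>\<^sub>F t in nhds 0. x t = cx (\<tau> t)" "\<forall>\<^sub>F t in nhds 0. y t = cy (\<tau> t)"
proof -
  note xy = irreducible_paramD(1-4)[OF assms]
  have "\<forall>\<^sub>F t in nhds 0. f (\<Theta> (\<Phi> (x t, y t))) = 0"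
    using irreducible_paramD(5)[OF assms] eventually_curve[OF \<Theta>\<Phi> xy] by eventually_elim simp
  from irreducible_param_push[where f = "\<lambda>p. f (\<Theta> p)", OF \<Phi> \<Theta> \<Theta>\<Phi> assms this]
  obtain \<tau> where \<tau>: "\<tau> analytic_on {0}" "\<tau> 0 = 0" "deriv \<tau> 0 \<noteq> 0"
    "\<forall>\<^sub>F t in nhds 0. fst (\<Phi> (x t, y t)) = \<tau> t ^ n \<and> snd (\<Phi> (x t, y t)) = s (\<tau> t)"
    by (rule irreducible_param_reparam[OF branch_pullback irr])
  have "\<forall>\<^sub>F t in nhds 0. x t = cx (\<tau> t) \<and> y t = cy (\<tau> t)"
    using \<tau>(4) eventually_curve[OF \<Theta>\<Phi> xy]
  proof eventually_elim
    case (elim t)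
    then have "\<Phi> (x t, y t) = (\<tau> t ^ n, s (\<tau> t))" by (simp add: prod_eq_iff)
    then have "\<Theta> (\<tau> t ^ n, s (\<tau> t)) = (x t, y t)" using elim(2) by simp
    then show ?case by (simp add: cx_def cy_def)
  qed
  then show ?thesis using that[OF \<tau>(1-3)] by (simp add: eventually_conj_iff)
qed

lemma germ_ord_pairing:
  assumes "irreducible_param f x y" "holo_germ P" "holo_germ Q"
  shows "germ_ord (pairing x y P Q) = germ_ord (pairing cx cy P Q)"
proof -
  obtain \<tau> where \<tau>: "\<tau> analytic_on {0}" "\<tau> 0 = 0" "deriv \<tau> 0 \<noteq> 0"
    "\<forall>\<^sub>F t in nhds 0. x t = cx (\<tau> t)" "\<forall>\<^sub>F t in nhds 0. y t = cy (\<tau> t)"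
    by (rule reparam[OF assms(1)])
  show ?thesis by (rule germ_ord_pairing_reparam[OF assms(2,3) c_props(1-4) \<tau>])
qed

text \<open>A gradient vanishing along the curve would, by the chain rule, annihilate the
  y-derivative of the pulled back equation there, which \<open>branch_pd2_nonzero\<close>
  excludes.\<close>

lemma gradient_nonzero_c:
  "\<not> (\<forall>\<^sub>F t in nhds 0. pd1 f (cx t, cy t) = 0 \<and> pd2 f (cx t, cy t) = 0)"
proof
  assume 0: "\<forall>\<^sub>F t in nhds 0. pd1 f (cx t, cy t) = 0 \<and> pd2 f (cx t, cy t) = 0"
  note g = irreducible_paramD(1-4)[OF irr]
  have h: "holo_germ (\<lambda>p. fst (\<Theta> p))" "holo_germ (\<lambda>p. snd (\<Theta> p))" using \<Theta> by (simp_all add: holo_map_def)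
  have "\<forall>\<^sub>F t in nhds 0. pd2 (\<lambda>p. f (\<Theta> p)) (t ^ n, s t) = 0"
    using 0 eventually_curve[OF holo_map_eventually[OF holo_germ_derivative[OF holo_f] \<Theta>] g]
      eventually_curve[OF holo_germ_derivative[OF h(1)] g] eventually_curve[OF holo_germ_derivative[OF h(2)] g]
  proof eventually_elim
    case (elim t)
    have "((\<lambda>p. f (fst (\<Theta> p), snd (\<Theta> p))) has_derivative (\<lambda>v. 0 * fst v + 0 * snd v)) (at (t ^ n, s t))"
      using holo2_at_compose[where G = "\<lambda>p. fst (\<Theta> p)" and H = "\<lambda>p. snd (\<Theta> p)" and p = "(t ^ n, s t)", OF _ elim(3,4), of f 0 0]
        elim(1,2) by (simp add: cx_def cy_def)
    from holo2_imp_section(2)[OF this] show ?case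
      by (simp add: pd2_def DERIV_imp_deriv)
  qed
  with branch_pd2_nonzero[OF branch_pullback irr] show False by simp
qed

lemma gradient_nonzero:
  assumes "irreducible_param f x y"
  shows "\<not> (\<forall>\<^sub>F t in nhds 0. pd1 f (x t, y t) = 0) \<or> \<not> (\<forall>\<^sub>F t in nhds 0. pd2 f (x t, y t) = 0)"
proof (rule ccontr)
  assume "\<not> ?thesis"
  then have 0: "\<forall>\<^sub>F t in nhds 0. pd1 f (x t, y t) = 0" "\<forall>\<^sub>F t in nhds 0. pd2 f (x t, y t) = 0" by auto
  obtain \<tau> where \<tau>: "\<tau> analytic_on {0}" "\<tau> 0 = 0" "deriv \<tau> 0 \<noteq> 0"
    "\<forall>\<^sub>F t in nhds 0. x t = cx (\<tau> t)" "\<forall>\<^sub>F t in nhds 0. y t = cy (\<tau> t)"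
    by (rule reparam[OF assms])
  have \<tau>0: "\<not> (\<forall>\<^sub>F t in nhds 0. \<tau> t = 0)"
  proof
    assume "\<forall>\<^sub>F t in nhds 0. \<tau> t = 0"
    from eventually_nhds_x_imp_x[OF eventually_deriv_eq[OF this]] \<tau>(3) show False by simp
  qed
  have "\<forall>\<^sub>F t in nhds 0. F (cx t, cy t) = 0"
    if F: "holo_germ F" "\<forall>\<^sub>F t in nhds 0. F (x t, y t) = 0" for F
  proof (rule analytic_compose_zero[OF holo_germ_curve[OF F(1) c_props(1-4)] \<tau>(1,2) \<tau>0])
    show "\<forall>\<^sub>F t in nhds 0. F (cx (\<tau> t), cy (\<tau> t)) = 0"
      using F(2) \<tau>(4,5) by eventually_elim simp
  qed
  from this[OF holo_germ_pd1[OF holo_f] 0(1)] this[OF holo_germ_pd2[OF holo_f] 0(2)] gradient_nonzero_c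
  show False by (simp add: eventually_conj_iff)
qed

text \<open>If the dual form kills the tangent vector, the field is parallel to the curve; hence
  X(f) vanishes along the branch and is a multiple of its equation.\<close>

lemma invariant_if_infinite_contact:
  assumes A: "holo_germ A" and B: "holo_germ B"
    and 0: "\<forall>\<^sub>F t in nhds 0. pairing cx cy (\<lambda>p. - B p) A t = 0"
  shows "invariant_curve A B f"
proof -
  define X where "X = apply_vf A B f"
  have X: "X p = A p * pd1 f p + B p * pd2 f p" for p
    by (simp add: X_def apply_vf_def pd1_def pd2_def)
  have hX: "holo_germ X"
    unfolding X[abs_def] by (intro holo_germ_add holo_germ_mult holo_germ_pd1 holo_germ_pd2 A B holo_f)
  have aX: "(\<lambda>t. X (cx t, cy t)) analytic_on {0}" by (rule holo_germ_curve[OF hX c_props(1-4)])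
  note tan = tangent_relation[OF holo_f c_props]
  \<comment> \<open>X(f) times either component of the tangent vector is a combination of the two
    vanishing pairings. One component is a nonzero germ and can be cancelled.\<close>
  have "\<forall>\<^sub>F t in nhds 0. deriv cx t * X (cx t, cy t) = 0"
    using 0 tan
  proof eventually_elim
    case (elim t)
    have "deriv cx t * X (cx t, cy t) = A (cx t, cy t) * pairing cx cy (pd1 f) (pd2 f) t
       - pd2 f (cx t, cy t) * pairing cx cy (\<lambda>p. - B p) A t"
      by (simp add: X pairing_def algebra_simps)
    then show ?case using elim by simp
  qed
  moreover have "\<forall>\<^sub>F t in nhds 0. deriv cy t * X (cx t, cy t) = 0"
    using 0 tan
  proof eventually_elim
    case (elim t)
    have "deriv cy t * X (cx t, cy t) = B (cx t, cy t) * pairing cx cy (pd1 f) (pd2 f) t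
       + pd1 f (cx t, cy t) * pairing cx cy (\<lambda>p. - B p) A t"
      by (simp add: X pairing_def algebra_simps)
    then show ?case using elim by simp
  qed
  ultimately have "\<forall>\<^sub>F t in nhds 0. X (cx t, cy t) = 0"
    using irreducible_param_deriv_nonzero[OF irreducible_c]
      analytic_mult_zero[OF analytic_deriv[OF c_props(1)] aX] analytic_mult_zero[OF analytic_deriv[OF c_props(2)] aX]
    by (auto simp: eventually_conj_iff)
  then have "\<forall>\<^sub>F t in nhds 0. X (\<Theta> (t ^ n, s t)) = 0" by (simp add: cx_def cy_def)
  from branch_divides[OF branch_pullback irr holo_map_compose[OF hX \<Theta>] this]
  obtain r where r: "holo_germ r" "\<forall>\<^sub>F p in nhds 0. X (\<Theta> p) = r p * f (\<Theta> p)" by (elim exE conjE)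
  from holo_map_eventually[OF r(2) \<Phi>] \<Theta>\<Phi> have "\<forall>\<^sub>F p in nhds 0. X p = r (\<Phi> p) * f p"
    by eventually_elim simp
  then show ?thesis
    unfolding invariant_curve_def X_def using holo_map_compose[OF r(1) \<Phi>] by (intro exI conjI)
qed

end

section \<open>The local flow\<close>

lemma eventually_box:
  assumes "\<forall>\<^sub>F p in nhds (0 :: complex \<times> complex). P p"
  obtains r where "r > 0" "\<And>x y. norm x < r \<Longrightarrow> norm y < r \<Longrightarrow> P (x, y)"
proof -
  have "\<forall>\<^sub>F p in nhds (0 :: complex) \<times>\<^sub>F nhds (0 :: complex). P p"
    using assms by (simp add: zero_prod_def nhds_prod)
  then obtain Pf Pg where P: "eventually Pf (nhds 0)" "eventually Pg (nhds 0)" "\<And>x y. Pf x \<Longrightarrow> Pg y \<Longrightarrow> P (x, y)"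
    unfolding eventually_prod_filter by auto
  obtain d e where d: "d > 0" "\<And>x. dist x 0 < d \<Longrightarrow> Pf x" and e: "e > 0" "\<And>x. dist x 0 < e \<Longrightarrow> Pg x"
    using P(1,2) unfolding eventually_nhds_metric by auto
  show ?thesis by (rule that[of "min d e"]) (use d e P(3) in auto)
qed

lemma eventually_box3:
  assumes "\<forall>\<^sub>F z in nhds ((0 :: complex), (0 :: complex \<times> complex)). P z"
  obtains r where "r > 0" "\<And>s x y. norm s < r \<Longrightarrow> norm x < r \<Longrightarrow> norm y < r \<Longrightarrow> P (s, x, y)"
proof -
  obtain Pf Pg where P: "eventually Pf (nhds 0)" "eventually Pg (nhds 0)" "\<And>x y. Pf x \<Longrightarrow> Pg y \<Longrightarrow> P (x, y)"
    using assms unfolding nhds_prod eventually_prod_filter by auto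
  obtain d where d: "d > 0" "\<And>x. dist x 0 < d \<Longrightarrow> Pf x"
    using P(1) unfolding eventually_nhds_metric by auto
  obtain e where e: "e > 0" "\<And>x y. norm x < e \<Longrightarrow> norm y < e \<Longrightarrow> Pg (x, y)"
    using eventually_box[OF P(2)] by auto
  show ?thesis by (rule that[of "min d e"]) (use d e P(3) in auto)
qed

definition lipschitz_box :: "real \<Rightarrow> real \<Rightarrow> (complex \<times> complex \<Rightarrow> complex) \<Rightarrow> bool" where
  "lipschitz_box r L F \<longleftrightarrow> (\<forall>x y x' y'. norm x < r \<longrightarrow> norm y < r \<longrightarrow> norm x' < r \<longrightarrow> norm y' < r \<longrightarrow>
     norm (F (x, y) - F (x', y')) \<le> L * (norm (x - x') + norm (y - y')))"

lemma holo_germ_lipschitz: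
  assumes F: "holo_germ F"
  obtains r L where "r > 0" "L > 0" "lipschitz_box r L F"
proof -
  define L where "L = norm (pd1 F 0) + norm (pd2 F 0) + 1"
  have L: "L > 0" unfolding L_def by (intro add_nonneg_pos add_nonneg_nonneg) auto
  have "\<forall>\<^sub>F p in nhds 0. norm (pd1 F p) < L" "\<forall>\<^sub>F p in nhds 0. norm (pd2 F p) < L"
    by (rule order_tendstoD(2)[OF tendsto_norm[OF holo_germ_tendsto]];
        simp add: holo_germ_pd1 holo_germ_pd2 F L_def add_pos_nonneg add_nonneg_pos)+
  with holo_germ_derivative[OF F]
  have "\<forall>\<^sub>F p in nhds 0. (F has_derivative (\<lambda>v. pd1 F p * fst v + pd2 F p * snd v)) (at p) \<and>
     norm (pd1 F p) < L \<and> norm (pd2 F p) < L"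
    by eventually_elim simp
  then obtain r where r: "r > 0" "\<And>x y. norm x < r \<Longrightarrow> norm y < r \<Longrightarrow>
     (F has_derivative (\<lambda>v. pd1 F (x, y) * fst v + pd2 F (x, y) * snd v)) (at (x, y)) \<and>
     norm (pd1 F (x, y)) < L \<and> norm (pd2 F (x, y)) < L"
    by (rule eventually_box) simp
  have "lipschitz_box r L F"
    unfolding lipschitz_box_def
  proof (intro allI impI)
    fix x y x' y' :: complex
    assume *: "norm x < r" "norm y < r" "norm x' < r" "norm y' < r"
    have "norm (F (x, y) - F (x', y)) \<le> L * norm (x - x')"
    proof (rule field_differentiable_bound[where S = "ball 0 r" and f' = "\<lambda>x. pd1 F (x, y)"])
      show "((\<lambda>x. F (x, y)) has_field_derivative pd1 F (z, y)) (at z within ball 0 r)" if "z \<in> ball 0 r" for z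
        by (rule has_field_derivative_at_within[OF holo2_imp_section(1)]) (use r(2)[of z y] * that in auto)
      show "norm (pd1 F (z, y)) \<le> L" if "z \<in> ball 0 r" for z
        using r(2)[of z y] * that by auto
    qed (use * in auto)
    moreover have "norm (F (x', y) - F (x', y')) \<le> L * norm (y - y')"
    proof (rule field_differentiable_bound[where S = "ball 0 r" and f' = "\<lambda>y. pd2 F (x', y)"])
      show "((\<lambda>y. F (x', y)) has_field_derivative pd2 F (x', z)) (at z within ball 0 r)" if "z \<in> ball 0 r" for z
        by (rule has_field_derivative_at_within[OF holo2_imp_section(2)]) (use r(2)[of x' z] * that in auto)
      show "norm (pd2 F (x', z)) \<le> L" if "z \<in> ball 0 r" for z
        using r(2)[of x' z] * that by auto
    qed (use * in auto)
    moreover have "norm (F (x, y) - F (x', y')) \<le> norm (F (x, y) - F (x', y)) + norm (F (x', y) - F (x', y'))"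
      using norm_triangle_ineq[of "F (x, y) - F (x', y)" "F (x', y) - F (x', y')"] by simp
    ultimately show "norm (F (x, y) - F (x', y')) \<le> L * (norm (x - x') + norm (y - y'))"
      by (simp add: distrib_left)
  qed
  with r(1) L show ?thesis by (rule that)
qed

lemma lipschitz_box_mono:
  "lipschitz_box r L F \<Longrightarrow> r' \<le> r \<Longrightarrow> L \<le> L' \<Longrightarrow> lipschitz_box r' L' F"
  unfolding lipschitz_box_def
  by (meson add_nonneg_nonneg less_le_trans mult_right_mono norm_ge_zero order_trans)

text \<open>A contraction estimate in complex time: where the sum \<open>D\<close> of the two
  component distances is largest on the disc, the mean value inequality gives
  \<open>D m \<le> 2 * \<rho> * L * D m\<close>, with the 2 from the two components. As
  \<open>2 * \<rho> * L < 1\<close>, \<open>D\<close> vanishes.\<close>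

lemma ode_unique:
  fixes z1 z2 w1 w2 :: "complex \<Rightarrow> complex"
  assumes lip: "lipschitz_box r L A" "lipschitz_box r L B" and L: "L > 0" and \<rho>: "\<rho> > 0" "2 * \<rho> * L < 1"
    and box: "\<And>s. norm s \<le> \<rho> \<Longrightarrow> norm (z1 s) < r \<and> norm (z2 s) < r \<and> norm (w1 s) < r \<and> norm (w2 s) < r"
    and z: "\<And>s. norm s \<le> \<rho> \<Longrightarrow> (z1 has_field_derivative A (z1 s, z2 s)) (at s)"
      "\<And>s. norm s \<le> \<rho> \<Longrightarrow> (z2 has_field_derivative B (z1 s, z2 s)) (at s)"
    and w: "\<And>s. norm s \<le> \<rho> \<Longrightarrow> (w1 has_field_derivative A (w1 s, w2 s)) (at s)"
      "\<And>s. norm s \<le> \<rho> \<Longrightarrow> (w2 has_field_derivative B (w1 s, w2 s)) (at s)"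
    and init: "z1 0 = w1 0" "z2 0 = w2 0"
    and s: "norm s \<le> \<rho>"
  shows "z1 s = w1 s" "z2 s = w2 s"
proof -
  define D where "D = (\<lambda>s. norm (z1 s - w1 s) + norm (z2 s - w2 s))"
  have "continuous_on (cball 0 \<rho>) D"
    unfolding D_def
    by (intro continuous_intros continuous_at_imp_continuous_on ballI)
      (use DERIV_isCont[OF z(1)] DERIV_isCont[OF z(2)] DERIV_isCont[OF w(1)] DERIV_isCont[OF w(2)] in auto)
  moreover have "cball (0 :: complex) \<rho> \<noteq> {}" using \<rho> by auto
  ultimately obtain m where m: "m \<in> cball 0 \<rho>" "\<forall>s\<in>cball 0 \<rho>. D s \<le> D m"
    using continuous_attains_sup[OF compact_cball, of 0 \<rho> D] by auto
  have M0: "0 \<le> D m" by (simp add: D_def)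
  have est: "norm (u s - v s) \<le> L * D m * \<rho>"
    if uv: "\<And>s. norm s \<le> \<rho> \<Longrightarrow> (u has_field_derivative F (z1 s, z2 s)) (at s)"
      "\<And>s. norm s \<le> \<rho> \<Longrightarrow> (v has_field_derivative F (w1 s, w2 s)) (at s)"
      "lipschitz_box r L F" "u 0 = v 0" "norm s \<le> \<rho>" for u v F s
  proof -
    have "norm ((u s - v s) - (u 0 - v 0)) \<le> L * D m * norm (s - 0)"
    proof (rule field_differentiable_bound[where S = "cball 0 \<rho>" and f' = "\<lambda>s. F (z1 s, z2 s) - F (w1 s, w2 s)"])
      show "((\<lambda>s. u s - v s) has_field_derivative F (z1 t, z2 t) - F (w1 t, w2 t)) (at t within cball 0 \<rho>)"
        if "t \<in> cball 0 \<rho>" for t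
        by (rule has_field_derivative_at_within[OF DERIV_diff[OF uv(1,2)]]) (use that in auto)
      show "norm (F (z1 t, z2 t) - F (w1 t, w2 t)) \<le> L * D m" if t: "t \<in> cball 0 \<rho>" for t
      proof -
        have "norm (F (z1 t, z2 t) - F (w1 t, w2 t)) \<le> L * D t"
          using uv(3) box[of t] t unfolding lipschitz_box_def D_def by simp
        also have "\<dots> \<le> L * D m" using m(2) t L by simp
        finally show ?thesis .
      qed
    qed (use \<rho> that(5) in auto)
    also have "\<dots> \<le> L * D m * \<rho>" using that(5) L M0 by (intro mult_left_mono) auto
    finally show ?thesis using uv(4) by simp
  qed
  have "norm m \<le> \<rho>" using m by simp
  from est[OF z(1) w(1) lip(1) init(1) this] est[OF z(2) w(2) lip(2) init(2) this]
  have "D m \<le> 2 * \<rho> * L * D m" by (simp add: D_def algebra_simps)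
  then have "D m * (1 - 2 * \<rho> * L) \<le> 0" by (simp add: algebra_simps)
  then have "D m \<le> 0" using \<rho>(2) by (simp add: mult_le_0_iff)
  then have "D s \<le> 0" using m(2) s by force
  then show "z1 s = w1 s" "z2 s = w2 s"
    unfolding D_def by (smt (verit) norm_ge_zero norm_eq_zero eq_iff_diff_eq_0)+
qed

lemma holo3_sections:
  fixes F :: "complex \<times> complex \<times> complex \<Rightarrow> complex"
  assumes F: "(F has_derivative (\<lambda>v. a * fst v + b * fst (snd v) + c * snd (snd v))) (at (s, p))"
  shows "((\<lambda>s. F (s, p)) has_field_derivative a) (at s)"
    "((\<lambda>p. F (s, p)) has_derivative (\<lambda>v. b * fst v + c * snd v)) (at p)"
proof -
  have "((\<lambda>s. (s, p)) has_derivative (\<lambda>h. (h, 0))) (at s)" by (auto intro!: derivative_eq_intros)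
  from has_derivative_compose[OF this F]
  show "((\<lambda>s. F (s, p)) has_field_derivative a) (at s)"
    unfolding has_field_derivative_def by simp
  have "((\<lambda>p. (s, p)) has_derivative (\<lambda>h. (0, h))) (at p)" by (auto intro!: derivative_eq_intros)
  from has_derivative_compose[OF this F]
  show "((\<lambda>p. F (s, p)) has_derivative (\<lambda>v. b * fst v + c * snd v)) (at p)" by simp
qed

lemma holo3_compose:
  fixes F :: "complex \<times> complex \<times> complex \<Rightarrow> complex"
  assumes "(F has_derivative (\<lambda>v. a * fst v + b * fst (snd v) + c * snd (snd v))) (at (g p, G p, H p))"
    "(g has_derivative (\<lambda>v. g1 * fst v + g2 * snd v)) (at p)"
    "(G has_derivative (\<lambda>v. G1 * fst v + G2 * snd v)) (at p)"
    "(H has_derivative (\<lambda>v. H1 * fst v + H2 * snd v)) (at p)"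
  shows "((\<lambda>p. F (g p, G p, H p)) has_derivative
     (\<lambda>v. (a * g1 + b * G1 + c * H1) * fst v + (a * g2 + b * G2 + c * H2) * snd v)) (at p)"
proof -
  have "((\<lambda>p. (g p, G p, H p)) has_derivative
      (\<lambda>v. (g1 * fst v + g2 * snd v, G1 * fst v + G2 * snd v, H1 * fst v + H2 * snd v))) (at p)"
    by (intro has_derivative_Pair assms)
  from has_derivative_compose[OF this assms(1)] show ?thesis
    by (rule has_derivative_eq_rhs) (simp add: fun_eq_iff algebra_simps)
qed

text \<open>A joint derivative is recorded because time and starting point will vary at once; the
  flow equation identifies its time coefficient.\<close>

definition flow_derivative ::
  "(complex \<times> complex \<Rightarrow> complex) \<Rightarrow> (complex \<times> complex \<Rightarrow> complex) \<Rightarrow>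
   (complex \<Rightarrow> complex \<times> complex \<Rightarrow> complex \<times> complex) \<Rightarrow> complex \<Rightarrow> complex \<times> complex \<Rightarrow> bool" where
  "flow_derivative A B \<psi> s p \<longleftrightarrow>
     ((\<lambda>z. fst (\<psi> (fst z) (snd z))) has_derivative (\<lambda>v. A (\<psi> s p) * fst v +
        pd1 (\<lambda>p. fst (\<psi> s p)) p * fst (snd v) + pd2 (\<lambda>p. fst (\<psi> s p)) p * snd (snd v))) (at (s, p)) \<and>
     ((\<lambda>z. snd (\<psi> (fst z) (snd z))) has_derivative (\<lambda>v. B (\<psi> s p) * fst v +
        pd1 (\<lambda>p. snd (\<psi> s p)) p * fst (snd v) + pd2 (\<lambda>p. snd (\<psi> s p)) p * snd (snd v))) (at (s, p))"

lemma holo3_derivative: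
  fixes F :: "complex \<times> complex \<times> complex \<Rightarrow> complex"
  assumes "holo3_at F (s, p)" "((\<lambda>s. F (s, p)) has_field_derivative D) (at s)"
  shows "(F has_derivative (\<lambda>v. D * fst v + pd1 (\<lambda>p. F (s, p)) p * fst (snd v) + pd2 (\<lambda>p. F (s, p)) p * snd (snd v))) (at (s, p))"
proof -
  obtain a b c where F: "(F has_derivative (\<lambda>v. a * fst v + b * fst (snd v) + c * snd (snd v))) (at (s, p))"
    using assms(1) unfolding holo3_at_def by (elim exE)
  note sec = holo3_sections[OF F]
  obtain x y where p: "p = (x, y)" by force
  have "a = D" using sec(1) assms(2) by (rule DERIV_unique)
  moreover have "pd1 (\<lambda>p. F (s, p)) p = b" "pd2 (\<lambda>p. F (s, p)) p = c"
    using holo2_imp_section[OF sec(2)[unfolded p]] by (simp_all add: pd1_def pd2_def p DERIV_imp_deriv)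
  ultimately show ?thesis using F by simp
qed

text \<open>\<open>one_parameter_group\<close> consists of differentiability, the flow equation and
  the initial condition. That the origin stays fixed and that \<open>\<psi> (- s)\<close> inverts
  \<open>\<psi> s\<close> is extracted here from uniqueness of solutions, for small times.\<close>

lemma flow_local:
  assumes A: "holo_germ A" "A 0 = 0" and B: "holo_germ B" "B 0 = 0" and opg: "one_parameter_group A B \<psi>"
  obtains \<delta> where "\<delta> > 0"
    "\<forall>s. norm s < \<delta> \<longrightarrow> holo_map (\<psi> s)"
    "\<forall>s. norm s < \<delta> \<longrightarrow> (\<forall>\<^sub>F p in nhds 0. \<psi> (- s) (\<psi> s p) = p)"
    "\<forall>s. norm s < \<delta> \<longrightarrow> (\<forall>\<^sub>F z in nhds (s, 0). flow_derivative A B \<psi> (fst z) (snd z))"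
proof -
  obtain rA LA where lA: "rA > 0" "LA > 0" "lipschitz_box rA LA A" by (rule holo_germ_lipschitz[OF A(1)])
  obtain rB LB where lB: "rB > 0" "LB > 0" "lipschitz_box rB LB B" by (rule holo_germ_lipschitz[OF B(1)])
  define r where "r = min rA rB"
  define L where "L = max LA LB"
  have rL: "r > 0" "L > 0" using lA lB by (auto simp: r_def L_def)
  have lip: "lipschitz_box r L A" "lipschitz_box r L B"
    using lipschitz_box_mono[OF lA(3), of r L] lipschitz_box_mono[OF lB(3), of r L] by (auto simp: r_def L_def)
  have id: "\<forall>\<^sub>F p in nhds 0. \<psi> 0 p = p" using opg by (simp add: one_parameter_group_def)
  have ev: "\<forall>\<^sub>F z in nhds (0, 0). holo3_at (\<lambda>(\<sigma>, q). fst (\<psi> \<sigma> q)) z \<and> holo3_at (\<lambda>(\<sigma>, q). snd (\<psi> \<sigma> q)) z \<and>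
        ((\<lambda>\<sigma>. fst (\<psi> \<sigma> (snd z))) has_field_derivative A (\<psi> (fst z) (snd z))) (at (fst z)) \<and>
        ((\<lambda>\<sigma>. snd (\<psi> \<sigma> (snd z))) has_field_derivative B (\<psi> (fst z) (snd z))) (at (fst z))"
    using opg unfolding one_parameter_group_def by (simp add: case_prod_beta')
  have ev': "\<forall>\<^sub>F z in nhds (0, 0). flow_derivative A B \<psi> (fst z) (snd z)"
    using ev
  proof eventually_elim
    case (elim z)
    obtain s p where z: "z = (s, p)" by (metis prod.collapse)
    show ?case
      using holo3_derivative[of "\<lambda>z. fst (\<psi> (fst z) (snd z))" s p "A (\<psi> s p)"]
        holo3_derivative[of "\<lambda>z. snd (\<psi> (fst z) (snd z))" s p "B (\<psi> s p)"] elim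
      by (simp add: z flow_derivative_def case_prod_beta')
  qed
  have \<psi>00: "\<psi> 0 0 = 0" using eventually_nhds_x_imp_x[OF id] .
  have "flow_derivative A B \<psi> 0 0" using eventually_nhds_x_imp_x[OF ev'] by simp
  then have "isCont (\<lambda>z. fst (\<psi> (fst z) (snd z))) (0, 0)" "isCont (\<lambda>z. snd (\<psi> (fst z) (snd z))) (0, 0)"
    unfolding flow_derivative_def by (auto dest: has_derivative_continuous)
  then have "\<forall>\<^sub>F z in nhds (0, 0). norm (fst (\<psi> (fst z) (snd z))) < r"
     "\<forall>\<^sub>F z in nhds (0, 0). norm (snd (\<psi> (fst z) (snd z))) < r"
    using \<psi>00 rL(1) by (auto intro!: order_tendstoD(2)[OF tendsto_norm] simp: tendsto_nhds_iff isCont_def)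
  moreover have "\<forall>\<^sub>F z in nhds ((0 :: complex), 0). \<psi> 0 (snd z) = snd z"
    by (rule eventually_subst[OF id]) (auto intro!: continuous_intros)
  ultimately have "\<forall>\<^sub>F z in nhds (0, 0). flow_derivative A B \<psi> (fst z) (snd z) \<and> norm (fst (\<psi> (fst z) (snd z))) < r \<and>
     norm (snd (\<psi> (fst z) (snd z))) < r \<and> \<psi> 0 (snd z) = snd z"
    using ev' by eventually_elim simp
  then obtain d where d: "d > 0" "\<And>s x y. norm s < d \<Longrightarrow> norm x < d \<Longrightarrow> norm y < d \<Longrightarrow>
      flow_derivative A B \<psi> s (x, y) \<and> norm (fst (\<psi> s (x, y))) < r \<and> norm (snd (\<psi> s (x, y))) < r \<and> \<psi> 0 (x, y) = (x, y)"
    by (rule eventually_box3) (simp; fail)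
  have ode: "((\<lambda>\<sigma>. fst (\<psi> \<sigma> (x, y))) has_field_derivative A (\<psi> s (x, y))) (at s)"
     "((\<lambda>\<sigma>. snd (\<psi> \<sigma> (x, y))) has_field_derivative B (\<psi> s (x, y))) (at s)"
    if "norm s < d" "norm x < d" "norm y < d" for s x y
    using holo3_sections(1)[of "\<lambda>z. fst (\<psi> (fst z) (snd z))" _ _ _ s "(x, y)"]
      holo3_sections(1)[of "\<lambda>z. snd (\<psi> (fst z) (snd z))" _ _ _ s "(x, y)"] d(2)[OF that]
    unfolding flow_derivative_def by auto
  \<comment> \<open>\<open>d / 3\<close> keeps the sum of two admissible times inside the box, and
    \<open>1 / (4 * L)\<close> makes the contraction factor in \<open>ode_unique\<close> at most
    1/2.\<close>
  define \<rho> where "\<rho> = min (d / 3) (1 / (4 * L))"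
  have \<rho>: "\<rho> > 0" "\<rho> \<le> d / 3" "2 * \<rho> * L < 1"
  proof -
    show "\<rho> > 0" "\<rho> \<le> d / 3" using d(1) rL by (auto simp: \<rho>_def)
    have "\<rho> * L \<le> 1 / (4 * L) * L" using rL by (intro mult_right_mono) (auto simp: \<rho>_def)
    then show "2 * \<rho> * L < 1" using rL by simp
  qed
  \<comment> \<open>The constant 0 is a solution because \<open>A\<close> and \<open>B\<close>
    vanish at the origin.\<close>
  have zero: "\<psi> s 0 = 0" if s: "norm s \<le> \<rho>" for s
  proof -
    have "fst (\<psi> s (0, 0)) = 0" "snd (\<psi> s (0, 0)) = 0"
      by (rule ode_unique[OF lip rL(2) \<rho>(1,3), of "\<lambda>s. fst (\<psi> s (0, 0))" "\<lambda>s. snd (\<psi> s (0, 0))" "\<lambda>_. 0" "\<lambda>_. 0"];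
          use s \<rho> d ode rL A(2) B(2) \<psi>00 in \<open>simp add: zero_prod_def\<close>)+
    then show ?thesis by (simp add: zero_prod_def prod_eq_iff)
  qed
  have map: "holo_map (\<psi> s)" if s: "norm s \<le> \<rho>" for s
  proof -
    have "\<forall>\<^sub>F p in nhds 0. p \<in> ball 0 d \<times> (ball 0 d :: complex set)"
      using d(1) by (intro eventually_nhds_in_open open_Times) (auto simp: zero_prod_def)
    then have "\<forall>\<^sub>F p in nhds 0. holo2_at (\<lambda>p. fst (\<psi> s p)) p \<and> holo2_at (\<lambda>p. snd (\<psi> s p)) p"
    proof eventually_elim
      case (elim p)
      obtain x y where p: "p = (x, y)" by force
      have fd: "flow_derivative A B \<psi> s p" using d(2)[of s x y] elim s \<rho> d(1) by (simp add: p)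
      show ?case
        using holo3_sections(2)[OF fd[unfolded flow_derivative_def, THEN conjunct1]]
          holo3_sections(2)[OF fd[unfolded flow_derivative_def, THEN conjunct2]]
        by (auto intro: holo2_atI)
    qed
    then show ?thesis unfolding holo_map_def holo_germ_def using zero[OF s] by (simp add: eventually_conj_iff)
  qed
  have inverse: "\<forall>\<^sub>F p in nhds 0. \<psi> (- s) (\<psi> s p) = p" if s: "norm s \<le> \<rho>" for s
  proof -
    have box: "\<forall>\<^sub>F p in nhds 0. p \<in> ball 0 d \<times> (ball 0 d :: complex set)"
      using d(1) by (intro eventually_nhds_in_open open_Times) (auto simp: zero_prod_def)
    show ?thesis
      using box holo_map_eventually[OF box map[OF s]]
    proof eventually_elim
      case (elim p)
      obtain x y where p: "p = (x, y)" by force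
      obtain u v where uv: "\<psi> s (x, y) = (u, v)" by force
      have xy: "norm x < d" "norm y < d" and uv': "norm u < d" "norm v < d" using elim by (simp_all add: p uv)
      have small: "norm (t + s) < d" "norm t < d" if "norm t \<le> \<rho>" for t
      proof -
        have "norm (t + s) \<le> norm t + norm s" by (rule norm_triangle_ineq)
        then show "norm (t + s) < d" "norm t < d" using that s \<rho>(2) d(1) by simp_all
      qed
      have sh: "((\<lambda>t. f (t + s)) has_field_derivative D) (at t)"
        if "(f has_field_derivative D) (at (t + s))" for f :: "complex \<Rightarrow> complex" and D t
        using that by (simp add: DERIV_shift)
      \<comment> \<open>Two solutions in \<open>t\<close> that agree at \<open>t = 0\<close>: the
        flow of \<open>(u, v)\<close> and the time-shifted flow of \<open>(x, y)\<close>. They are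
        compared at \<open>t = - s\<close>.\<close>
      have "fst (\<psi> (- s) (u, v)) = fst (\<psi> (- s + s) (x, y))" "snd (\<psi> (- s) (u, v)) = snd (\<psi> (- s + s) (x, y))"
        by (rule ode_unique[OF lip rL(2) \<rho>(1,3), of "\<lambda>t. fst (\<psi> t (u, v))" "\<lambda>t. snd (\<psi> t (u, v))"
              "\<lambda>t. fst (\<psi> (t + s) (x, y))" "\<lambda>t. snd (\<psi> (t + s) (x, y))"];
            use s d(2)[OF small(1) xy] d(2)[OF small(2) uv'] d(2)[of 0 u v] d(1) uv' uv
              sh[OF ode(1)[OF small(1) xy]] sh[OF ode(2)[OF small(1) xy]] ode[OF small(2) uv'] in simp)+
      then show ?case using d(2)[of 0 x y] d(1) xy by (simp add: p uv prod_eq_iff)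
    qed
  qed
  have deriv: "\<forall>\<^sub>F z in nhds (s, 0). flow_derivative A B \<psi> (fst z) (snd z)" if s: "norm s \<le> \<rho>" for s
  proof -
    have "\<forall>\<^sub>F z in nhds (s, 0). z \<in> ball 0 d \<times> (ball 0 d :: complex set) \<times> (ball 0 d :: complex set)"
      using d(1) s \<rho>(2) by (intro eventually_nhds_in_open open_Times) (auto simp: zero_prod_def)
    then show ?thesis by eventually_elim (use d(2) in auto)
  qed
  show ?thesis by (rule that[OF \<rho>(1)]) (use map inverse deriv in auto)
qed

section \<open>Velocity of the Puiseux coefficients\<close>

lemma pd_eqI:
  assumes "(F has_derivative (\<lambda>v. a * fst v + b * snd v)) (at p)"
  shows "pd1 F p = a" "pd2 F p = b"
  using holo2_imp_section[of F a b "fst p" "snd p"] assms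
  by (simp_all add: pd1_def pd2_def DERIV_imp_deriv)

text \<open>The constant \<open>C\<close> and the range of \<open>t\<close> may depend on
  \<open>\<sigma>\<close>. Still, each bound forces \<open>K (\<sigma>, 0) = 0\<close>, and one
  factor \<open>t\<close> at a time splits off holomorphically in both variables: non-uniform
  estimates become a uniform factorization.\<close>

lemma iterated_hadamard_division:
  assumes "holo_germ K" "\<forall>\<^sub>F \<sigma> in nhds 0. \<exists>C. \<forall>\<^sub>F t in at 0. norm (K (\<sigma>, t)) \<le> C * norm t ^ N"
  shows "\<exists>G. holo_germ G \<and> (\<forall>\<^sub>F p in nhds 0. K p = snd p ^ N * G p)"
  using assms
proof (induction N arbitrary: K)
  case 0
  then show ?case by (intro exI[of _ K]) simp
next
  case (Suc N)
  have cs: "isCont (\<lambda>\<sigma>. (\<sigma>, 0 :: complex)) (0 :: complex)" by (intro isCont_Pair continuous_intros)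
  have ct: "isCont (\<lambda>t. (\<sigma>, t)) (0 :: complex)" for \<sigma> :: complex by (intro isCont_Pair continuous_intros)
  have "\<forall>\<^sub>F \<sigma> in nhds 0. holo2_at K (\<sigma>, 0)"
    by (rule eventually_subst[OF Suc.prems(1)[unfolded holo_germ_def] cs]) (simp add: zero_prod_def)
  with Suc.prems(2) have "\<forall>\<^sub>F \<sigma> in nhds 0. K (\<sigma>, 0) = 0"
  proof eventually_elim
    case (elim \<sigma>)
    then obtain C where C: "\<forall>\<^sub>F t in at 0. norm (K (\<sigma>, t)) \<le> C * norm t ^ Suc N" by auto
    have "isCont K (\<sigma>, 0)" using elim(2) by (auto elim!: holo2_atE dest: has_derivative_continuous)
    then have "isCont (\<lambda>t. K (\<sigma>, t)) 0" by (rule isCont_o2[OF ct])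
    then have 1: "((\<lambda>t. norm (K (\<sigma>, t))) \<longlongrightarrow> norm (K (\<sigma>, 0))) (at 0)" by (simp add: isCont_def tendsto_norm)
    have "isCont (\<lambda>t :: complex. C * norm t ^ Suc N) 0" by (intro continuous_intros)
    then have 2: "((\<lambda>t :: complex. C * norm t ^ Suc N) \<longlongrightarrow> 0) (at 0)" by (simp add: isCont_def)
    have "norm (K (\<sigma>, 0)) \<le> 0" by (rule tendsto_le[OF _ 2 1 C]) simp
    then show ?case by simp
  qed
  then obtain K1 where K1: "holo_germ K1" "\<forall>\<^sub>F p in nhds 0. K p = snd p * K1 p"
    using hadamard_division[OF Suc.prems(1)] by auto
  have "\<forall>\<^sub>F p in nhds 0. \<forall>\<^sub>F q in nhds p. K q = snd q * K1 q" using K1(2) by (simp add: eventually_eventually)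
  from eventually_subst[OF this cs] have "\<forall>\<^sub>F \<sigma> in nhds 0. \<forall>\<^sub>F q in nhds (\<sigma>, 0). K q = snd q * K1 q"
    by (simp add: zero_prod_def)
  with Suc.prems(2) have "\<forall>\<^sub>F \<sigma> in nhds 0. \<exists>C. \<forall>\<^sub>F t in at 0. norm (K1 (\<sigma>, t)) \<le> C * norm t ^ N"
  proof eventually_elim
    case (elim \<sigma>)
    then obtain C where C: "\<forall>\<^sub>F t in at 0. norm (K (\<sigma>, t)) \<le> C * norm t ^ Suc N" by auto
    have "\<forall>\<^sub>F t in nhds 0. K (\<sigma>, t) = t * K1 (\<sigma>, t)"
      using eventually_subst[OF elim(2) ct] by simp
    then have "\<forall>\<^sub>F t in at 0. t \<noteq> 0 \<and> K (\<sigma>, t) = t * K1 (\<sigma>, t)"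
      unfolding eventually_at_filter by eventually_elim simp
    with C have "\<forall>\<^sub>F t in at 0. norm (K1 (\<sigma>, t)) \<le> C * norm t ^ N"
    proof eventually_elim
      case (elim t)
      then have "norm t * norm (K1 (\<sigma>, t)) \<le> norm t * (C * norm t ^ N)" by (simp add: norm_mult mult_ac)
      then show ?case using elim by simp
    qed
    then show ?case by auto
  qed
  from Suc.IH[OF K1(1) this] obtain G where G: "holo_germ G" "\<forall>\<^sub>F p in nhds 0. K1 p = snd p ^ N * G p" by auto
  from K1(2) G(2) have "\<forall>\<^sub>F p in nhds 0. K p = snd p ^ Suc N * G p" by eventually_elim simp
  with G(1) show ?case by (intro exI conjI)
qed

text \<open>The power of the second variable is constant for differentiation in the first, so
  vanishing to order \<open>N\<close> in \<open>t\<close> passes to the \<sigma>-derivative.\<close>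

lemma eventually_pd1_power_factor:
  assumes "holo_germ G" "\<forall>\<^sub>F p in nhds 0. K p = snd p ^ N * G p"
  shows "\<forall>\<^sub>F p in nhds 0. pd1 K p = snd p ^ N * pd1 G p"
proof -
  have "\<forall>\<^sub>F p in nhds 0. \<forall>\<^sub>F q in nhds p. K q = snd q ^ N * G q" using assms(2) by (simp add: eventually_eventually)
  with holo_germ_derivative[OF assms(1)] show ?thesis
  proof eventually_elim
    case (elim p)
    obtain x y where p: "p = (x, y)" by (metis prod.collapse)
    have c: "isCont (\<lambda>x. (x, y)) x" by (intro isCont_Pair continuous_intros)
    have ev: "\<forall>\<^sub>F w in nhds x. K (w, y) = y ^ N * G (w, y)"
      using eventually_subst[OF elim(2) c] p by simp
    have "((\<lambda>w. G (w, y)) has_field_derivative pd1 G p) (at x)"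
      using elim(1) unfolding p by (rule holo2_imp_section(1))
    then have "((\<lambda>w. y ^ N * G (w, y)) has_field_derivative y ^ N * pd1 G p) (at x)" by (rule DERIV_cmult)
    then have "((\<lambda>w. K (w, y)) has_field_derivative y ^ N * pd1 G p) (at x)"
      using DERIV_cong_ev[OF refl ev refl] by simp
    then show ?case by (simp add: p pd1_def DERIV_imp_deriv)
  qed
qed

lemma eval_fps_truncate:
  fixes F :: "complex fps"
  assumes "fps_conv_radius F > 0"
  obtains g where "g analytic_on {0}" "\<forall>\<^sub>F t in nhds 0. eval_fps F t = (\<Sum>i<N. fps_nth F i * t ^ i) + t ^ N * g t"
proof
  have r: "fps_conv_radius (fps_shift N F) > 0" using assms by simp
  then show "eval_fps (fps_shift N F) analytic_on {0}"
    by (intro analytic_on_eval_fps) (auto simp: zero_ereal_def)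
  have "\<forall>\<^sub>F t in nhds (0 :: complex). t \<in> eball 0 (fps_conv_radius F)"
    using assms by (intro eventually_nhds_in_open) (auto simp: zero_ereal_def)
  then show "\<forall>\<^sub>F t in nhds 0. eval_fps F t = (\<Sum>i<N. fps_nth F i * t ^ i) + t ^ N * eval_fps (fps_shift N F) t"
  proof eventually_elim
    case (elim t)
    then have sm: "summable (\<lambda>i. fps_nth F i * t ^ i)" by (intro summable_fps) (simp add: zero_ereal_def)
    have "summable (\<lambda>i. fps_nth (fps_shift N F) i * t ^ i)"
      using elim by (intro summable_fps) (simp add: zero_ereal_def)
    then have tail: "(\<Sum>i. t ^ N * (fps_nth (fps_shift N F) i * t ^ i)) = t ^ N * eval_fps (fps_shift N F) t"
      unfolding eval_fps_def by (rule suminf_mult)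
    have "eval_fps F t = (\<Sum>i. fps_nth F (i + N) * t ^ (i + N)) + (\<Sum>i<N. fps_nth F i * t ^ i)"
      unfolding eval_fps_def by (rule suminf_split_initial_segment[OF sm])
    also have "(\<Sum>i. fps_nth F (i + N) * t ^ (i + N)) = (\<Sum>i. t ^ N * (fps_nth (fps_shift N F) i * t ^ i))"
      by (intro suminf_cong) (simp add: power_add mult_ac)
    finally show ?case unfolding tail by (simp only: add.commute)
  qed
qed

text \<open>Differentiating the inverse relation at the origin makes the two derivative matrices
  inverse to each other, and determinants multiply.\<close>

lemma jacobian_nonzero:
  assumes V: "holo_map V" and U: "holo_map U" and inv: "\<forall>\<^sub>F p in nhds 0. U (V p) = p"
  shows "pd1 (\<lambda>p. fst (V p)) 0 * pd2 (\<lambda>p. snd (V p)) 0 - pd1 (\<lambda>p. snd (V p)) 0 * pd2 (\<lambda>p. fst (V p)) 0 \<noteq> 0"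
proof
  define V11 V12 V21 V22 where V_defs: "V11 = pd1 (\<lambda>p. fst (V p)) 0" "V12 = pd2 (\<lambda>p. fst (V p)) 0"
    "V21 = pd1 (\<lambda>p. snd (V p)) 0" "V22 = pd2 (\<lambda>p. snd (V p)) 0"
  have dV: "((\<lambda>p. fst (V p)) has_derivative (\<lambda>v. V11 * fst v + V12 * snd v)) (at 0)"
    "((\<lambda>p. snd (V p)) has_derivative (\<lambda>v. V21 * fst v + V22 * snd v)) (at 0)"
    using V unfolding holo_map_def V_defs by (auto dest!: holo_germ_derivative eventually_nhds_x_imp_x)
  have V0: "(fst (V 0), snd (V 0)) = 0" using V by (simp add: holo_map_def prod_eq_iff)
  have chain: "pd1 F 0 * V11 + pd2 F 0 * V21 = a \<and> pd1 F 0 * V12 + pd2 F 0 * V22 = b"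
    if F: "holo_germ F" "\<forall>\<^sub>F p in nhds 0. F (V p) = a * fst p + b * snd p" for F a b
  proof -
    have "(F has_derivative (\<lambda>v. pd1 F 0 * fst v + pd2 F 0 * snd v)) (at (fst (V 0), snd (V 0)))"
      unfolding V0 by (rule eventually_nhds_x_imp_x[OF holo_germ_derivative[OF F(1)]])
    from holo2_at_compose[where G = "\<lambda>p. fst (V p)" and H = "\<lambda>p. snd (V p)", OF this dV]
    have 1: "((\<lambda>p. F (V p)) has_derivative (\<lambda>v. (pd1 F 0 * V11 + pd2 F 0 * V21) * fst v +
        (pd1 F 0 * V12 + pd2 F 0 * V22) * snd v)) (at 0)" by simp
    have "((\<lambda>p. a * fst p + b * snd p) has_derivative (\<lambda>v. a * fst v + b * snd v)) (at 0)"
      by (auto intro!: derivative_eq_intros)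
    moreover have "\<forall>\<^sub>F p in at 0. a * fst p + b * snd p = F (V p)"
      using F(2) by (auto simp: eventually_at_filter elim: eventually_mono)
    moreover have "a * fst 0 + b * snd 0 = F (V 0)" using eventually_nhds_x_imp_x[OF F(2)] by simp
    ultimately have 2: "((\<lambda>p. F (V p)) has_derivative (\<lambda>v. a * fst v + b * snd v)) (at 0)"
      by (rule has_derivative_transform_eventually) auto
    show ?thesis using pd_eqI[OF 1] pd_eqI[OF 2] by simp
  qed
  have "\<forall>\<^sub>F p in nhds 0. fst (U (V p)) = 1 * fst p + 0 * snd p" "\<forall>\<^sub>F p in nhds 0. snd (U (V p)) = 0 * fst p + 1 * snd p"
    using inv by (auto elim: eventually_mono)
  then obtain u11 u12 u21 u22 where
    "u11 * V11 + u12 * V21 = 1" "u11 * V12 + u12 * V22 = 0" "u21 * V11 + u22 * V21 = 0" "u21 * V12 + u22 * V22 = 1"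
    using chain[of "\<lambda>p. fst (U p)" 1 0] chain[of "\<lambda>p. snd (U p)" 0 1] U unfolding holo_map_def by auto
  moreover have "(u11 * u22 - u12 * u21) * (V11 * V22 - V21 * V12) =
     (u11 * V11 + u12 * V21) * (u21 * V12 + u22 * V22) - (u11 * V12 + u12 * V22) * (u21 * V11 + u22 * V21)"
    by (simp add: algebra_simps)
  moreover assume "pd1 (\<lambda>p. fst (V p)) 0 * pd2 (\<lambda>p. snd (V p)) 0 - pd1 (\<lambda>p. snd (V p)) 0 * pd2 (\<lambda>p. fst (V p)) 0 = 0"
  then have "V11 * V22 - V21 * V12 = 0" by (simp add: V_defs)
  ultimately show False by simp
qed

text \<open>Dividing by \<open>\<phi>\<close> costs \<open>e\<close> orders, after which the error
  still lies beyond order \<open>M\<close>; since \<open>J\<close> is a unit, \<open>T\<close> has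
  the order of \<open>Q\<close>.\<close>

lemma germ_ord_from_approximation:
  assumes \<phi>: "\<phi> analytic_on {0}" and Q: "Q analytic_on {0}" "germ_ord Q = enat M"
    and \<phi>e: "\<phi>1 analytic_on {0}" "\<phi>1 0 \<noteq> 0" "\<forall>\<^sub>F t in nhds 0. \<phi> t = t ^ e * \<phi>1 t"
    and J: "J analytic_on {0}" "J 0 \<noteq> 0" and R: "R analytic_on {0}" and T: "T analytic_on {0}"
    and eq: "\<forall>\<^sub>F t in nhds 0. \<phi> t * (J t * T t - Q t) = t ^ (e + M + Suc k) * R t"
  shows "germ_ord T = enat M"
proof -
  have "\<not> (\<forall>\<^sub>F t in nhds 0. Q t = 0)" using Q(2) by (auto simp: germ_ord_def)
  then obtain m Q1 where Q1: "Q1 analytic_on {0}" "Q1 0 \<noteq> 0" "\<forall>\<^sub>F t in nhds 0. Q t = t ^ m * Q1 t" "germ_ord Q = enat m"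
    by (rule analytic_factor[OF Q(1)])
  then have m: "m = M" using Q(2) by simp
  \<comment> \<open>The prospective unit part of \<open>T\<close>, found by solving for
    \<open>T\<close> and taking out \<open>t ^ M\<close>. At 0 the error drops out through
    \<open>t ^ Suc k\<close>, leaving \<open>Q1 0 / J 0\<close>.\<close>
  define u where "u = (\<lambda>t. (Q1 t + t ^ Suc k * R t * inverse (\<phi>1 t)) * inverse (J t))"
  have u: "u analytic_on {0}" unfolding u_def
    by (intro analytic_on_mult analytic_on_add analytic_on_inverse analytic_on_power analytic_on_ident Q1 R \<phi>e(1) J(1))
      (use \<phi>e J in auto)
  have nz: "\<forall>\<^sub>F t in nhds 0. h t \<noteq> 0" if "h analytic_on {0}" "h 0 \<noteq> 0" for h :: "complex \<Rightarrow> complex"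
    using that analytic_at_imp_isCont[OF that(1)]
    by (intro tendsto_imp_eventually_ne) (auto simp: tendsto_nhds_iff isContD)
  have "\<forall>\<^sub>F t in nhds 0. t \<noteq> 0 \<longrightarrow> T t - t ^ M * u t = 0"
    using eq \<phi>e(3) Q1(3) nz[OF \<phi>e(1,2)] nz[OF J]
  proof eventually_elim
    case (elim t)
    show ?case
    proof
      assume t: "t \<noteq> 0"
      have "t ^ e * (\<phi>1 t * (J t * T t - t ^ M * Q1 t)) = t ^ e * (t ^ M * t ^ Suc k * R t)"
        using elim(1-3) by (simp add: m power_add mult_ac)
      then have "\<phi>1 t * (J t * T t - t ^ M * Q1 t) = t ^ M * t ^ Suc k * R t"
        using t by simp
      then have "J t * T t - t ^ M * Q1 t = t ^ M * t ^ Suc k * R t * inverse (\<phi>1 t)"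
        using elim(4) by (simp add: field_simps)
      then have "J t * T t = t ^ M * (Q1 t + t ^ Suc k * R t * inverse (\<phi>1 t))"
        by (simp add: algebra_simps)
      then have "T t = t ^ M * (Q1 t + t ^ Suc k * R t * inverse (\<phi>1 t)) * inverse (J t)"
        using elim(5) by (metis mult.commute mult.left_commute mult.right_neutral right_inverse)
      then show "T t - t ^ M * u t = 0" by (simp add: u_def mult_ac)
    qed
  qed
  then have "\<forall>\<^sub>F t in at 0. T t - t ^ M * u t = 0" by (simp add: eventually_at_filter)
  then have "\<forall>\<^sub>F t in nhds 0. T t - t ^ M * u t = 0"
    by (rule analytic_zero_at[rotated])
      (intro analytic_on_diff analytic_on_mult analytic_on_power analytic_on_ident T u)
  then have "\<forall>\<^sub>F t in nhds 0. T t = t ^ M * u t" by simp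
  moreover have "u 0 \<noteq> 0" using Q1(2) J(2) by (simp add: u_def)
  ultimately show ?thesis using germ_ord_factor[OF u] by simp
qed

lemma germ_ord_polynomial:
  assumes "germ_ord (\<lambda>t. t ^ m * (\<Sum>i<N. a i * t ^ i)) = enat M"
  shows "m \<le> M" "\<And>i. i < N \<Longrightarrow> i + m < M \<Longrightarrow> a i = 0" "M - m < N" "a (M - m) \<noteq> 0"
proof -
  define F where "F = Abs_fps (\<lambda>i. if i < N then a i else 0)"
  have "(\<lambda>t. \<Sum>i<N. a i * t ^ i) has_fps_expansion (\<Sum>i<N. fps_const (a i) * fps_X ^ i)"
    by (intro fps_expansion_intros)
  also have "(\<Sum>i<N. fps_const (a i) * fps_X ^ i) = F"
    by (rule fps_ext) (auto simp: F_def fps_sum_nth if_distrib[where f = "\<lambda>z. _ * z"] sum.delta cong: if_cong)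
  finally have h: "(\<lambda>t. t ^ m * (\<Sum>i<N. a i * t ^ i)) has_fps_expansion fps_X ^ m * F"
    by (intro fps_expansion_intros)
  then have an: "(\<lambda>t. t ^ m * (\<Sum>i<N. a i * t ^ i)) analytic_on {0}" by (rule has_fps_expansion_imp_analytic_0)
  have e: "fps_expansion (\<lambda>t. t ^ m * (\<Sum>i<N. a i * t ^ i)) 0 = fps_X ^ m * F"
    by (rule fps_expansion_unique_complex[OF analytic_at_imp_has_fps_expansion_0[OF an] h])
  have F0: "F \<noteq> 0"
  proof
    assume "F = 0"
    then have "\<forall>\<^sub>F t in nhds 0. t ^ m * (\<Sum>i<N. a i * t ^ i) = 0"
      using h unfolding has_fps_expansion_def by (auto elim: eventually_mono)
    then show False using assms by (simp add: germ_ord_def)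
  qed
  have "germ_ord (\<lambda>t. t ^ m * (\<Sum>i<N. a i * t ^ i)) = enat (m + subdegree F)"
    using assms F0 unfolding germ_ord_def e by (auto split: if_splits)
  then have M: "M = m + subdegree F" using assms by simp
  have nz: "fps_nth F (subdegree F) \<noteq> 0" using F0 by simp
  show "m \<le> M" "M - m < N" "a (M - m) \<noteq> 0" using M nz by (auto simp: F_def split: if_splits)
  show "a i = 0" if "i < N" "i + m < M" for i
    using that M nth_less_subdegree_zero[of i F] by (simp add: F_def)
qed

lemma eventually_pd_compose:
  assumes "holo_germ F" "holo_germ G" "holo_germ H" "G 0 = 0" "H 0 = 0"
  shows "\<forall>\<^sub>F p in nhds 0. pd1 (\<lambda>p. F (G p, H p)) p = pd1 F (G p, H p) * pd1 G p + pd2 F (G p, H p) * pd1 H p \<and>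
     pd2 (\<lambda>p. F (G p, H p)) p = pd1 F (G p, H p) * pd2 G p + pd2 F (G p, H p) * pd2 H p"
proof -
  have "isCont (\<lambda>p. (G p, H p)) 0" by (intro isCont_Pair holo_germ_isCont assms)
  from eventually_subst[OF holo_germ_derivative[OF assms(1)] this]
  have "\<forall>\<^sub>F p in nhds 0. (F has_derivative (\<lambda>v. pd1 F (G p, H p) * fst v + pd2 F (G p, H p) * snd v)) (at (G p, H p))"
    using assms(4,5) by (simp add: prod_eq_iff)
  then show ?thesis
    using holo_germ_derivative[OF assms(2)] holo_germ_derivative[OF assms(3)]
  proof eventually_elim
    case (elim p)
    show ?case using pd_eqI[OF holo2_at_compose[where G = G and H = H, OF elim]] by simp
  qed
qed

section \<open>The deformed branch near one fixed time\<close>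

text \<open>\<open>\<epsilon>\<close> is a fixed, not necessarily zero, time and
  \<open>\<sigma>\<close> an increment, because velocities are needed at all small times. The
  coefficients are holomorphic one by one.\<close>

locale deformed_branch = parametrized_branch +
  fixes A B :: "complex \<times> complex \<Rightarrow> complex"
    and \<psi> :: "complex \<Rightarrow> complex \<times> complex \<Rightarrow> complex \<times> complex"
    and S :: "complex \<Rightarrow> complex fps" and \<epsilon> :: complex
  assumes A: "holo_germ A" and B: "holo_germ B"
    and flow_map: "\<forall>\<^sub>F \<sigma> in nhds 0. holo_map (\<psi> (\<epsilon> + \<sigma>))"
    and back_map: "holo_map (\<psi> (- \<epsilon>))"
    and flow_back: "\<forall>\<^sub>F p in nhds 0. \<psi> (- \<epsilon>) (\<psi> \<epsilon> p) = p"
    and flow_deriv: "\<forall>\<^sub>F z in nhds (\<epsilon>, 0). flow_derivative A B \<psi> (fst z) (snd z)"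
    and puiseux: "\<forall>\<^sub>F \<sigma> in nhds 0. puiseux_param (\<lambda>p. f (\<psi> (\<epsilon> + \<sigma>) (\<Theta> p))) n (S (\<epsilon> + \<sigma>))"
    and coeff: "\<And>i. (\<lambda>e. fps_nth (S e) i) analytic_on {\<epsilon>}"
begin

lemma n_pos: "n > 0"
  by (rule irreducible_param_pos[OF irr])

definition se :: "complex \<Rightarrow> complex" where "se = eval_fps (S \<epsilon>)"

lemma irr_e: "irreducible_param (\<lambda>p. f (\<psi> \<epsilon> (\<Theta> p))) (\<lambda>t. t ^ n) se"
  and radius_e: "fps_conv_radius (S \<epsilon>) > 0"
  using eventually_nhds_x_imp_x[OF puiseux] by (simp_all add: puiseux_param_def se_def)

lemmas \<gamma> = irreducible_paramD(1-4)[OF irr_e]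

lemma map_e: "holo_map (\<psi> \<epsilon>)"
  using eventually_nhds_x_imp_x[OF flow_map] by simp

text \<open>The deformed curve is the preimage of \<open>f = 0\<close> under the flow, so
  \<open>V\<close> carries its Puiseux parametrization onto the undeformed branch: for every
  \<open>\<epsilon>\<close> the pair \<open>(x, y)\<close> below parametrizes the same
  curve.\<close>

definition V :: "complex \<times> complex \<Rightarrow> complex \<times> complex" where "V p = \<psi> \<epsilon> (\<Theta> p)"
abbreviation V1 :: "complex \<times> complex \<Rightarrow> complex" where "V1 \<equiv> \<lambda>p. fst (V p)"
abbreviation V2 :: "complex \<times> complex \<Rightarrow> complex" where "V2 \<equiv> \<lambda>p. snd (V p)"

lemma holo_V: "holo_map V"
  unfolding V_def[abs_def] by (rule holo_map_comp[OF map_e \<Theta>])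

lemma holo_V12: "holo_germ V1" "holo_germ V2"
  using holo_V by (simp_all add: holo_map_def)

lemma V_inverse: "holo_map (\<lambda>p. \<Phi> (\<psi> (- \<epsilon>) p))" "\<forall>\<^sub>F p in nhds 0. \<Phi> (\<psi> (- \<epsilon>) (V p)) = p"
proof -
  show "holo_map (\<lambda>p. \<Phi> (\<psi> (- \<epsilon>) p))" by (rule holo_map_comp[OF \<Phi> back_map])
  from holo_map_eventually[OF flow_back \<Theta>] \<Phi>\<Theta> show "\<forall>\<^sub>F p in nhds 0. \<Phi> (\<psi> (- \<epsilon>) (V p)) = p"
    by eventually_elim (simp add: V_def)
qed

definition x :: "complex \<Rightarrow> complex" where "x t = V1 (t ^ n, se t)"
definition y :: "complex \<Rightarrow> complex" where "y t = V2 (t ^ n, se t)"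

lemma irr_xy: "irreducible_param f x y"
proof -
  have "\<forall>\<^sub>F t in nhds 0. f (V (t ^ n, se t)) = 0"
    using irreducible_paramD(5)[OF irr_e] by (simp add: V_def)
  from irreducible_param_push[OF holo_V V_inverse irr_e this] show ?thesis
    by (simp add: x_def[abs_def] y_def[abs_def])
qed

lemmas xy = irreducible_paramD(1-5)[OF irr_xy]

definition u :: "nat \<Rightarrow> complex \<Rightarrow> complex" where
  "u i \<sigma> = fps_nth (S (\<epsilon> + \<sigma>)) i - fps_nth (S \<epsilon>) i"

definition a' :: "nat \<Rightarrow> complex" where "a' i = deriv (\<lambda>e. fps_nth (S e) i) \<epsilon>"

lemma u: "u i analytic_on {0}" "u i 0 = 0" "(u i has_field_derivative a' i) (at 0)"
proof -
  have sh: "(\<lambda>\<sigma>. \<epsilon> + \<sigma>) analytic_on {0}" by (intro analytic_intros)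
  have "(\<lambda>\<sigma>. fps_nth (S (\<epsilon> + \<sigma>)) i) analytic_on {0}"
    using analytic_on_compose_gen[OF sh coeff[of i]] by (simp add: o_def)
  then show "u i analytic_on {0}" unfolding u_def[abs_def] by (intro analytic_on_diff analytic_on_const)
  show "u i 0 = 0" by (simp add: u_def)
  have "((\<lambda>e. fps_nth (S e) i) has_field_derivative a' i) (at (\<epsilon> + 0))"
    using analytic_has_deriv[OF coeff[of i]] by (simp add: a'_def)
  moreover have "((\<lambda>\<sigma>. \<epsilon> + \<sigma>) has_field_derivative 1) (at 0)" by (auto intro!: derivative_eq_intros)
  ultimately have "((\<lambda>\<sigma>. fps_nth (S (\<epsilon> + \<sigma>)) i) has_field_derivative a' i * 1) (at 0)" by (rule DERIV_chain2)
  from DERIV_diff[OF this DERIV_const[of "fps_nth (S \<epsilon>) i"]]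
  show "(u i has_field_derivative a' i) (at 0)" by (simp add: u_def[abs_def])
qed

definition Y :: "nat \<Rightarrow> complex \<times> complex \<Rightarrow> complex" where
  "Y N p = se (snd p) + (\<Sum>i<N. u i (fst p) * snd p ^ i)"

lemma Y: "holo_germ (Y N)" "Y N (0, t) = se t" "Y N 0 = 0" "pd1 (Y N) (0, t) = (\<Sum>i<N. a' i * t ^ i)"
proof -
  show "holo_germ (Y N)"
    unfolding Y_def[abs_def]
    by (intro holo_germ_add holo_germ_sum holo_germ_mult holo_germ_power holo_germ_snd
        holo_germ_compose1[OF \<gamma>(2) holo_germ_snd] holo_germ_compose1[OF u(1) holo_germ_fst]) simp_all
  show 0: "Y N (0, t) = se t" for t by (simp add: Y_def u)
  then show "Y N 0 = 0" using \<gamma>(4) by (simp add: zero_prod_def)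
  have "((\<lambda>\<sigma>. Y N (\<sigma>, t)) has_field_derivative (0 + (\<Sum>i<N. a' i * t ^ i))) (at 0)"
    unfolding Y_def fst_conv snd_conv
    by (intro DERIV_add DERIV_const DERIV_sum DERIV_cmult_right u(3))
  then show "pd1 (Y N) (0, t) = (\<Sum>i<N. a' i * t ^ i)" by (simp add: pd1_def DERIV_imp_deriv)
qed

text \<open>
  No uniform lower bound on the radii of convergence of the \<open>S \<epsilon>\<close> is known, so the series at time
  \<open>\<epsilon> + \<sigma>\<close> is replaced by the one at time \<open>\<epsilon>\<close> with only its first \<open>N\<close> coefficients updated. This is
  jointly holomorphic in \<open>(\<sigma>, t)\<close>, and \<open>f\<close> then vanishes to order \<open>N\<close> in \<open>t\<close> instead of identically.
\<close>

definition K :: "nat \<Rightarrow> complex \<times> complex \<Rightarrow> complex" where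
  "K N p = f (\<psi> (\<epsilon> + fst p) (\<Theta> (snd p ^ n, Y N p)))"

lemma holo_pown: "holo_germ (\<lambda>p. snd p ^ n)" "(snd (0 :: complex \<times> complex)) ^ n = 0"
  using n_pos by (simp_all add: holo_germ_power holo_germ_snd power_0_left)

lemma eventually_axis:
  "\<forall>\<^sub>F p in nhds (0 :: complex \<times> complex). P p \<Longrightarrow> \<forall>\<^sub>F t in nhds 0. P (0, t)"
  by (erule eventually_curve) (auto intro: analytic_on_ident)

text \<open>\<open>\<sigma>\<close> enters twice: through the flow time, which contributes
  \<open>(A, B)\<close>, and through \<open>Y N\<close>, which contributes the y-derivative of
  \<open>V\<close> times the velocity polynomial. At \<open>\<sigma> = 0\<close> the series is the
  true one, so the base point is \<open>(x t, y t)\<close>.\<close>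

lemma K_derivative:
  "holo_germ (K N)"
  "\<forall>\<^sub>F t in nhds 0. pd1 (K N) (0, t) =
     pd1 f (x t, y t) * (A (x t, y t) + pd2 V1 (t ^ n, se t) * (\<Sum>i<N. a' i * t ^ i)) +
     pd2 f (x t, y t) * (B (x t, y t) + pd2 V2 (t ^ n, se t) * (\<Sum>i<N. a' i * t ^ i))"
proof -
  define \<Theta>1 \<Theta>2 where \<Theta>12: "\<Theta>1 = (\<lambda>p. fst (\<Theta> p))" "\<Theta>2 = (\<lambda>p. snd (\<Theta> p))"
  have h\<Theta>: "holo_germ \<Theta>1" "holo_germ \<Theta>2" "\<Theta>1 0 = 0" "\<Theta>2 0 = 0" using \<Theta> by (simp_all add: \<Theta>12 holo_map_def)
  define p1 p2 where p12: "p1 = (\<lambda>p. fst (\<psi> \<epsilon> p))" "p2 = (\<lambda>p. snd (\<psi> \<epsilon> p))"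
  have hp: "holo_germ p1" "holo_germ p2" using map_e by (simp_all add: p12 holo_map_def)
  define P1 P2 where P12: "P1 = (\<lambda>p. \<Theta>1 (snd p ^ n, Y N p))" "P2 = (\<lambda>p. \<Theta>2 (snd p ^ n, Y N p))"
  have hP: "holo_germ P1" "holo_germ P2"
    unfolding P12 by (rule holo_germ_compose[OF _ holo_pown(1) Y(1) holo_pown(2) Y(3)]; rule h\<Theta>)+
  have z0: "(snd (0 :: complex \<times> complex) ^ n, Y N 0) = 0" using Y(3) holo_pown(2) by (simp add: prod_eq_iff)
  have P0: "P1 0 = 0" "P2 0 = 0" using h\<Theta>(3,4) unfolding P12 z0 by simp_all
  define G1 G2 where G12: "G1 = (\<lambda>p. fst (\<psi> (\<epsilon> + fst p) (P1 p, P2 p)))" "G2 = (\<lambda>p. snd (\<psi> (\<epsilon> + fst p) (P1 p, P2 p)))"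
  have K_eq: "K N = (\<lambda>p. f (G1 p, G2 p))"
    by (simp add: K_def fun_eq_iff G12 P12 \<Theta>12)
  have c: "isCont (\<lambda>p. (\<epsilon> + fst p, P1 p, P2 p)) 0"
    by (intro isCont_Pair continuous_intros holo_germ_isCont hP)
  have "\<forall>\<^sub>F p in nhds 0. flow_derivative A B \<psi> (\<epsilon> + fst p) (P1 p, P2 p)"
    using eventually_subst[OF flow_deriv c] P0 by (simp add: zero_prod_def)
  with holo_germ_derivative[OF hP(1)] holo_germ_derivative[OF hP(2)]
  have Gd: "\<forall>\<^sub>F p in nhds 0. (holo2_at G1 p \<and> holo2_at G2 p) \<and>
     pd1 G1 p = A (G1 p, G2 p) + pd1 (\<lambda>q. fst (\<psi> (\<epsilon> + fst p) q)) (P1 p, P2 p) * pd1 P1 p +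
        pd2 (\<lambda>q. fst (\<psi> (\<epsilon> + fst p) q)) (P1 p, P2 p) * pd1 P2 p \<and>
     pd1 G2 p = B (G1 p, G2 p) + pd1 (\<lambda>q. snd (\<psi> (\<epsilon> + fst p) q)) (P1 p, P2 p) * pd1 P1 p +
        pd2 (\<lambda>q. snd (\<psi> (\<epsilon> + fst p) q)) (P1 p, P2 p) * pd1 P2 p"
  proof eventually_elim
    case (elim p)
    have d: "((\<lambda>p :: complex \<times> complex. \<epsilon> + fst p) has_derivative (\<lambda>v. 1 * fst v + 0 * snd v)) (at p)"
      by (auto intro!: derivative_eq_intros)
    note 1 = holo3_compose[where g = "\<lambda>p. \<epsilon> + fst p" and G = P1 and H = P2,
        OF elim(3)[unfolded flow_derivative_def, THEN conjunct1] d elim(1,2)]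
    note 2 = holo3_compose[where g = "\<lambda>p. \<epsilon> + fst p" and G = P1 and H = P2,
        OF elim(3)[unfolded flow_derivative_def, THEN conjunct2] d elim(1,2)]
    show ?case
      using holo2_atI[OF 1] holo2_atI[OF 2] pd_eqI(1)[OF 1] pd_eqI(1)[OF 2]
      by (simp add: G12)
  qed
  have hG: "holo_germ G1" "holo_germ G2"
    using Gd unfolding holo_germ_def by (auto elim: eventually_mono)
  have "\<psi> \<epsilon> (0, 0) = 0" using map_e by (simp add: holo_map_def zero_prod_def)
  then have G0: "G1 0 = 0" "G2 0 = 0" by (simp_all add: G12 P0)
  show "holo_germ (K N)" unfolding K_eq by (rule holo_germ_compose[OF holo_f hG G0])
  have V_eq: "V1 = (\<lambda>p. p1 (\<Theta>1 p, \<Theta>2 p))" "V2 = (\<lambda>p. p2 (\<Theta>1 p, \<Theta>2 p))"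
    by (simp_all add: V_def p12 \<Theta>12)
  note K_pd = eventually_axis[OF eventually_pd_compose[OF holo_f hG G0]]
  note P1_pd = eventually_axis[OF eventually_pd_compose[OF h\<Theta>(1) holo_pown(1) Y(1)[of N] holo_pown(2) Y(3)]]
  note P2_pd = eventually_axis[OF eventually_pd_compose[OF h\<Theta>(2) holo_pown(1) Y(1)[of N] holo_pown(2) Y(3)]]
  note V1_pd = eventually_curve[OF eventually_pd_compose[OF hp(1) h\<Theta>] \<gamma>]
  note V2_pd = eventually_curve[OF eventually_pd_compose[OF hp(2) h\<Theta>] \<gamma>]
  show "\<forall>\<^sub>F t in nhds 0. pd1 (K N) (0, t) =
     pd1 f (x t, y t) * (A (x t, y t) + pd2 V1 (t ^ n, se t) * (\<Sum>i<N. a' i * t ^ i)) +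
     pd2 f (x t, y t) * (B (x t, y t) + pd2 V2 (t ^ n, se t) * (\<Sum>i<N. a' i * t ^ i))"
    using K_pd P1_pd P2_pd V1_pd V2_pd eventually_axis[OF Gd]
  proof eventually_elim
    case (elim t)
    define \<tau> where "\<tau> = (\<Sum>i<N. a' i * t ^ i)"
    have G: "G1 (0, t) = x t" "G2 (0, t) = y t" and P: "P1 (0, t) = \<Theta>1 (t ^ n, se t)" "P2 (0, t) = \<Theta>2 (t ^ n, se t)"
      by (simp_all add: G12 P12 x_def y_def V_def \<Theta>12 Y(2))
    \<comment> \<open>The first Puiseux coordinate t^n does not move with
      \<open>\<sigma>\<close>.\<close>
    have 0: "pd1 (\<lambda>p. snd p ^ n) (0, t) = 0" by (simp add: pd1_def)
    have dP: "pd1 P1 (0, t) = pd2 \<Theta>1 (t ^ n, se t) * \<tau>" "pd1 P2 (0, t) = pd2 \<Theta>2 (t ^ n, se t) * \<tau>"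
      using elim(2,3) unfolding 0 Y(2,4) \<tau>_def P12 by simp_all
    have dV: "pd2 V1 (t ^ n, se t) = pd1 p1 (\<Theta>1 (t ^ n, se t), \<Theta>2 (t ^ n, se t)) * pd2 \<Theta>1 (t ^ n, se t)
         + pd2 p1 (\<Theta>1 (t ^ n, se t), \<Theta>2 (t ^ n, se t)) * pd2 \<Theta>2 (t ^ n, se t)"
      "pd2 V2 (t ^ n, se t) = pd1 p2 (\<Theta>1 (t ^ n, se t), \<Theta>2 (t ^ n, se t)) * pd2 \<Theta>1 (t ^ n, se t)
         + pd2 p2 (\<Theta>1 (t ^ n, se t), \<Theta>2 (t ^ n, se t)) * pd2 \<Theta>2 (t ^ n, se t)"
      using elim(4,5) unfolding V_eq by blast+
    have dG: "pd1 G1 (0, t) = A (x t, y t) + pd2 V1 (t ^ n, se t) * \<tau>"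
      "pd1 G2 (0, t) = B (x t, y t) + pd2 V2 (t ^ n, se t) * \<tau>"
      using elim(6) unfolding dV by (simp_all add: G P dP p12 algebra_simps)
    show ?case using elim(1) unfolding K_eq[symmetric] G dG \<tau>_def by blast
  qed
qed

text \<open>\<open>Y N\<close> agrees with the true series at time
  \<open>\<epsilon> + \<sigma>\<close> in the first \<open>N\<close> coefficients, and a Lipschitz
  germ that vanishes on the true curve is of order \<open>N\<close> on the approximate one. The
  constants depend on \<open>\<sigma>\<close>.\<close>

lemma K_bound:
  assumes N: "N > 0"
  shows "\<forall>\<^sub>F \<sigma> in nhds 0. \<exists>C. \<forall>\<^sub>F t in at 0. norm (K N (\<sigma>, t)) \<le> C * norm t ^ N"
  using flow_map puiseux
proof eventually_elim
  case (elim \<sigma>)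
  define h where "h = (\<lambda>p. f (\<psi> (\<epsilon> + \<sigma>) (\<Theta> p)))"
  define e where "e = eval_fps (S (\<epsilon> + \<sigma>))"
  have irr\<sigma>: "irreducible_param h (\<lambda>t. t ^ n) e" and rad: "fps_conv_radius (S (\<epsilon> + \<sigma>)) > 0"
    using elim(2) by (simp_all add: puiseux_param_def e_def h_def)
  note e = irreducible_paramD(1-5)[OF irr\<sigma>]
  have hh: "holo_germ h" unfolding h_def by (rule holo_map_compose[OF holo_map_compose[OF holo_f elim(1)] \<Theta>])
  obtain r L where rL: "r > 0" "L > 0" "lipschitz_box r L h" by (rule holo_germ_lipschitz[OF hh])
  obtain g1 where g1: "g1 analytic_on {0}"
    "\<forall>\<^sub>F t in nhds 0. e t = (\<Sum>i<N. fps_nth (S (\<epsilon> + \<sigma>)) i * t ^ i) + t ^ N * g1 t"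
    unfolding e_def by (rule eval_fps_truncate[OF rad])
  obtain g2 where g2: "g2 analytic_on {0}"
    "\<forall>\<^sub>F t in nhds 0. se t = (\<Sum>i<N. fps_nth (S \<epsilon>) i * t ^ i) + t ^ N * g2 t"
    unfolding se_def by (rule eval_fps_truncate[OF radius_e])
  \<comment> \<open>\<open>Y N (\<sigma>, t)\<close> rewritten as the true series minus the
    difference of the tails from index \<open>N\<close> on.\<close>
  define w where "w = (\<lambda>t. e t - t ^ N * (g1 t - g2 t))"
  have w: "w analytic_on {0}" "w 0 = 0"
    unfolding w_def using e(4) N
    by (auto intro!: analytic_on_diff analytic_on_mult analytic_on_power analytic_on_ident e g1 g2)
  have Yw: "\<forall>\<^sub>F t in nhds 0. Y N (\<sigma>, t) = w t"
    using g1(2) g2(2)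
  proof eventually_elim
    case (elim t)
    then show ?case
      by (simp add: Y_def w_def u_def algebra_simps sum_subtractf)
  qed
  have small: "\<forall>\<^sub>F t in nhds 0. norm (v t) < c" if "v analytic_on {0}" "norm (v 0) < c" for v :: "complex \<Rightarrow> complex" and c
    using that analytic_at_imp_isCont[OF that(1)]
    by (intro order_tendstoD(2)[OF tendsto_norm]) (auto simp: tendsto_nhds_iff isContD)
  define C where "C = norm (g1 0 - g2 0) + 1"
  have gC: "\<forall>\<^sub>F t in nhds 0. norm (g1 t - g2 t) < C"
    by (rule small) (auto simp: C_def intro: analytic_on_diff g1 g2)
  have "\<forall>\<^sub>F t in nhds (0 :: complex). norm (t ^ n) < r"
    by (rule small[OF e(1)]) (use n_pos rL(1) in \<open>simp add: power_0_left\<close>)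
  moreover have "\<forall>\<^sub>F t in nhds 0. norm (e t) < r"
    by (rule small[OF e(2)]) (use e(4) rL(1) in simp)
  moreover have "\<forall>\<^sub>F t in nhds 0. norm (w t) < r"
    by (rule small[OF w(1)]) (use w(2) rL(1) in simp)
  ultimately have "\<forall>\<^sub>F t in nhds 0. norm (K N (\<sigma>, t)) \<le> (L * C) * norm t ^ N"
    using Yw gC e(5)
  proof eventually_elim
    case (elim t)
    note sm = elim(1-3)
    have "K N (\<sigma>, t) = h (t ^ n, w t)" using elim(4) by (simp add: K_def h_def)
    then have "norm (K N (\<sigma>, t)) = norm (h (t ^ n, w t) - h (t ^ n, e t))" using elim(6) by simp
    also have "\<dots> \<le> L * (norm (t ^ n - t ^ n) + norm (w t - e t))"
      using rL(3) sm unfolding lipschitz_box_def by blast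
    also have "norm (w t - e t) = norm t ^ N * norm (g1 t - g2 t)"
      by (simp add: w_def norm_mult norm_power)
    also have "L * (norm (t ^ n - t ^ n) + norm t ^ N * norm (g1 t - g2 t)) \<le> L * (norm t ^ N * C)"
      using elim(5) rL(2) by (simp add: mult_left_mono)
    finally show ?case by (simp add: mult_ac)
  qed
  then have "\<forall>\<^sub>F t in at 0. norm (K N (\<sigma>, t)) \<le> (L * C) * norm t ^ N"
    by (auto simp: eventually_at_filter elim: eventually_mono)
  then show ?case by (rule exI)
qed

text \<open>The Jacobian determinant of \<open>V\<close> along the curve, with the factor
  \<open>n\<close> from differentiating t^n. The accompanying power \<open>t ^ (n - 1)\<close> is
  kept apart so that \<open>J\<close> is a unit.\<close>

definition J :: "complex \<Rightarrow> complex" where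
  "J t = of_nat n * (pd1 V1 (t ^ n, se t) * pd2 V2 (t ^ n, se t) - pd1 V2 (t ^ n, se t) * pd2 V1 (t ^ n, se t))"

lemma J: "J analytic_on {0}" "J 0 \<noteq> 0"
proof -
  have pd: "(\<lambda>t. F (t ^ n, se t)) analytic_on {0}" if "holo_germ F" for F
    by (rule holo_germ_curve[OF that \<gamma>])
  show "J analytic_on {0}"
    unfolding J_def[abs_def]
    by (intro analytic_on_mult analytic_on_diff analytic_on_const pd holo_germ_pd1 holo_germ_pd2 holo_V12)
  have "((0 :: complex) ^ n, se 0) = 0" using \<gamma>(3,4) by (simp add: zero_prod_def)
  then show "J 0 \<noteq> 0"
    using jacobian_nonzero[OF holo_V V_inverse] n_pos unfolding J_def by simp
qed

text \<open>
  Differentiating \<open>K N = O(t\<^sup>N)\<close> in \<open>\<sigma>\<close> shows that the gradient of \<open>f\<close> is orthogonal, up to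
  \<open>O(t\<^sup>N)\<close>, to \<open>(A, B) + (\<partial>V/\<partial>y) (\<Sum> a' i t\<^sup>i)\<close>; it is also orthogonal to the tangent vector, and the
  bracket below is the determinant of the two vectors.
\<close>

lemma first_variation:
  assumes N: "N > 0" and \<phi>: "\<phi> = pd1 f \<or> \<phi> = pd2 f"
  obtains R where "R analytic_on {0}"
    "\<forall>\<^sub>F t in nhds 0. \<phi> (x t, y t) * (J t * (t ^ (n - 1) * (\<Sum>i<N. a' i * t ^ i)) -
       pairing x y (\<lambda>p. - B p) A t) = t ^ N * R t"
proof -
  obtain G where G: "holo_germ G" "\<forall>\<^sub>F p in nhds 0. K N p = snd p ^ N * G p"
    using iterated_hadamard_division[OF K_derivative(1) K_bound[OF N]] by (elim exE conjE)
  define R0 where "R0 = (\<lambda>t. pd1 G (0, t))"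
  have R0: "R0 analytic_on {0}" unfolding R0_def
    by (rule holo_germ_curve[OF holo_germ_pd1[OF G(1)]]) (auto intro: analytic_on_ident)
  note KG = eventually_axis[OF eventually_pd1_power_factor[OF G]]
  note tan = tangent_relation[OF holo_f xy]
  note dx = holo_germ_curve_deriv[OF holo_V12(1) \<gamma>]
  note dy = holo_germ_curve_deriv[OF holo_V12(2) \<gamma>]
  have dp: "deriv (\<lambda>t :: complex. t ^ n) t = of_nat n * t ^ (n - 1)" for t
    by (rule DERIV_imp_deriv) (auto intro!: derivative_eq_intros)
  define T where "T = (\<lambda>t. \<Sum>i<N. a' i * t ^ i)"
  define Q where "Q = pairing x y (\<lambda>p. - B p) A"
  \<comment> \<open>Both partial derivatives are treated, since either of them may vanish
    identically along the curve.\<close>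
  have *: "\<forall>\<^sub>F t in nhds 0. pd2 f (x t, y t) * (J t * (t ^ (n - 1) * T t) - Q t) = t ^ N * (deriv x t * R0 t) \<and>
      pd1 f (x t, y t) * (J t * (t ^ (n - 1) * T t) - Q t) = t ^ N * (- deriv y t * R0 t)"
    using KG K_derivative(2)[of N] tan dx dy
  proof eventually_elim
    case (elim t)
    define f1 f2 where f: "f1 = pd1 f (x t, y t)" "f2 = pd2 f (x t, y t)"
    define v11 v12 v21 v22 where v: "v11 = pd1 V1 (t ^ n, se t)" "v12 = pd2 V1 (t ^ n, se t)"
      "v21 = pd1 V2 (t ^ n, se t)" "v22 = pd2 V2 (t ^ n, se t)"
    define a b where ab: "a = A (x t, y t)" "b = B (x t, y t)"
    define x' y' s' m where x': "x' = deriv x t" "y' = deriv y t" "s' = deriv se t" "m = of_nat n * t ^ (n - 1)"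
    define w where "w = f1 * (a + v12 * T t) + f2 * (b + v22 * T t)"
    have E: "w = t ^ N * R0 t"
      using elim(1,2) by (simp add: R0_def T_def f v ab w_def)
    have tg: "f1 * x' + f2 * y' = 0" using elim(3) by (simp add: pairing_def f x')
    have X: "x' = v11 * m + v12 * s'" "y' = v21 * m + v22 * s'"
      using DERIV_imp_deriv[OF elim(4)] DERIV_imp_deriv[OF elim(5)]
      by (simp_all add: x' v dp x_def[abs_def] y_def[abs_def])
    have key: "J t * (t ^ (n - 1) * T t) - Q t = x' * (b + v22 * T t) - y' * (a + v12 * T t)"
    proof -
      have "J t * (t ^ (n - 1) * T t) = m * (v11 * v22 - v21 * v12) * T t"
        by (simp add: J_def v x' mult_ac)
      also have "\<dots> = (x' * v22 - y' * v12) * T t" unfolding X by (simp add: algebra_simps)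
      finally show ?thesis by (simp add: Q_def pairing_def ab[symmetric] x'[symmetric] algebra_simps)
    qed
    \<comment> \<open>Cramer's rule without division: from the variation \<open>w\<close> and the
      tangency relation, both linear in \<open>f1\<close> and \<open>f2\<close>, this identity
      eliminates \<open>f1\<close> and the next one \<open>f2\<close>.\<close>
    have "f2 * (x' * (b + v22 * T t) - y' * (a + v12 * T t)) = x' * w - (a + v12 * T t) * (f1 * x' + f2 * y')"
      by (simp add: w_def algebra_simps)
    moreover have "f1 * (x' * (b + v22 * T t) - y' * (a + v12 * T t)) = (b + v22 * T t) * (f1 * x' + f2 * y') - y' * w"
      by (simp add: w_def algebra_simps)
    ultimately show ?case unfolding key f[symmetric] x'(1,2)[symmetric] tg E by (simp add: mult_ac)
  qed
  show ?thesis
  proof (rule disjE[OF \<phi>])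
    assume "\<phi> = pd1 f"
    then show ?thesis
      using * by (intro that[of "\<lambda>t. - deriv y t * R0 t"] analytic_on_mult analytic_on_neg analytic_deriv xy R0)
        (auto elim: eventually_mono simp: T_def Q_def)
  next
    assume "\<phi> = pd2 f"
    then show ?thesis
      using * by (intro that[of "\<lambda>t. deriv x t * R0 t"] analytic_on_mult analytic_deriv xy R0)
        (auto elim: eventually_mono simp: T_def Q_def)
  qed
qed

text \<open>Up to a unit and an error beyond order \<open>M\<close>, \<open>t ^ (n - 1)\<close>
  times the velocity polynomial equals the dual form along the curve, so the orders agree; the shift
  by \<open>n - 1\<close> produces the index \<open>Suc M - n\<close>.\<close>

lemma coefficient_velocity:
  assumes M: "germ_ord (pairing x y (\<lambda>p. - B p) A) = enat M"
  shows "n \<le> Suc M" "\<And>i. i + n \<le> M \<Longrightarrow> a' i = 0" "a' (Suc M - n) \<noteq> 0"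
proof -
  obtain \<phi> where \<phi>: "\<phi> = pd1 f \<or> \<phi> = pd2 f" "\<not> (\<forall>\<^sub>F t in nhds 0. \<phi> (x t, y t) = 0)"
    using gradient_nonzero[OF irr_xy] by blast
  have h\<phi>: "holo_germ \<phi>" using \<phi>(1) holo_germ_pd1[OF holo_f] holo_germ_pd2[OF holo_f] by auto
  have a\<phi>: "(\<lambda>t. \<phi> (x t, y t)) analytic_on {0}" by (rule holo_germ_curve[OF h\<phi> xy(1-4)])
  obtain e \<phi>1 where \<phi>1: "\<phi>1 analytic_on {0}" "\<phi>1 0 \<noteq> 0" "\<forall>\<^sub>F t in nhds 0. \<phi> (x t, y t) = t ^ e * \<phi>1 t"
    by (rule analytic_factor[OF a\<phi> \<phi>(2)])
  \<comment> \<open>\<open>e\<close> pays for dividing by \<open>\<phi>\<close>; the excess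
    \<open>Suc n\<close> over \<open>e + M\<close> puts the error beyond order \<open>M\<close> and
    keeps all indices of interest below \<open>N\<close>.\<close>
  define N where "N = e + M + Suc n"
  have "N > 0" by (simp add: N_def)
  then obtain R where R: "R analytic_on {0}"
    "\<forall>\<^sub>F t in nhds 0. \<phi> (x t, y t) * (J t * (t ^ (n - 1) * (\<Sum>i<N. a' i * t ^ i)) -
       pairing x y (\<lambda>p. - B p) A t) = t ^ N * R t"
    by (rule first_variation[OF _ \<phi>(1)])
  have hB: "holo_germ (\<lambda>p. - B p)" using holo_germ_diff[OF holo_germ_const[of 0] B] by simp
  have "(\<lambda>t. t ^ (n - 1) * (\<Sum>i<N. a' i * t ^ i)) analytic_on {0}"
    by (intro analytic_intros)
  moreover from R(2) have "\<forall>\<^sub>F t in nhds 0. \<phi> (x t, y t) * (J t * (t ^ (n - 1) * (\<Sum>i<N. a' i * t ^ i)) -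
       pairing x y (\<lambda>p. - B p) A t) = t ^ (e + M + Suc n) * R t"
    by eventually_elim (simp only: N_def[symmetric])
  ultimately have "germ_ord (\<lambda>t. t ^ (n - 1) * (\<Sum>i<N. a' i * t ^ i)) = enat M"
    by (rule germ_ord_from_approximation[OF a\<phi> analytic_pairing[OF hB A xy(1-4)] M \<phi>1 J R(1)])
  note * = germ_ord_polynomial[OF this]
  show "n \<le> Suc M" using *(1) by linarith
  have "M - (n - 1) = Suc M - n" using *(1) n_pos by linarith
  with *(4) show "a' (Suc M - n) \<noteq> 0" by simp
  show "a' i = 0" if "i + n \<le> M" for i
    using *(2)[of i] that n_pos by (simp add: N_def)
qed

end

section \<open>From velocities to the contact exponent\<close>

lemma irreducible_param_cong:
  assumes "\<forall>\<^sub>F p in nhds 0. g p = h p" "irreducible_param g x y"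
  shows "irreducible_param h x y"
proof -
  note xy = irreducible_paramD(1-5)[OF assms(2)]
  have "\<forall>\<^sub>F t in nhds 0. h (x t, y t) = 0"
    using xy(5) eventually_curve[OF assms(1) xy(1-4)] by eventually_elim simp
  then show ?thesis using assms(2) unfolding irreducible_param_def by (elim conjE) (intro conjI)
qed

lemma local_biholo_inverse:
  assumes "local_biholo \<Theta>"
  obtains \<Phi> where "holo_map \<Theta>" "holo_map \<Phi>"
    "\<forall>\<^sub>F p in nhds 0. \<Phi> (\<Theta> p) = p" "\<forall>\<^sub>F p in nhds 0. \<Theta> (\<Phi> p) = p"
proof -
  have \<Theta>: "holo_map \<Theta>" using assms by (simp add: local_biholo_def holo_map_def o_def)
  obtain \<Phi> where "holo_germ (fst \<circ> \<Phi>)" "holo_germ (snd \<circ> \<Phi>)" "\<Phi> 0 = 0"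
    and inv: "\<forall>\<^sub>F p in nhds 0. \<Phi> (\<Theta> p) = p" "\<forall>\<^sub>F p in nhds 0. \<Theta> (\<Phi> p) = p"
    using assms unfolding local_biholo_def by (elim conjE exE)
  then have "holo_map \<Phi>" by (simp add: holo_map_def o_def)
  from \<Theta> this inv show ?thesis by (rule that)
qed

text \<open>The derivative is controlled only for times below \<open>r\<close>; the identity theorem
  carries constancy from the small disc to the whole ball.\<close>

lemma constant_on_ball_if_deriv_zero:
  assumes h: "h holomorphic_on ball 0 \<delta>" and r: "0 < r" "r \<le> \<delta>"
    and 0: "\<And>e :: complex. norm e < r \<Longrightarrow> deriv h e = 0"
  shows "h constant_on ball 0 \<delta>"
proof -
  have "(h has_field_derivative 0) (at e within ball 0 r)" if "e \<in> ball 0 r" for e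
  proof -
    have "(h has_field_derivative deriv h e) (at e)"
      by (rule holomorphic_derivI[OF h]) (use that r in auto)
    then have "(h has_field_derivative 0) (at e)" using 0[of e] that by simp
    then show ?thesis by (rule has_field_derivative_at_within)
  qed
  then obtain c where c: "\<forall>e\<in>ball 0 r. h e = c"
    using has_field_derivative_zero_constant[of "ball 0 r" h] by auto
  have "h e = c" if "e \<in> ball 0 \<delta>" for e
    by (rule analytic_continuation_open[of "ball 0 r" "ball 0 \<delta>" h "\<lambda>_. c"]) (use h r c that in auto)
  then show ?thesis unfolding constant_on_def by auto
qed

theorem theorem3:
  fixes A B f :: "complex \<times> complex \<Rightarrow> complex"
    and x y :: "complex \<Rightarrow> complex"
    and n :: nat and k :: enat
  assumes "holo_germ A" and "holo_germ B"
    and "A 0 = 0" and "B 0 = 0"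
    and "branch f" and "curve_multiplicity f = n"
    and "\<not> invariant_curve A B f"
    and "irreducible_param f x y"
    and "has_contact_exponent A B f k"
  shows "k \<noteq> \<infinity> \<and> form_contact x y (dual_form A B) = k + enat n"
proof -
  obtain \<psi> \<Theta> S \<delta> where opg: "one_parameter_group A B \<psi>" and bi: "local_biholo \<Theta>" and \<delta>: "\<delta> > 0"
    and pui: "\<forall>\<epsilon>\<in>ball 0 \<delta>. puiseux_param (f \<circ> \<psi> \<epsilon> \<circ> \<Theta>) (curve_multiplicity f) (S \<epsilon>)"
    and hol: "\<forall>i. (\<lambda>\<epsilon>. fps_nth (S \<epsilon>) i) holomorphic_on ball 0 \<delta>"
    and k: "k = Inf (enat ` {i. \<not> (\<lambda>\<epsilon>. fps_nth (S \<epsilon>) i) constant_on ball 0 \<delta>})"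
    using assms(9) unfolding has_contact_exponent_def by (elim exE conjE)
  have pui': "puiseux_param (\<lambda>p. f (\<psi> \<epsilon> (\<Theta> p))) n (S \<epsilon>)" if "norm \<epsilon> < \<delta>" for \<epsilon>
    using pui that assms(6) by (simp add: o_def)
  obtain \<Phi> where \<Theta>: "holo_map \<Theta>" and \<Phi>: "holo_map \<Phi>"
    and inv: "\<forall>\<^sub>F p in nhds 0. \<Phi> (\<Theta> p) = p" "\<forall>\<^sub>F p in nhds 0. \<Theta> (\<Phi> p) = p"
    by (rule local_biholo_inverse[OF bi])
  \<comment> \<open>The flow at time 0 is the identity only as a germ, so the parametrization at
    time 0 is transferred to the undeformed equation through a germ identity.\<close>
  have "\<forall>\<^sub>F p in nhds 0. \<psi> 0 p = p" using opg by (simp add: one_parameter_group_def)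
  from holo_map_eventually[OF this \<Theta>] have "\<forall>\<^sub>F p in nhds 0. f (\<psi> 0 (\<Theta> p)) = f (\<Theta> p)"
    by eventually_elim simp
  moreover have "irreducible_param (\<lambda>p. f (\<psi> 0 (\<Theta> p))) (\<lambda>t. t ^ n) (eval_fps (S 0))"
    using pui'[of 0] \<delta> by (simp add: puiseux_param_def)
  ultimately have irr: "irreducible_param (\<lambda>p. f (\<Theta> p)) (\<lambda>t. t ^ n) (eval_fps (S 0))"
    by (rule irreducible_param_cong)
  interpret parametrized_branch f \<Theta> \<Phi> n "eval_fps (S 0)"
    by unfold_locales (fact assms(5) \<Theta> \<Phi> inv irr)+
  have hB: "holo_germ (\<lambda>p. - B p)" using holo_germ_diff[OF holo_germ_const[of 0] assms(2)] by simp
  \<comment> \<open>Non-invariance makes the order finite.\<close>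
  have "\<not> (\<forall>\<^sub>F t in nhds 0. pairing cx cy (\<lambda>p. - B p) A t = 0)"
    using invariant_if_infinite_contact[OF assms(1,2)] assms(7) by auto
  then obtain M where M: "germ_ord (pairing cx cy (\<lambda>p. - B p) A) = enat M"
    by (rule analytic_factor[OF analytic_pairing[OF hB assms(1) c_props(1-4)]])
  obtain \<delta>' where \<delta>': "\<delta>' > 0"
    and map: "\<forall>s. norm s < \<delta>' \<longrightarrow> holo_map (\<psi> s)"
    and ret: "\<forall>s. norm s < \<delta>' \<longrightarrow> (\<forall>\<^sub>F p in nhds 0. \<psi> (- s) (\<psi> s p) = p)"
    and fd: "\<forall>s. norm s < \<delta>' \<longrightarrow> (\<forall>\<^sub>F z in nhds (s, 0). flow_derivative A B \<psi> (fst z) (snd z))"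
    by (rule flow_local[OF assms(1,3,2,4) opg])
  define r where "r = min \<delta> \<delta>'"
  have r: "r > 0" "r \<le> \<delta>" "r \<le> \<delta>'" using \<delta> \<delta>' by (auto simp: r_def)
  \<comment> \<open>\<open>M\<close> is read off the reference parametrization, but it is also the
    order along \<open>(D.x, D.y)\<close> at any small time, as these are primitive parametrizations
    of the same branch. So the indices do not depend on \<open>\<epsilon>\<close>.\<close>
  have vel: "n \<le> Suc M \<and> (\<forall>i. i + n \<le> M \<longrightarrow> deriv (\<lambda>e. fps_nth (S e) i) \<epsilon> = 0) \<and>
      deriv (\<lambda>e. fps_nth (S e) (Suc M - n)) \<epsilon> \<noteq> 0" if \<epsilon>: "norm \<epsilon> < r" for \<epsilon>
  proof -
    have near: "\<forall>\<^sub>F \<sigma> in nhds 0. norm (\<epsilon> + \<sigma>) < r"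
    proof -
      have "\<forall>\<^sub>F s in nhds \<epsilon>. s \<in> ball 0 r" using \<epsilon> by (intro eventually_nhds_in_open) auto
      from eventually_subst[OF this, where g = "\<lambda>\<sigma>. \<epsilon> + \<sigma>" and a = 0] show ?thesis
        by (auto intro: continuous_intros)
    qed
    interpret D: deformed_branch f \<Theta> \<Phi> n "eval_fps (S 0)" A B \<psi> S \<epsilon>
    proof
      show "\<forall>\<^sub>F \<sigma> in nhds 0. holo_map (\<psi> (\<epsilon> + \<sigma>))"
        using near by eventually_elim (use map r in auto)
      show "\<forall>\<^sub>F \<sigma> in nhds 0. puiseux_param (\<lambda>p. f (\<psi> (\<epsilon> + \<sigma>) (\<Theta> p))) n (S (\<epsilon> + \<sigma>))"
        using near by eventually_elim (use pui' r in auto)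
      show "(\<lambda>e. fps_nth (S e) i) analytic_on {\<epsilon>}" for i
        unfolding analytic_at using hol \<epsilon> r by (intro exI[of _ "ball 0 \<delta>"]) auto
    qed (use assms map ret fd \<epsilon> r in auto)
    have "germ_ord (pairing D.x D.y (\<lambda>p. - B p) A) = enat M"
      using germ_ord_pairing[OF D.irr_xy hB assms(1)] M by simp
    from D.coefficient_velocity[OF this] show ?thesis unfolding D.a'_def by auto
  qed
  define m where "m = Suc M - n"
  have nM: "n \<le> Suc M" using vel[of 0] r by simp
  \<comment> \<open>Constancy needs vanishing velocity on a whole disc of times.\<close>
  have const: "(\<lambda>\<epsilon>. fps_nth (S \<epsilon>) i) constant_on ball 0 \<delta>" if "i < m" for i
    by (rule constant_on_ball_if_deriv_zero[OF hol[rule_format] r(1,2)]) (use vel that in \<open>auto simp: m_def\<close>)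
  \<comment> \<open>For the index \<open>m\<close> the nonzero velocity at time 0 alone
    suffices.\<close>
  have nonconst: "\<not> (\<lambda>\<epsilon>. fps_nth (S \<epsilon>) m) constant_on ball 0 \<delta>"
  proof
    assume "(\<lambda>\<epsilon>. fps_nth (S \<epsilon>) m) constant_on ball 0 \<delta>"
    then obtain c where c: "\<forall>\<epsilon>\<in>ball 0 \<delta>. fps_nth (S \<epsilon>) m = c" unfolding constant_on_def by auto
    have "\<forall>\<^sub>F \<epsilon> in nhds (0 :: complex). \<epsilon> \<in> ball 0 \<delta>" using \<delta> by (intro eventually_nhds_in_open) auto
    then have "\<forall>\<^sub>F \<epsilon> in nhds 0. fps_nth (S \<epsilon>) m = c" by eventually_elim (use c in auto)
    from eventually_nhds_x_imp_x[OF eventually_deriv_eq[OF this]] vel[of 0] r show False by (simp add: m_def)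
  qed
  have "k = enat m"
    unfolding k
  proof (rule cInf_eq_minimum)
    show "enat m \<in> enat ` {i. \<not> (\<lambda>\<epsilon>. fps_nth (S \<epsilon>) i) constant_on ball 0 \<delta>}" using nonconst by auto
    show "enat m \<le> j" if "j \<in> enat ` {i. \<not> (\<lambda>\<epsilon>. fps_nth (S \<epsilon>) i) constant_on ball 0 \<delta>}" for j
      using that const by (force simp: not_less)
  qed
  moreover have "form_contact x y (dual_form A B) = germ_ord (pairing x y (\<lambda>p. - B p) A) + 1"
    by (simp add: form_contact_def dual_form_def pairing_def[abs_def])
  moreover have "germ_ord (pairing x y (\<lambda>p. - B p) A) = enat M"
    using germ_ord_pairing[OF assms(8) hB assms(1)] M by simp
  \<comment> \<open>The contact is \<open>M + 1\<close>, and \<open>n \<le> Suc M\<close> makes the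
    natural-number subtraction in \<open>m\<close> exact, so \<open>m + n = Suc M\<close>.\<close>
  ultimately show ?thesis using nM by (simp add: m_def one_enat_def)
qed

end
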